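(* Let $B$ be a real $c\times c$ matrix all of whose eigenvalues have zero real part, and let $A$ be a real $(u+s)\times(u+s)$ matrix with $u$ eigenvalues of positive real part and $s$ eigenvalues of negative real part (with multiplicity). Let $n=c+u+s$ and consider $$\dot{\mathbf x}=B\mathbf x+g(\mathbf x,\mathbf y),\qquad \dot{\mathbf y}=A\mathbf y+h(\mathbf x,\mathbf y),\qquad (\mathbf x,\mathbf y)\in\mathbb R^c\times\mathbb R^{u+s},$$ with an equilibrium at $0$ and linearization $\mathrm{diag}(B,A)$ there, where $g,h$ are bounded and Lipschitz, $$|g(\mathbf x_1,\mathbf y_1)-g(\mathbf x_2,\mathbf y_2)|\le c_1|\mathbf x_1-\mathbf x_2|+c_2|\mathbf y_1-\mathbf y_2|,\quad |h(\mathbf x_1,\mathbf y_1)-h(\mathbf x_2,\mathbf y_2)|\le d_1|\mathbf x_1-\mathbf x_2|+d_2|\mathbf y_1-\mathbf y_2|,$$ with sufficiently small constants $c_1,c_2,d_1,d_2$ (smaller than some bound depending on $A,B$). Then the system has $u$ unstable (generalized) eigenfunctions $s_1,\dots,s_u$ and $s$ stable (generalized) eigenfunctions $s_{u+1},\dots,s_{u+s}$ of the Koopman operator. Moreover, the joint zero level set $$L_{cs}=\{\mathbf z\in\mathbb R^n\mid s_1(\mathbf z)=0,\dots,s_u(\mathbf z)=0\}$$ is the center-stable manifold $W^{cs}$, $$L_c=\{\mathbf z\in\mathbb R^n\mid s_1(\mathbf z)=0,\dots,s_u(\mathbf z)=0,\ s_{u+1}(\mathbf z)=0,\dots,s_{u+s}(\mathbf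 z)=0\}$$ is the (global, unique) center manifold $W^c$, and $$L_{cu}=\{\mathbf z\in\mathbb R^n\mid s_{u+1}(\mathbf z)=0,\dots,s_{u+s}(\mathbf z)=0\}$$ is the center-unstable manifold $W^{cu}$.
   Context: $U^t f=f\circ S^t$ is the Koopman operator of the flow $S^t$. A family of (continuous) functions is a family of (generalized) Koopman eigenfunctions if the vector $\mathbf s$ of these functions satisfies $\frac{d}{dt}\mathbf s(S^t\mathbf z)=J\mathbf s(S^t\mathbf z)$ along trajectories with $J$ a matrix in complex Jordan normal form; they are called unstable (stable) when the associated eigenvalues, here those of $A$, have positive (negative) real part. Under the stated hypotheses Palmer's linearization theorem provides a homeomorphism $(\mathbf x,\mathbf y)\mapsto(\tilde{\mathbf x},\tilde{\mathbf y})$ of $\mathbb R^n$ conjugating the system to $\dot{\tilde{\mathbf x}}=B\tilde{\mathbf x}+\tilde g(\tilde{\mathbf x})$, $\dot{\tilde{\mathbf y}}=A\tilde{\mathbf y}$, with $\tilde g$ bounded and Lipschitz. In terms of this conjugacy, the global center manifold $W^c$ is the preimage of $\{\tilde{\mathbf y}=0\}$ (so the dynamics on it is $\dot{\tilde{\mathbf x}}=B\tilde{\mathbf x}+\tilde g(\tilde{\mathbf x})$); the center-stable manifold $W^{cs}$ is the preimage of the set where $\tilde{\mathbf y}$ lies in the stable subspace of $A$; the center-unstable manifold $W^{cu}$ is the preimage of the set where $\tilde{\mathbf y}$ lies in the unstable subspace of $A$. *)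

theory Defs
  imports "HOL-Analysis.Analysis" "Jordan_Normal_Form.Jordan_Normal_Form"
begin

no_notation Matrix.vec_index (infixl "$" 100)

(* Bridge from matrices indexed by a finite type to the explicitly sized matrices that
   jordan_nf, char_poly and eigenvalue are about.  Another enumeration of the index type gives a
   permutation-similar matrix, so none of these three notions depends on the choice made here. *)

definition idx_enum :: "nat \<Rightarrow> 'n::finite" where
  "idx_enum = (SOME e. bij_betw e {..<CARD('n)} (UNIV :: 'n set))"

definition cmat :: "real^'n^'n \<Rightarrow> complex mat" where
  "cmat A = Matrix.mat CARD('n) CARD('n) (\<lambda>(i, j). complex_of_real (A $ idx_enum i $ idx_enum j))"

definition num_eigenvalues :: "real^'n^'n \<Rightarrow> (complex \<Rightarrow> bool) \<Rightarrow> nat" where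
  "num_eigenvalues A P =
     (\<Sum>\<mu> | eigenvalue (cmat A) \<mu> \<and> P \<mu>. Polynomial.order \<mu> (char_poly (cmat A)))"

(* The real points of the complex span of the generalized eigenvectors whose eigenvalues satisfy P. *)
definition spectral_subspace :: "real^'n^'n \<Rightarrow> (complex \<Rightarrow> bool) \<Rightarrow> (real^'n) set" where
  "spectral_subspace A P = {y. (\<chi> i. complex_of_real (y $ i)) \<in>
     vec.span {w. \<exists>\<mu> k. P \<mu> \<and>
       ((\<lambda>v. map_matrix complex_of_real A *v v - \<mu> *s v) ^^ k) w = 0}}"

definition stable_subspace :: "real^'n^'n \<Rightarrow> (real^'n) set" where
  "stable_subspace A = spectral_subspace A (\<lambda>\<mu>. Re \<mu> < 0)"

definition unstable_subspace :: "real^'n^'n \<Rightarrow> (real^'n) set" where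
  "unstable_subspace A = spectral_subspace A (\<lambda>\<mu>. Re \<mu> > 0)"

definition is_flow :: "('a::real_normed_vector \<Rightarrow> 'a) \<Rightarrow> (real \<Rightarrow> 'a \<Rightarrow> 'a) \<Rightarrow> bool" where
  "is_flow F S \<longleftrightarrow> (\<forall>z. S 0 z = z \<and>
     (\<forall>t. ((\<lambda>\<tau>. S \<tau> z) has_vector_derivative F (S t z)) (at t)))"

(* Only used for globally Lipschitz F, for which the complete flow exists and is unique. *)
definition flow :: "('a::real_normed_vector \<Rightarrow> 'a) \<Rightarrow> real \<Rightarrow> 'a \<Rightarrow> 'a" where
  "flow F = (THE S. is_flow F S)"

definition koopman :: "('a::real_normed_vector \<Rightarrow> 'a) \<Rightarrow> real \<Rightarrow> ('a \<Rightarrow> complex) \<Rightarrow> 'a \<Rightarrow> complex" where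
  "koopman F t f = f \<circ> flow F t"

(* The functions \<phi> 0, ..., \<phi> (m - 1), where m is the size of the Jordan matrix J. *)
definition gen_koopman_eigenfunctions ::
  "('a::real_normed_vector \<Rightarrow> 'a) \<Rightarrow> (nat \<times> complex) list \<Rightarrow> (nat \<Rightarrow> 'a \<Rightarrow> complex) \<Rightarrow> bool" where
  "gen_koopman_eigenfunctions F n_as \<phi> \<longleftrightarrow>
     (let J = jordan_matrix n_as; m = dim_row J in
      \<forall>i<m. continuous_on UNIV (\<phi> i) \<and>
        (\<forall>z t. ((\<lambda>\<tau>. koopman F \<tau> (\<phi> i) z) has_vector_derivative
                 (\<Sum>j<m. J $$ (i, j) * koopman F t (\<phi> j) z)) (at t)))"

definition coupled_field ::
  "real^'c^'c \<Rightarrow> real^'m^'m \<Rightarrow> ((real^'c) \<times> (real^'m) \<Rightarrow> real^'c) \<Rightarrow>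
   ((real^'c) \<times> (real^'m) \<Rightarrow> real^'m) \<Rightarrow> (real^'c) \<times> (real^'m) \<Rightarrow> (real^'c) \<times> (real^'m)" where
  "coupled_field B A g h = (\<lambda>(x, y). (B *v x + g (x, y), A *v y + h (x, y)))"

definition palmer_conjugacy ::
  "real^'c^'c \<Rightarrow> real^'m^'m \<Rightarrow> ((real^'c) \<times> (real^'m) \<Rightarrow> (real^'c) \<times> (real^'m)) \<Rightarrow>
   (real^'c \<Rightarrow> real^'c) \<Rightarrow> ((real^'c) \<times> (real^'m) \<Rightarrow> (real^'c) \<times> (real^'m)) \<Rightarrow> bool" where
  "palmer_conjugacy B A F gt H \<longleftrightarrow>
     (\<exists>H'. homeomorphism UNIV UNIV H H') \<and>
     bounded (range gt) \<and> (\<exists>L. L-lipschitz_on UNIV gt) \<and>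
     (\<forall>t z. H (flow F t z) = flow (coupled_field B A (\<lambda>(x, y). gt x) (\<lambda>_. 0)) t (H z))"

definition center_manifold ::
  "((real^'c) \<times> (real^'m) \<Rightarrow> (real^'c) \<times> (real^'m)) \<Rightarrow> ((real^'c) \<times> (real^'m)) set" where
  "center_manifold H = {z. snd (H z) = 0}"

definition center_stable_manifold ::
  "real^'m^'m \<Rightarrow> ((real^'c) \<times> (real^'m) \<Rightarrow> (real^'c) \<times> (real^'m)) \<Rightarrow> ((real^'c) \<times> (real^'m)) set" where
  "center_stable_manifold A H = {z. snd (H z) \<in> stable_subspace A}"

definition center_unstable_manifold ::
  "real^'m^'m \<Rightarrow> ((real^'c) \<times> (real^'m) \<Rightarrow> (real^'c) \<times> (real^'m)) \<Rightarrow> ((real^'c) \<times> (real^'m)) set" where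
  "center_unstable_manifold A H = {z. snd (H z) \<in> unstable_subspace A}"

(* The sense in which the center manifold is global and unique: it is a flow-invariant graph of a
   bounded continuous function over the whole center space, and there is only one such graph.
   An arbitrary topological conjugacy alone would not determine the preimage of y = 0: the flow
   x' = - x^3 / (1 + x^4), y' = - y has self-conjugacies that move the x-axis. *)
definition global_center_graph ::
  "((real^'c) \<times> (real^'m) \<Rightarrow> (real^'c) \<times> (real^'m)) \<Rightarrow> ((real^'c) \<times> (real^'m)) set \<Rightarrow> bool" where
  "global_center_graph F W \<longleftrightarrow>
     (\<exists>v. continuous_on UNIV v \<and> bounded (range v) \<and> W = range (\<lambda>x. (x, v x))) \<and>
     (\<forall>t. flow F t ` W \<subseteq> W)"

definition unique_global_center_manifold ::
  "((real^'c) \<times> (real^'m) \<Rightarrow> (real^'c) \<times> (real^'m)) \<Rightarrow> ((real^'c) \<times> (real^'m)) set \<Rightarrow> bool" where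
  "unique_global_center_manifold F W \<longleftrightarrow>
     global_center_graph F W \<and> (\<forall>W'. global_center_graph F W' \<longrightarrow> W' = W)"

end

theory Submission
  imports Defs "Jordan_Normal_Form.Jordan_Normal_Form_Existence"
begin

text \<open>
  In rescaled Jordan coordinates the linear part is expanding, contracting or almost isometric on the
  unstable, stable and centre components.  For small Lipschitz constants the difference of two
  orbits then obeys a cone condition: a quadratic form \<open>V\<close> which compares the unstable component with
  the other ones satisfies \<open>V' \<ge> k V\<close>.  This gives the unstable foliation without a fixed point argument
  in a function space: two points share a leaf if their difference stays in the cone for all times;
  uniqueness follows from the growth of \<open>V\<close>, existence from Brouwer's theorem at time \<open>- n\<close> and a
  compactness argument as \<open>n\<close> tends to infinity.  Reversing time gives the stable foliation.

  The hyperbolic coordinate \<open>Y\<close> of the conjugacy is the limit of \<open>exp (- t A) y(t)\<close> in the unstable directions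
  (and its time reversal in the stable ones), so it evolves exactly linearly.  The centre coordinate of
  a point is found by sliding it along its unstable and then along a stable leaf to the set \<open>Y = 0\<close>, which is the
  graph of a bounded Lipschitz function.  The map obtained in this way is a continuous bijection, hence a
  homeomorphism by invariance of domain.  The eigenfunctions are the Jordan coordinates of \<open>Y\<close>.
\<close>

section \<open>Flows of Lipschitz vector fields\<close>

text \<open>Boundedness and smallness of the perturbation do different work. Boundedness keeps the
  linearizing coordinate within a fixed distance of the unstable component, so prescribed values of
  it are attained by Brouwer's theorem without a contraction estimate. Smallness enters through the
  differential inequalities for \<open>V\<close> and \<open>qu\<close>, and these give uniqueness.
  Limits and continuity of the leaf projections then follow softly: sharing a leaf is a closed
  condition, and a bounded sequence has only one possible limit.

  The cone is not convex, so it is not evident that sharing a leaf is transitive. This rests on a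
  gap of rates: backward in time \<open>q\<close> decays like exp(a t) on a leaf, whereas
  \<open>V\<close> grows at the smaller rate a/2; any pair of points with the faster decay must be
  in the cone at all times.

  The constants 1/4 in \<open>V\<close>, a/8 for the centre and a/64 for the perturbation are
  balanced so that the inequality for \<open>V\<close> leaves no slack in the centre
  direction.\<close>

lemma exp_lower_bound_deriv:
  fixes f f' :: "real \<Rightarrow> real"
  assumes "\<And>t. (f has_real_derivative f' t) (at t)" and "\<And>t. k * f t \<le> f' t" and "s \<le> t"
  shows "exp (k * (t - s)) * f s \<le> f t"
proof -
  have "exp (- k * s) * f s \<le> exp (- k * t) * f t"
  proof (rule DERIV_nonneg_imp_nondecreasing[OF \<open>s \<le> t\<close>])
    fix x
    have "((\<lambda>t. exp (- k * t) * f t) has_real_derivative exp (- k * x) * (f' x - k * f x)) (at x)"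
      by (auto intro!: derivative_eq_intros assms(1) simp: algebra_simps)
    moreover have "exp (- k * x) * (f' x - k * f x) \<ge> 0"
      using assms(2)[of x] by simp
    ultimately show "\<exists>y. ((\<lambda>t. exp (- k * t) * f t) has_real_derivative y) (at x) \<and> 0 \<le> y"
      by blast
  qed
  then have "exp (k * t) * (exp (- k * s) * f s) \<le> exp (k * t) * (exp (- k * t) * f t)"
    by (intro mult_left_mono) auto
  moreover have "exp (k * t) * exp (- k * s) = exp (k * (t - s))" "exp (k * t) * exp (- k * t) = 1"
    by (simp_all add: exp_add[symmetric] right_diff_distrib)
  ultimately show ?thesis
    by (simp only: mult.assoc[symmetric])
qed

lemma exp_upper_bound_deriv:
  fixes f f' :: "real \<Rightarrow> real"
  assumes "\<And>t. (f has_real_derivative f' t) (at t)" and "\<And>t. f' t \<le> k * f t" and "s \<le> t"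
  shows "f t \<le> exp (k * (t - s)) * f s"
  using exp_lower_bound_deriv[where f = "\<lambda>t. - f t" and f' = "\<lambda>t. - f' t" and k = k and s = s and t = t] assms
  by (auto intro!: derivative_eq_intros)

lemma has_derivative_norm_square:
  fixes x :: "real \<Rightarrow> 'a::real_inner"
  assumes "(x has_vector_derivative x') (at t)"
  shows "((\<lambda>t. (norm (x t))\<^sup>2) has_real_derivative 2 * inner x' (x t)) (at t)"
proof -
  have "((\<lambda>t. inner (x t) (x t)) has_derivative
      (\<lambda>h. inner (x t) (h *\<^sub>R x') + inner (h *\<^sub>R x') (x t))) (at t)"
    using assms unfolding has_vector_derivative_def
    by (auto intro!: derivative_eq_intros)
  then show ?thesis
    unfolding has_field_derivative_def power2_norm_eq_inner
    by (rule has_derivative_eq_rhs) (auto simp: inner_commute)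
qed

lemma has_vector_derivative_reverse:
  assumes "(f has_vector_derivative f') (at (- t))"
  shows "((\<lambda>s. f (- s)) has_vector_derivative - f') (at t)"
proof -
  have "((f \<circ> uminus) has_vector_derivative (- 1) *\<^sub>R f') (at t)"
    by (rule vector_diff_chain_at) (use assms in \<open>auto intro!: derivative_eq_intros\<close>)
  then show ?thesis by (simp add: o_def)
qed

lemma has_vector_derivative_shift:
  assumes "(f has_vector_derivative f') (at (t + c))"
  shows "((\<lambda>s. f (s + c)) has_vector_derivative f') (at t)"
proof -
  have "((f \<circ> (\<lambda>s. s + c)) has_vector_derivative 1 *\<^sub>R f') (at t)"
    by (rule vector_diff_chain_at) (use assms in \<open>auto intro!: derivative_eq_intros\<close>)
  then show ?thesis by (simp add: o_def)
qed

section \<open>Global existence and uniqueness of solutions\<close>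

lemma antiderivative_exists:
  fixes f :: "real \<Rightarrow> 'a::euclidean_space"
  assumes "continuous_on UNIV f"
  obtains G where "G 0 = 0" and "\<And>t. (G has_vector_derivative f t) (at t)"
proof -
  obtain G where G: "\<And>x. (G has_vector_derivative f x) (at x)"
    using einterval_antiderivative[of "-\<infinity>" "\<infinity>" f] assms
    by (auto simp: continuous_on_eq_continuous_at)
  show ?thesis
    by (rule that[of "\<lambda>t. G t - G 0"]) (auto intro!: derivative_eq_intros G)
qed

text \<open>Integrating the weight gains the factor 1/k. For k large against the Lipschitz constant
  this gain makes Picard iteration a contraction. Negative times reduce to positive ones by
  reflecting the curve.\<close>

lemma norm_antiderivative_exp_le:
  fixes G f :: "real \<Rightarrow> 'a::real_normed_vector"
  assumes "G 0 = 0" and "\<And>t. (G has_vector_derivative f t) (at t)"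
    and "k > 0" and "C \<ge> 0" and "\<And>t. norm (f t) \<le> C * exp (k * \<bar>t\<bar>)"
  shows "norm (G t) \<le> C / k * exp (k * \<bar>t\<bar>)"
proof -
  have *: "norm (G t) \<le> C / k * exp (k * t)"
    if "G 0 = 0" "\<And>t. (G has_vector_derivative f t) (at t)" "t > 0"
      "\<And>t. t > 0 \<Longrightarrow> norm (f t) \<le> C * exp (k * t)" for G f :: "real \<Rightarrow> 'a" and t
  proof -
    have "norm (G t - G 0) \<le> C / k * exp (k * t) - C / k * exp (k * 0)"
    proof (rule differentiable_bound_general[OF \<open>t > 0\<close>])
      show "continuous_on {0..t} G"
        using that(2) by (intro continuous_at_imp_continuous_on) (blast intro: has_vector_derivative_continuous)
      show "((\<lambda>t. C / k * exp (k * t)) has_vector_derivative C * exp (k * x)) (at x)" for x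
        using \<open>k > 0\<close> unfolding has_real_derivative_iff_has_vector_derivative[symmetric]
        by (auto intro!: derivative_eq_intros)
    qed (use that \<open>k > 0\<close> in \<open>auto intro!: continuous_intros\<close>)
    moreover have "C / k \<ge> 0" using assms by simp
    ultimately show ?thesis using that(1) by simp
  qed
  consider "t = 0" | "t > 0" | "t < 0" by linarith
  then show ?thesis
  proof cases
    case 1 then show ?thesis using assms by simp
  next
    case 2
    have "norm (f s) \<le> C * exp (k * s)" if "s > 0" for s
      using assms(5)[of s] that by simp
    from *[OF assms(1,2) 2 this] show ?thesis using 2 by simp
  next
    case 3
    have "norm (G (- (- t))) \<le> C / k * exp (k * (- t))"
    proof (rule *[of "\<lambda>s. G (- s)" "\<lambda>s. - f (- s)"])
      show "((\<lambda>s. G (- s)) has_vector_derivative - f (- s)) (at s)" for s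
        by (rule has_vector_derivative_reverse) (rule assms(2))
      show "norm (- f (- s)) \<le> C * exp (k * s)" if "s > 0" for s
        using assms(5)[of "- s"] that by simp
    qed (use assms 3 in auto)
    then show ?thesis using 3 by simp
  qed
qed

text \<open>Picard iteration is a contraction for the norm with weight \<open>exp (- 2 K \<bar>t\<bar>)\<close>
  on the whole time line, so no continuation of local solutions is needed.\<close>

lemma lipschitz_ode_solution_exists:
  fixes F :: "'a::euclidean_space \<Rightarrow> 'a"
  assumes lip: "K-lipschitz_on UNIV F"
  shows "\<exists>x. x 0 = z \<and> (\<forall>t. (x has_vector_derivative F (x t)) (at t))"
proof -
  \<comment> \<open>The contraction factor will be K/k, hence at most 1/2; K + 1 instead of K keeps
    k positive when K = 0.\<close>
  define k where "k = 2 * (K + 1)"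
  have K: "K \<ge> 0" using lip by (rule lipschitz_on_nonneg)
  then have k: "k > 0" "K \<le> k / 2" by (auto simp: k_def)
  have lipF: "norm (F x - F y) \<le> K * norm (x - y)" for x y
    using lipschitz_onD[OF lip, of x y] by (simp add: dist_norm)
  have contF: "continuous_on UNIV F"
    using lip lipschitz_on_continuous_on by blast
  define w where "w t = exp (k * \<bar>t\<bar>)" for t :: real
  have w: "w t \<ge> 1" "w t > 0" "w t \<noteq> 0" for t
    using k by (auto simp: w_def)
  have contw: "continuous_on UNIV w"
    unfolding w_def by (intro continuous_intros)
  \<comment> \<open>The unknown is the rescaled curve \<phi> = x / w, an element of the complete
    space of bounded continuous functions. The integral of \<open>F\<close> along w \<phi> is taken
    as the antiderivative that vanishes at 0.\<close>
  define I where "I \<phi> = (SOME G. G 0 = 0 \<and>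
      (\<forall>t. (G has_vector_derivative F (w t *\<^sub>R apply_bcontfun \<phi> t)) (at t)))"
    for \<phi> :: "real \<Rightarrow>\<^sub>C 'a"
  have I: "I \<phi> 0 = 0" "(I \<phi> has_vector_derivative F (w t *\<^sub>R apply_bcontfun \<phi> t)) (at t)" for \<phi> t
  proof -
    have "continuous_on UNIV (\<lambda>t. F (w t *\<^sub>R apply_bcontfun \<phi> t))"
      by (rule continuous_on_compose2[OF contF])
        (auto intro!: continuous_intros contw continuous_on_apply_bcontfun)
    then have "\<exists>G. G 0 = 0 \<and> (\<forall>t. (G has_vector_derivative F (w t *\<^sub>R apply_bcontfun \<phi> t)) (at t))"
      by (rule antiderivative_exists) blast
    from someI_ex[OF this, folded I_def]
    show "I \<phi> 0 = 0" "(I \<phi> has_vector_derivative F (w t *\<^sub>R apply_bcontfun \<phi> t)) (at t)" by auto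
  qed
  have bI: "norm (I \<phi> t) \<le> (norm (F 0) + K * norm \<phi>) / k * w t" for \<phi> t
    unfolding w_def
  proof (rule norm_antiderivative_exp_le[OF I \<open>k > 0\<close>])
    fix t
    have "norm (F (w t *\<^sub>R apply_bcontfun \<phi> t)) \<le> norm (F 0) + K * norm (w t *\<^sub>R apply_bcontfun \<phi> t)"
      using lipF[of "w t *\<^sub>R apply_bcontfun \<phi> t" 0] norm_triangle_sub[of "F (w t *\<^sub>R apply_bcontfun \<phi> t)" "F 0"]
      by simp
    also have "\<dots> \<le> norm (F 0) * w t + K * (w t * norm \<phi>)"
      using w[of t] K norm_bounded[where f = \<phi> and x = t]
      by (intro add_mono mult_left_mono) (auto simp: mult_le_cancel_left1)
    finally show "norm (F (w t *\<^sub>R apply_bcontfun \<phi> t)) \<le> (norm (F 0) + K * norm \<phi>) * exp (k * \<bar>t\<bar>)"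
      by (simp add: w_def algebra_simps)
  qed (use K in auto)
  define \<Phi> where "\<Phi> \<phi> = Bcontfun (\<lambda>t. (1 / w t) *\<^sub>R (z + I \<phi> t))" for \<phi>
  have \<Phi>: "apply_bcontfun (\<Phi> \<phi>) t = (1 / w t) *\<^sub>R (z + I \<phi> t)" for \<phi> t
  proof -
    have "continuous_on UNIV (I \<phi>)"
      using I(2) by (intro continuous_at_imp_continuous_on) (blast intro: has_vector_derivative_continuous)
    then have "continuous_on UNIV (\<lambda>t. (1 / w t) *\<^sub>R (z + I \<phi> t))"
      using w(3) contw by (intro continuous_intros) auto
    moreover have "norm ((1 / w t) *\<^sub>R (z + I \<phi> t)) \<le> norm z + (norm (F 0) + K * norm \<phi>) / k" for t
    proof -
      have "norm (z + I \<phi> t) \<le> norm z * w t + (norm (F 0) + K * norm \<phi>) / k * w t"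
        using bI[of \<phi> t] w(1)[of t] norm_triangle_ineq[of z "I \<phi> t"]
          mult_left_mono[OF w(1)[of t] norm_ge_zero[of z]] by simp
      also have "\<dots> = (norm z + (norm (F 0) + K * norm \<phi>) / k) * w t"
        by (simp only: distrib_right)
      finally show ?thesis using w(2)[of t] by (simp add: pos_divide_le_eq)
    qed
    ultimately have "(\<lambda>t. (1 / w t) *\<^sub>R (z + I \<phi> t)) \<in> bcontfun"
      by (intro bcontfun_normI)
    then show ?thesis by (simp add: \<Phi>_def Bcontfun_inverse)
  qed
  have "dist (\<Phi> \<phi>) (\<Phi> \<psi>) \<le> 1 / 2 * dist \<phi> \<psi>" for \<phi> \<psi>
  proof (rule dist_bound)
    fix t
    have "norm (I \<phi> t - I \<psi> t) \<le> K * dist \<phi> \<psi> / k * exp (k * \<bar>t\<bar>)"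
    proof (rule norm_antiderivative_exp_le[of "\<lambda>t. I \<phi> t - I \<psi> t"])
      show "((\<lambda>t. I \<phi> t - I \<psi> t) has_vector_derivative
          F (w t *\<^sub>R apply_bcontfun \<phi> t) - F (w t *\<^sub>R apply_bcontfun \<psi> t)) (at t)" for t
        by (auto intro!: derivative_eq_intros I)
      fix t
      have "norm (F (w t *\<^sub>R apply_bcontfun \<phi> t) - F (w t *\<^sub>R apply_bcontfun \<psi> t))
          \<le> K * norm (w t *\<^sub>R apply_bcontfun \<phi> t - w t *\<^sub>R apply_bcontfun \<psi> t)" by (rule lipF)
      also have "\<dots> = K * (w t * dist (apply_bcontfun \<phi> t) (apply_bcontfun \<psi> t))"
        using w(2)[of t] by (simp add: dist_norm scaleR_diff_right[symmetric])
      also have "\<dots> \<le> K * (w t * dist \<phi> \<psi>)"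
        using K w(2)[of t] by (intro mult_left_mono dist_bounded) auto
      finally show "norm (F (w t *\<^sub>R apply_bcontfun \<phi> t) - F (w t *\<^sub>R apply_bcontfun \<psi> t))
          \<le> K * dist \<phi> \<psi> * exp (k * \<bar>t\<bar>)" by (simp add: w_def algebra_simps)
    qed (use I K k in auto)
    moreover have "K * dist \<phi> \<psi> / k \<le> 1 / 2 * dist \<phi> \<psi>"
      using k mult_right_mono[OF k(2), of "dist \<phi> \<psi>"] by (simp add: field_simps)
    ultimately have "norm (I \<phi> t - I \<psi> t) \<le> 1 / 2 * dist \<phi> \<psi> * w t"
      unfolding w_def by (rule order_trans[OF _ mult_right_mono]) auto
    then show "dist (apply_bcontfun (\<Phi> \<phi>) t) (apply_bcontfun (\<Phi> \<psi>) t) \<le> 1 / 2 * dist \<phi> \<psi>"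
      using w(2)[of t] by (simp add: \<Phi> dist_norm scaleR_diff_right[symmetric] pos_divide_le_eq)
  qed
  then obtain \<phi> where "\<Phi> \<phi> = \<phi>"
    using banach_fix_type[of "1/2" \<Phi>] by auto
  then have "w t *\<^sub>R apply_bcontfun \<phi> t = z + I \<phi> t" for t
    using \<Phi>[of \<phi> t] w(2)[of t] by simp
  moreover have "((\<lambda>t. z + I \<phi> t) has_vector_derivative F (w t *\<^sub>R apply_bcontfun \<phi> t)) (at t)" for t
    by (auto intro!: derivative_eq_intros I)
  ultimately show ?thesis
    using I(1) by (intro exI[of _ "\<lambda>t. z + I \<phi> t"]) auto
qed

text \<open>Gronwall's inequality for the squared distance, which unlike the distance is
  differentiable where the curves meet. Equal initial values give uniqueness; the factor exp(K |t|)
  gives continuity of the flow in the initial point.\<close>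

lemma lipschitz_ode_dist_le:
  fixes F :: "'a::euclidean_space \<Rightarrow> 'a"
  assumes lip: "K-lipschitz_on UNIV F"
    and x: "\<And>t. (x has_vector_derivative F (x t)) (at t)"
    and y: "\<And>t. (y has_vector_derivative F (y t)) (at t)"
  shows "norm (x t - y t) \<le> exp (K * \<bar>t\<bar>) * norm (x 0 - y 0)"
proof -
  define d where "d t = (norm (x t - y t))\<^sup>2" for t
  have d: "(d has_real_derivative 2 * inner (F (x t) - F (y t)) (x t - y t)) (at t)" for t
    unfolding d_def by (rule has_derivative_norm_square) (auto intro!: derivative_eq_intros x y)
  have "\<bar>inner (F (x t) - F (y t)) (x t - y t)\<bar> \<le> K * d t" for t
  proof -
    have "\<bar>inner (F (x t) - F (y t)) (x t - y t)\<bar> \<le> norm (F (x t) - F (y t)) * norm (x t - y t)"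
      by (rule Cauchy_Schwarz_ineq2)
    also have "\<dots> \<le> (K * norm (x t - y t)) * norm (x t - y t)"
      using lipschitz_onD[OF lip, of "x t" "y t"] by (intro mult_right_mono) (auto simp: dist_norm)
    finally show ?thesis by (simp add: d_def power2_eq_square)
  qed
  then have bnd: "2 * inner (F (x t) - F (y t)) (x t - y t) \<le> 2 * K * d t"
    "- (2 * K) * d t \<le> 2 * inner (F (x t) - F (y t)) (x t - y t)" for t
    using abs_le_D1[of _ "K * d t"] abs_le_D2[of _ "K * d t"] by (fastforce simp: algebra_simps)+
  have "d t \<le> exp (2 * K * \<bar>t\<bar>) * d 0"
  proof (cases "t \<ge> 0")
    case True
    then show ?thesis
      using exp_upper_bound_deriv[where s = 0 and t = t, OF d bnd(1)] by simp
  next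
    case False
    then have "exp (- (2 * K) * (0 - t)) * d t \<le> d 0"
      using exp_lower_bound_deriv[where s = t and t = 0, OF d bnd(2)] by simp
    then have "exp (2 * K * (- t)) * (exp (- (2 * K) * (0 - t)) * d t) \<le> exp (2 * K * (- t)) * d 0"
      by (intro mult_left_mono) auto
    then show ?thesis using False
      by (simp add: mult.assoc[symmetric] exp_add[symmetric])
  qed
  also have "\<dots> = (exp (K * \<bar>t\<bar>) * norm (x 0 - y 0))\<^sup>2"
    by (simp add: d_def power_mult_distrib exp_double[symmetric] mult.assoc)
  finally show ?thesis
    unfolding d_def by (rule power2_le_imp_le) simp
qed

lemma is_flow_flow:
  fixes F :: "'a::euclidean_space \<Rightarrow> 'a"
  assumes lip: "K-lipschitz_on UNIV F"
  shows "is_flow F (flow F)"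
proof -
  obtain S where S: "\<And>z. S z 0 = z \<and> (\<forall>t. (S z has_vector_derivative F (S z t)) (at t))"
    using lipschitz_ode_solution_exists[OF lip] by metis
  show ?thesis unfolding flow_def
  proof (rule theI[where a = "\<lambda>t z. S z t"])
    show "is_flow F (\<lambda>t z. S z t)" using S by (auto simp: is_flow_def)
    fix T assume T: "is_flow F T"
    have "T t z = S z t" for t z
      using lipschitz_ode_dist_le[where x = "\<lambda>t. T t z" and y = "S z" and t = t, OF lip] T S
      by (simp add: is_flow_def)
    then show "T = (\<lambda>t z. S z t)" by auto
  qed
qed

locale lipschitz_field =
  fixes F :: "'a::euclidean_space \<Rightarrow> 'a" and K :: real
  assumes lipschitz: "K-lipschitz_on UNIV F"
begin

lemma flow_0 [simp]: "flow F 0 z = z"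
  and flow_deriv: "((\<lambda>t. flow F t z) has_vector_derivative F (flow F t z)) (at t)"
  using is_flow_flow[OF lipschitz] by (auto simp: is_flow_def)

lemma flow_dist_le: "norm (flow F t z - flow F t w) \<le> exp (K * \<bar>t\<bar>) * norm (z - w)"
  using lipschitz_ode_dist_le[where x = "\<lambda>t. flow F t z" and y = "\<lambda>t. flow F t w",
      OF lipschitz flow_deriv flow_deriv] by simp

text \<open>The group law, time reversal, linearity and the commutation rules below are all obtained
  by checking that both sides solve the same equation.\<close>

lemma flow_eqI:
  assumes "\<And>t. (x has_vector_derivative F (x t)) (at t)"
  shows "x t = flow F t (x 0)"
  using lipschitz_ode_dist_le[where y = "\<lambda>t. flow F t (x 0)" and t = t,
      OF lipschitz assms flow_deriv] by simp

lemma flow_add: "flow F (s + t) z = flow F s (flow F t z)"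
  using flow_eqI[of "\<lambda>s. flow F (s + t) z" s]
    has_vector_derivative_shift[OF flow_deriv] by simp

lemma flow_minus [simp]: "flow F (- t) (flow F t z) = z" "flow F t (flow F (- t) z) = z"
  by (simp_all flip: flow_add)

lemma continuous_on_flow [continuous_intros]:
  assumes "continuous_on X f"
  shows "continuous_on X (\<lambda>x. flow F t (f x))"
proof -
  have "(exp (K * \<bar>t\<bar>))-lipschitz_on UNIV (flow F t)"
    by (rule lipschitz_onI) (auto simp: dist_norm flow_dist_le)
  then have "continuous_on UNIV (flow F t)" using lipschitz_on_continuous_on by blast
  then show ?thesis using assms by (rule continuous_on_compose2) auto
qed

lemma lipschitz_reverse: "K-lipschitz_on UNIV (\<lambda>z. - F z)"
  using lipschitz by (auto simp: lipschitz_on_def dist_norm norm_minus_commute)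

lemma flow_reverse: "flow (\<lambda>z. - F z) t z = flow F (- t) z"
proof -
  interpret rev: lipschitz_field "\<lambda>z. - F z" K
    by unfold_locales (rule lipschitz_reverse)
  show ?thesis
    using rev.flow_eqI[of "\<lambda>t. flow F (- t) z" t] has_vector_derivative_reverse[OF flow_deriv]
    by simp
qed

lemma tendsto_flow [tendsto_intros]:
  assumes "(f \<longlongrightarrow> z) G" shows "((\<lambda>n. flow F t (f n)) \<longlongrightarrow> flow F t z) G"
  by (rule continuous_on_tendsto_compose[OF continuous_on_flow[OF continuous_on_id[of UNIV]] assms]) auto

end

section \<open>Linear flows in the role of matrix exponentials\<close>

locale linear_field =
  fixes A :: "'a::euclidean_space \<Rightarrow> 'a"
  assumes linear: "linear A"

sublocale linear_field \<subseteq> lipschitz_field A "onorm A"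
proof
  have "bounded_linear A" using linear by (simp add: linear_conv_bounded_linear)
  then show "(onorm A)-lipschitz_on UNIV A"
    by (intro lipschitz_onI) (auto simp: dist_norm onorm onorm_pos_le simp flip: linear_diff[OF linear])
qed

context linear_field
begin

lemma linear_flow: "linear (flow A t)"
proof
  fix y z c
  have "((\<lambda>t. flow A t y + flow A t z) has_vector_derivative A (flow A t y + flow A t z)) (at t)" for t
    by (auto intro!: derivative_eq_intros flow_deriv simp: linear_add[OF linear])
  from flow_eqI[OF this] show "flow A t (y + z) = flow A t y + flow A t z" by simp
  have "((\<lambda>t. c *\<^sub>R flow A t y) has_vector_derivative A (c *\<^sub>R flow A t y)) (at t)" for t
    by (auto intro!: derivative_eq_intros flow_deriv simp: linear_cmul[OF linear])
  from flow_eqI[OF this] show "flow A t (c *\<^sub>R y) = c *\<^sub>R flow A t y" by simp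
qed

lemma flow_commute:
  assumes P: "linear P" and PA: "\<And>y. P (A y) = A (P y)"
  shows "flow A t (P y) = P (flow A t y)"
proof -
  have bl: "bounded_linear P" using P by (simp add: linear_conv_bounded_linear)
  have "((\<lambda>t. P (flow A t y)) has_vector_derivative A (P (flow A t y))) (at t)" for t
    using bounded_linear.has_vector_derivative[OF bl flow_deriv] by (simp add: PA)
  from flow_eqI[OF this] show ?thesis by simp
qed

lemma flow_A: "flow A t (A y) = A (flow A t y)"
  by (rule flow_commute) (auto simp: linear)

text \<open>Expanding in a basis replaces the product rule for an operator-valued curve.\<close>

lemma flow_back_deriv:
  assumes y: "(y has_vector_derivative A (y t) + h) (at t)"
  shows "((\<lambda>t. flow A (- t) (y t)) has_vector_derivative flow A (- t) h) (at t)"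
proof -
  have expand: "flow A s v = (\<Sum>b\<in>Basis. inner v b *\<^sub>R flow A s b)" for s v
    by (subst euclidean_representation[of v, symmetric])
      (simp add: linear_sum[OF linear_flow] linear_cmul[OF linear_flow] del: euclidean_representation)
  have "((\<lambda>t. \<Sum>b\<in>Basis. inner (y t) b *\<^sub>R flow A (- t) b) has_vector_derivative
      (\<Sum>b\<in>Basis. inner (y t) b *\<^sub>R (- A (flow A (- t) b)) + inner (A (y t) + h) b *\<^sub>R flow A (- t) b)) (at t)"
  proof (rule has_vector_derivative_sum)
    fix b
    have "((\<lambda>t. inner (y t) b) has_real_derivative inner (A (y t) + h) b) (at t)"
      unfolding has_real_derivative_iff_has_vector_derivative
      using bounded_linear.has_vector_derivative[OF bounded_linear_inner_left y] .
    then show "((\<lambda>t. inner (y t) b *\<^sub>R flow A (- t) b) has_vector_derivative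
        inner (y t) b *\<^sub>R (- A (flow A (- t) b)) + inner (A (y t) + h) b *\<^sub>R flow A (- t) b) (at t)"
      by (rule has_vector_derivative_scaleR) (rule has_vector_derivative_reverse[OF flow_deriv])
  qed
  also have "(\<Sum>b\<in>Basis. inner (y t) b *\<^sub>R (- A (flow A (- t) b)) + inner (A (y t) + h) b *\<^sub>R flow A (- t) b)
      = - A (flow A (- t) (y t)) + flow A (- t) (A (y t) + h)"
    unfolding sum.distrib expand[symmetric]
    by (subst expand[of "- t" "y t"])
      (simp add: linear_sum[OF linear] linear_cmul[OF linear] sum_negf)
  finally show ?thesis
    by (simp only: expand[symmetric]) (simp add: linear_add[OF linear_flow] flow_A)
qed

end

section \<open>Cone conditions and the unstable foliation\<close>

lemma linear_injective_norm_le: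
  fixes f :: "'a::euclidean_space \<Rightarrow> 'b::euclidean_space"
  assumes "linear f" "inj f"
  obtains C where "C > 0" "\<And>x. norm x \<le> C * norm (f x)"
proof -
  obtain c where "c > 0" "\<And>x. c * norm x \<le> norm (f x)"
    using linear_inj_bounded_below_pos[OF assms] by blast
  then show ?thesis by (intro that[of "1 / c"]) (auto simp: field_simps)
qed

lemma linear_norm_le:
  fixes f :: "'a::euclidean_space \<Rightarrow> 'b::real_normed_vector"
  assumes "linear f"
  obtains C where "C > 0" "\<And>x. norm (f x) \<le> C * norm x"
  using linear_bounded_pos[OF assms] by (metis mult.commute)

text \<open>Exponential growth that stays bounded cannot start from a positive value; this is how
  bounds for all forward times force signs and equalities below.\<close>

lemma exp_growth_unbounded:
  fixes c C k :: real
  assumes "k > 0" and "\<And>t. t \<ge> 0 \<Longrightarrow> exp (k * t) * c \<le> C"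
  shows "c \<le> 0"
proof (rule ccontr)
  assume c: "\<not> c \<le> 0"
  \<comment> \<open>At this time exp x \<ge> 1 + x already makes the left side at least c + |C|,
    which exceeds C.\<close>
  define t where "t = \<bar>C\<bar> / (k * c)"
  have t: "t \<ge> 0" using c assms(1) by (simp add: t_def)
  have "(1 + k * t) * c \<le> exp (k * t) * c"
    using c by (intro mult_right_mono exp_ge_add_one_self) auto
  also have "\<dots> \<le> C" by (rule assms(2)[OF t])
  finally have "c + k * t * c \<le> C" by (simp add: algebra_simps)
  moreover have "k * t * c = \<bar>C\<bar>" using c assms(1) by (simp add: t_def)
  ultimately show False using c by linarith
qed

lemma norm_add_square_le:
  fixes x y :: "'a::real_inner"
  shows "(norm (x + y))\<^sup>2 \<le> 2 * (norm x)\<^sup>2 + 2 * (norm y)\<^sup>2"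
proof -
  have "0 \<le> (norm (x - y))\<^sup>2" by simp
  then show ?thesis
    by (simp add: power2_norm_eq_inner inner_left_distrib inner_right_distrib
        inner_diff_left inner_diff_right inner_commute)
qed

lemma abs_inner_le:
  fixes u v :: "'a::real_inner"
  assumes "norm u \<le> e * sqrt n" "(norm v)\<^sup>2 \<le> n" "e \<ge> 0"
  shows "\<bar>inner u v\<bar> \<le> e * n"
proof -
  have n: "n \<ge> 0" using assms(2) zero_le_power2[of "norm v"] by linarith
  have "\<bar>inner u v\<bar> \<le> norm u * norm v" by (rule Cauchy_Schwarz_ineq2)
  also have "\<dots> \<le> (e * sqrt n) * sqrt n"
    using assms n by (intro mult_mono real_le_rsqrt) auto
  finally show ?thesis using n by (simp add: mult.assoc)
qed

lemma lipschitz_coupled_field: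
  fixes A :: "'y::euclidean_space \<Rightarrow> 'y" and B :: "'x::euclidean_space \<Rightarrow> 'x"
  assumes linear_A: "linear A" and linear_B: "linear B"
    and lipschitz_g: "\<exists>K. K-lipschitz_on UNIV g" and lipschitz_h: "\<exists>K. K-lipschitz_on UNIV h"
  shows "\<exists>K. K-lipschitz_on UNIV (\<lambda>z. (B (fst z) + g z, A (snd z) + h z))"
proof -
  define F where "F = (\<lambda>z. (B (fst z) + g z, A (snd z) + h z))"
  obtain Kg Kh where K: "Kg-lipschitz_on UNIV g" "Kh-lipschitz_on UNIV h"
    using lipschitz_g lipschitz_h by blast
  obtain CB where CB: "CB > 0" "\<And>x. norm (B x) \<le> CB * norm x" using linear_norm_le[OF linear_B] by blast
  obtain CA where CA: "CA > 0" "\<And>x. norm (A x) \<le> CA * norm x" using linear_norm_le[OF linear_A] by blast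
  have "(CB + Kg + CA + Kh)-lipschitz_on UNIV F"
  proof (rule lipschitz_onI)
    fix z w :: "'x \<times> 'y"
    have fst_le: "norm (fst z - fst w) \<le> norm (z - w)" and snd_le: "norm (snd z - snd w) \<le> norm (z - w)"
      using norm_fst_le[of "fst z - fst w" "snd z - snd w"] norm_snd_le[of "snd z - snd w" "fst z - fst w"]
      by (simp_all add: minus_prod_def)
    have "dist (F z) (F w) = norm (B (fst z - fst w) + (g z - g w), A (snd z - snd w) + (h z - h w))"
      by (simp add: F_def dist_norm linear_diff[OF linear_A] linear_diff[OF linear_B] algebra_simps)
    also have "\<dots> \<le> norm (B (fst z - fst w) + (g z - g w)) + norm (A (snd z - snd w) + (h z - h w))"
      by (rule norm_Pair_le)
    also have "\<dots> \<le> (norm (B (fst z - fst w)) + norm (g z - g w)) + (norm (A (snd z - snd w)) + norm (h z - h w))"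
      by (intro add_mono norm_triangle_ineq)
    also have "\<dots> \<le> (CB * norm (z - w) + Kg * norm (z - w)) + (CA * norm (z - w) + Kh * norm (z - w))"
    proof (intro add_mono)
      show "norm (B (fst z - fst w)) \<le> CB * norm (z - w)"
        using order_trans[OF CB(2) mult_left_mono[OF fst_le]] CB(1) by simp
      show "norm (A (snd z - snd w)) \<le> CA * norm (z - w)"
        using order_trans[OF CA(2) mult_left_mono[OF snd_le]] CA(1) by simp
    qed (use lipschitz_onD[OF K(1), of z w] lipschitz_onD[OF K(2), of z w] in \<open>auto simp: dist_norm\<close>)
    finally show "dist (F z) (F w) \<le> (CB + Kg + CA + Kh) * dist z w"
      by (simp add: dist_norm algebra_simps)
  qed (use CB CA lipschitz_on_nonneg[OF K(1)] lipschitz_on_nonneg[OF K(2)] in auto)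
  then show ?thesis unfolding F_def by blast
qed

text \<open>\<open>L\<close> and \<open>Lc\<close> carry adapted norms: in them the linear part
  expands and contracts at rate a without a constant in front. The two-sided bound in
  \<open>center\<close> and the parallel treatment of \<open>Pu\<close> and \<open>Ps\<close> make
  the assumptions invariant under time reversal. The factor a/8 is used up in the cone
  inequality.\<close>

locale splitting =
  fixes A :: "'y::euclidean_space \<Rightarrow> 'y" and B :: "'x::euclidean_space \<Rightarrow> 'x"
    and Pu Ps :: "'y \<Rightarrow> 'y"
    and Lc :: "'x \<Rightarrow> 'p::euclidean_space" and L :: "'y \<Rightarrow> 'q::euclidean_space"
    and a :: real
  assumes linear_A: "linear A" and linear_B: "linear B"
    and linear_Pu: "linear Pu" and linear_Ps: "linear Ps"
    and linear_Lc: "linear Lc" and linear_L: "linear L"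
    and inj_Lc: "inj Lc" and inj_L: "inj L"
    and Pu_plus_Ps: "\<And>y. Pu y + Ps y = y"
    and Pu_Ps [simp]: "\<And>y. Pu (Ps y) = 0" and Ps_Pu [simp]: "\<And>y. Ps (Pu y) = 0"
    and Pu_A: "\<And>y. Pu (A y) = A (Pu y)" and Ps_A: "\<And>y. Ps (A y) = A (Ps y)"
    and a_pos: "a > 0"
    and expanding: "\<And>y. a * (norm (L (Pu y)))\<^sup>2 \<le> inner (L (A (Pu y))) (L (Pu y))"
    and contracting: "\<And>y. inner (L (A (Ps y))) (L (Ps y)) \<le> - a * (norm (L (Ps y)))\<^sup>2"
    and center: "\<And>x. \<bar>inner (Lc (B x)) (Lc x)\<bar> \<le> a / 8 * (norm (Lc x))\<^sup>2"
begin

lemmas linears = linear_A linear_B linear_Pu linear_Ps linear_Lc linear_L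

lemmas linear_simps =
  linears[THEN linear_add] linears[THEN linear_diff] linears[THEN linear_0] linears[THEN linear_neg]

lemma continuous_on_linears [continuous_intros]:
  assumes "continuous_on X f"
  shows "continuous_on X (\<lambda>x. Pu (f x))" "continuous_on X (\<lambda>x. Ps (f x))"
    "continuous_on X (\<lambda>x. L (f x))"
  using linear_Pu linear_Ps linear_L assms
  by (auto simp: linear_conv_bounded_linear intro: bounded_linear.continuous_on)

lemma continuous_on_Lc [continuous_intros]:
  assumes "continuous_on X f" shows "continuous_on X (\<lambda>x. Lc (f x))"
  using linear_Lc assms by (auto simp: linear_conv_bounded_linear intro: bounded_linear.continuous_on)

lemma Pu_Pu [simp]: "Pu (Pu y) = Pu y"
  using Pu_plus_Ps[of "Pu y"] by simp

lemma Ps_Ps [simp]: "Ps (Ps y) = Ps y"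
  using Pu_plus_Ps[of "Ps y"] by simp

definition qc :: "'x \<times> 'y \<Rightarrow> real" where "qc z = (norm (Lc (fst z)))\<^sup>2"
definition qu :: "'x \<times> 'y \<Rightarrow> real" where "qu z = (norm (L (Pu (snd z))))\<^sup>2"
definition qs :: "'x \<times> 'y \<Rightarrow> real" where "qs z = (norm (L (Ps (snd z))))\<^sup>2"
definition q :: "'x \<times> 'y \<Rightarrow> real" where "q z = qc z + qu z + qs z"

text \<open>The cone \<open>V \<ge> 0\<close> is where the unstable component dominates.  Its aperture is narrower than
  \<open>1\<close> so that two points outside both the unstable and the stable cone differ mainly in the
  centre direction.\<close>

definition V :: "'x \<times> 'y \<Rightarrow> real" where "V z = qu z - (qc z + qs z) / 4"

lemma q_nonneg [simp]: "qc z \<ge> 0" "qu z \<ge> 0" "qs z \<ge> 0" "q z \<ge> 0"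
  by (simp_all add: qc_def qu_def qs_def q_def)

lemma q_minus_commute: "qc (z - w) = qc (w - z)" "qu (z - w) = qu (w - z)"
    "qs (z - w) = qs (w - z)" "q (z - w) = q (w - z)" "V (z - w) = V (w - z)"
  by (simp_all add: qc_def qu_def qs_def q_def V_def linear_simps norm_minus_commute)

lemma q_add_le: "q (z + w) \<le> 2 * q z + 2 * q w"
  unfolding q_def qc_def qu_def qs_def
  using norm_add_square_le[of "Lc (fst z)" "Lc (fst w)"]
    norm_add_square_le[of "L (Pu (snd z))" "L (Pu (snd w))"]
    norm_add_square_le[of "L (Ps (snd z))" "L (Ps (snd w))"]
  by (simp add: linear_simps)

lemma V_le: "V z \<le> qu z"
  unfolding V_def add_divide_distrib using q_nonneg(1,3)[of z] by linarith

lemma V_ge: "- q z \<le> V z"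
  unfolding V_def q_def add_divide_distrib using q_nonneg(1-3)[of z] by linarith

lemma q_le_cone: "V z \<ge> 0 \<Longrightarrow> q z \<le> 5 * qu z"
  by (simp add: V_def q_def)

lemma continuous_on_V: "continuous_on UNIV V"
  unfolding V_def qc_def qu_def qs_def by (intro continuous_intros) auto

lemma tendsto_V: "(f \<longlongrightarrow> z) G \<Longrightarrow> ((\<lambda>n. V (f n)) \<longlongrightarrow> V z) G"
  by (rule continuous_on_tendsto_compose[OF continuous_on_V]) auto

lemma norm_le_q:
  obtains C where "C > 0" "\<And>z. (norm z)\<^sup>2 \<le> C * q z"
proof -
  obtain c1 where c1: "c1 > 0" "\<And>x. norm x \<le> c1 * norm (Lc x)"
    using linear_injective_norm_le[OF linear_Lc inj_Lc] by blast
  obtain c2 where c2: "c2 > 0" "\<And>y. norm y \<le> c2 * norm (L y)"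
    using linear_injective_norm_le[OF linear_L inj_L] by blast
  have "(norm z)\<^sup>2 \<le> (c1\<^sup>2 + 2 * c2\<^sup>2) * q z" for z :: "'x \<times> 'y"
  proof -
    have "(norm (fst z))\<^sup>2 \<le> (c1 * norm (Lc (fst z)))\<^sup>2"
      by (intro power_mono c1) auto
    then have 1: "(norm (fst z))\<^sup>2 \<le> c1\<^sup>2 * qc z" by (simp add: power_mult_distrib qc_def)
    have "(norm (snd z))\<^sup>2 \<le> (c2 * norm (L (snd z)))\<^sup>2"
      by (intro power_mono c2) auto
    also have "\<dots> = c2\<^sup>2 * (norm (L (Pu (snd z)) + L (Ps (snd z))))\<^sup>2"
      by (simp add: power_mult_distrib Pu_plus_Ps linear_add[OF linear_L, symmetric])
    also have "\<dots> \<le> c2\<^sup>2 * (2 * qu z + 2 * qs z)"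
      unfolding qu_def qs_def by (intro mult_left_mono norm_add_square_le) auto
    finally have 2: "(norm (snd z))\<^sup>2 \<le> 2 * c2\<^sup>2 * (qu z + qs z)" by (simp add: algebra_simps)
    have "(norm z)\<^sup>2 = (norm (fst z))\<^sup>2 + (norm (snd z))\<^sup>2"
      by (simp add: norm_prod_def)
    also have "\<dots> \<le> c1\<^sup>2 * q z + 2 * c2\<^sup>2 * q z"
      using 1 2 mult_left_mono[of "qc z" "q z" "c1\<^sup>2"] mult_left_mono[of "qu z + qs z" "q z" "2 * c2\<^sup>2"]
      by (simp add: q_def)
    finally show ?thesis by (simp add: algebra_simps)
  qed
  moreover have "c1\<^sup>2 + 2 * c2\<^sup>2 > 0" using c1 by (simp add: add_pos_nonneg)
  ultimately show ?thesis using that by blast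
qed

lemma q_eq_0: "q z = 0 \<Longrightarrow> z = 0"
  using norm_le_q by (metis mult_zero_right norm_le_zero_iff power2_le_imp_le norm_ge_zero
      power_zero_numeral order_refl)

sublocale li: linear_field A
  by (rule linear_field.intro) (rule linear_A)

lemma flow_Pu: "flow A t (Pu y) = Pu (flow A t y)" and flow_Ps: "flow A t (Ps y) = Ps (flow A t y)"
  by (rule li.flow_commute; simp add: linears Pu_A Ps_A)+

lemma unstable_flow_ge:
  assumes "t \<ge> 0"
  shows "exp (a * t) * norm (L (Pu y)) \<le> norm (L (Pu (flow A t y)))"
proof -
  define f where "f t = (norm (L (Pu (flow A t y))))\<^sup>2" for t
  have bl: "bounded_linear (\<lambda>v. L (Pu v))"
    using linear_compose[OF linear_Pu linear_L] by (simp add: o_def linear_conv_bounded_linear)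
  have "(f has_real_derivative 2 * inner (L (Pu (A (flow A t y)))) (L (Pu (flow A t y)))) (at t)" for t
    unfolding f_def
    by (rule has_derivative_norm_square) (rule bounded_linear.has_vector_derivative[OF bl li.flow_deriv])
  then have "exp (2 * a * (t - 0)) * f 0 \<le> f t"
  proof (rule exp_lower_bound_deriv)
    show "2 * a * f t \<le> 2 * inner (L (Pu (A (flow A t y)))) (L (Pu (flow A t y)))" for t
      using expanding[of "flow A t y"] by (simp add: f_def Pu_A)
  qed (use assms in auto)
  then have "(exp (a * t) * norm (L (Pu y)))\<^sup>2 \<le> (norm (L (Pu (flow A t y))))\<^sup>2"
    by (simp add: f_def power_mult_distrib exp_double[symmetric] mult.assoc)
  then show ?thesis by (rule power2_le_imp_le) simp
qed

end

section \<open>The cone condition for differences of orbits\<close>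

locale palmer_system = splitting A B Pu Ps Lc L a
  for A :: "'y::euclidean_space \<Rightarrow> 'y" and B :: "'x::euclidean_space \<Rightarrow> 'x"
    and Pu Ps :: "'y \<Rightarrow> 'y"
    and Lc :: "'x \<Rightarrow> 'p::euclidean_space" and L :: "'y \<Rightarrow> 'q::euclidean_space"
    and a :: real +
  fixes g :: "'x \<times> 'y \<Rightarrow> 'x" and h :: "'x \<times> 'y \<Rightarrow> 'y" and e :: real
  assumes e_pos: "e > 0" and e_le: "e \<le> a / 64"
    and lipschitz_g: "\<exists>K. K-lipschitz_on UNIV g" and lipschitz_h: "\<exists>K. K-lipschitz_on UNIV h"
    and bounded_g: "bounded (range g)" and bounded_h: "bounded (range h)"
    and g_small: "\<And>z w. norm (Lc (g z - g w)) \<le> e * sqrt (q (z - w))"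
    and hu_small: "\<And>z w. norm (L (Pu (h z - h w))) \<le> e * sqrt (q (z - w))"
    and hs_small: "\<And>z w. norm (L (Ps (h z - h w))) \<le> e * sqrt (q (z - w))"
begin

definition F :: "'x \<times> 'y \<Rightarrow> 'x \<times> 'y" where
  "F z = (B (fst z) + g z, A (snd z) + h z)"

lemma lipschitz_F: "\<exists>K. K-lipschitz_on UNIV F"
  using lipschitz_coupled_field[OF linear_A linear_B lipschitz_g lipschitz_h]
  by (simp add: F_def[abs_def])

sublocale fl: lipschitz_field F "SOME K. K-lipschitz_on UNIV F"
  by unfold_locales (rule someI_ex[OF lipschitz_F])

abbreviation S :: "real \<Rightarrow> 'x \<times> 'y \<Rightarrow> 'x \<times> 'y" where "S \<equiv> flow F"

lemma fst_flow_deriv: "((\<lambda>t. fst (S t z)) has_vector_derivative B (fst (S t z)) + g (S t z)) (at t)"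
  and snd_flow_deriv: "((\<lambda>t. snd (S t z)) has_vector_derivative A (snd (S t z)) + h (S t z)) (at t)"
  using bounded_linear.has_vector_derivative[OF bounded_linear_fst fl.flow_deriv[of z t]]
    bounded_linear.has_vector_derivative[OF bounded_linear_snd fl.flow_deriv[of z t]]
  by (simp_all add: F_def)

context
  fixes z w :: "'x \<times> 'y"
begin

private definition D where "D t = S t z - S t w"

text \<open>The linear part contributes twice its rate to a squared norm. The perturbation
  contributes at most 2 e q by the Cauchy-Schwarz inequality, since each component of the difference
  is bounded by sqrt q.\<close>

lemma qc_deriv: "\<exists>q'. ((\<lambda>t. qc (S t z - S t w)) has_real_derivative q') (at t) \<and>
    \<bar>q'\<bar> \<le> a / 4 * qc (S t z - S t w) + 2 * e * q (S t z - S t w)"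
  and qu_deriv: "\<exists>q'. ((\<lambda>t. qu (S t z - S t w)) has_real_derivative q') (at t) \<and>
    2 * a * qu (S t z - S t w) - 2 * e * q (S t z - S t w) \<le> q'"
  and qs_deriv: "\<exists>q'. ((\<lambda>t. qs (S t z - S t w)) has_real_derivative q') (at t) \<and>
    q' \<le> - 2 * a * qs (S t z - S t w) + 2 * e * q (S t z - S t w)"
proof -
  have bl: "bounded_linear Lc" "bounded_linear (\<lambda>y. L (Pu y))" "bounded_linear (\<lambda>y. L (Ps y))"
    using linear_compose[OF linear_Pu linear_L] linear_compose[OF linear_Ps linear_L] linear_Lc
    by (simp_all add: o_def linear_conv_bounded_linear)
  have fstD: "((\<lambda>t. fst (D t)) has_vector_derivative B (fst (D t)) + (g (S t z) - g (S t w))) (at t)"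
    unfolding D_def fst_diff
    by (auto intro!: derivative_eq_intros fst_flow_deriv simp: linear_simps algebra_simps)
  have sndD: "((\<lambda>t. snd (D t)) has_vector_derivative A (snd (D t)) + (h (S t z) - h (S t w))) (at t)"
    unfolding D_def snd_diff
    by (auto intro!: derivative_eq_intros snd_flow_deriv simp: linear_simps algebra_simps)
  have le: "qc (D t) \<le> q (D t)" "qu (D t) \<le> q (D t)" "qs (D t) \<le> q (D t)"
    using q_nonneg[of "D t"] by (auto simp: q_def)
  let ?e = "inner (Lc (g (S t z) - g (S t w))) (Lc (fst (D t)))"
  let ?m = "inner (Lc (B (fst (D t)))) (Lc (fst (D t)))"
  have "((\<lambda>t. qc (D t)) has_real_derivative
      2 * inner (Lc (B (fst (D t)) + (g (S t z) - g (S t w)))) (Lc (fst (D t)))) (at t)"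
    unfolding qc_def
    by (rule has_derivative_norm_square) (rule bounded_linear.has_vector_derivative[OF bl(1) fstD])
  then have d: "((\<lambda>t. qc (D t)) has_real_derivative 2 * ?m + 2 * ?e) (at t)"
    by (simp add: linear_add[OF linear_Lc] inner_add_left distrib_left)
  have e: "\<bar>?e\<bar> \<le> e * q (D t)"
    using le(1) g_small[of "S t z" "S t w"] e_pos
    by (intro abs_inner_le) (auto simp: qc_def D_def)
  have m: "\<bar>?m\<bar> \<le> a / 8 * qc (D t)"
    unfolding qc_def by (rule center)
  show "\<exists>q'. ((\<lambda>t. qc (S t z - S t w)) has_real_derivative q') (at t) \<and>
    \<bar>q'\<bar> \<le> a / 4 * qc (S t z - S t w) + 2 * e * q (S t z - S t w)"
    unfolding D_def[symmetric] using d e m by (intro exI[of _ "2 * ?m + 2 * ?e"]) linarith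
  let ?e = "inner (L (Pu (h (S t z) - h (S t w)))) (L (Pu (snd (D t))))"
  let ?m = "inner (L (Pu (A (snd (D t))))) (L (Pu (snd (D t))))"
  have "((\<lambda>t. qu (D t)) has_real_derivative
      2 * inner (L (Pu (A (snd (D t)) + (h (S t z) - h (S t w))))) (L (Pu (snd (D t))))) (at t)"
    unfolding qu_def
    by (rule has_derivative_norm_square) (rule bounded_linear.has_vector_derivative[OF bl(2) sndD])
  then have d: "((\<lambda>t. qu (D t)) has_real_derivative 2 * ?m + 2 * ?e) (at t)"
    by (simp add: linear_add[OF linear_Pu] linear_add[OF linear_L] inner_add_left distrib_left)
  have e: "\<bar>?e\<bar> \<le> e * q (D t)"
    using le(2) hu_small[of "S t z" "S t w"] e_pos
    by (intro abs_inner_le) (auto simp: qu_def D_def)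
  have m: "a * qu (D t) \<le> ?m"
    unfolding qu_def Pu_A by (rule expanding)
  show "\<exists>q'. ((\<lambda>t. qu (S t z - S t w)) has_real_derivative q') (at t) \<and>
    2 * a * qu (S t z - S t w) - 2 * e * q (S t z - S t w) \<le> q'"
    unfolding D_def[symmetric] using d e m by (intro exI[of _ "2 * ?m + 2 * ?e"]) linarith
  let ?e = "inner (L (Ps (h (S t z) - h (S t w)))) (L (Ps (snd (D t))))"
  let ?m = "inner (L (Ps (A (snd (D t))))) (L (Ps (snd (D t))))"
  have "((\<lambda>t. qs (D t)) has_real_derivative
      2 * inner (L (Ps (A (snd (D t)) + (h (S t z) - h (S t w))))) (L (Ps (snd (D t))))) (at t)"
    unfolding qs_def
    by (rule has_derivative_norm_square) (rule bounded_linear.has_vector_derivative[OF bl(3) sndD])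
  then have d: "((\<lambda>t. qs (D t)) has_real_derivative 2 * ?m + 2 * ?e) (at t)"
    by (simp add: linear_add[OF linear_Ps] linear_add[OF linear_L] inner_add_left distrib_left)
  have e: "\<bar>?e\<bar> \<le> e * q (D t)"
    using le(3) hs_small[of "S t z" "S t w"] e_pos
    by (intro abs_inner_le) (auto simp: qs_def D_def)
  have m: "?m \<le> - a * qs (D t)"
    unfolding qs_def Ps_A by (rule contracting)
  show "\<exists>q'. ((\<lambda>t. qs (S t z - S t w)) has_real_derivative q') (at t) \<and>
    q' \<le> - 2 * a * qs (S t z - S t w) + 2 * e * q (S t z - S t w)"
    unfolding D_def[symmetric] using d e m by (intro exI[of _ "2 * ?m + 2 * ?e"]) linarith
qed

end

text \<open>The term e q is a surplus over exponential growth: it makes the derivative of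
  \<open>V\<close> positive where \<open>V\<close> vanishes at distinct points, which
  \<open>eq_if_V_eq_0\<close> exploits.\<close>

lemma cone_deriv:
  "\<exists>V'. ((\<lambda>t. V (S t z - S t w)) has_real_derivative V') (at t) \<and>
    a / 2 * V (S t z - S t w) + e * q (S t z - S t w) \<le> V'"
proof -
  let ?D = "S t z - S t w"
  obtain c' where c: "((\<lambda>t. qc (S t z - S t w)) has_real_derivative c') (at t)"
    "\<bar>c'\<bar> \<le> a / 4 * qc ?D + 2 * e * q ?D"
    using qc_deriv[of z w t] by blast
  obtain u' where u: "((\<lambda>t. qu (S t z - S t w)) has_real_derivative u') (at t)"
    "2 * a * qu ?D - 2 * e * q ?D \<le> u'"
    using qu_deriv[of z w t] by blast
  obtain s' where s: "((\<lambda>t. qs (S t z - S t w)) has_real_derivative s') (at t)"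
    "s' \<le> - 2 * a * qs ?D + 2 * e * q ?D"
    using qs_deriv[of z w t] by blast
  have "((\<lambda>t. V (S t z - S t w)) has_real_derivative u' - (c' + s') / 4) (at t)"
    unfolding V_def by (auto intro!: derivative_eq_intros c(1) u(1) s(1))
  moreover have "a / 2 * V ?D + e * q ?D \<le> u' - (c' + s') / 4"
  proof -
    \<comment> \<open>Write u, c, s for a times \<open>qu\<close>, \<open>qc\<close>,
      \<open>qs\<close> and E for e q. The right side minus the left side of the goal is at least
      3u/2 + c/16 + 5s/8 - 4E. As 4E \<le> (u + c + s)/16, the bound e \<le> a/64 is exactly what
      the centre term allows.\<close>
    have "e * q ?D \<le> a / 64 * q ?D" using e_le by (intro mult_right_mono) auto
    moreover have "a * qu ?D \<ge> 0" "a * qc ?D \<ge> 0" "a * qs ?D \<ge> 0" using a_pos by simp_all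
    moreover have "a / 64 * q ?D = (a * qu ?D + a * qc ?D + a * qs ?D) / 64"
      by (simp add: q_def algebra_simps add_divide_distrib)
    moreover have "a / 2 * V ?D = a * qu ?D / 2 - (a * qc ?D + a * qs ?D) / 8"
      by (simp add: V_def algebra_simps add_divide_distrib)
    moreover have "2 * e * q ?D = 2 * (e * q ?D)" "2 * a * qu ?D = 2 * (a * qu ?D)"
      "a / 4 * qc ?D = a * qc ?D / 4" "- 2 * a * qs ?D = - 2 * (a * qs ?D)" by simp_all
    ultimately show ?thesis using c(2) u(2) s(2) unfolding add_divide_distrib by linarith
  qed
  ultimately show ?thesis by blast
qed

lemma cone_growth:
  assumes "s \<le> t"
  shows "exp (a / 2 * (t - s)) * V (S s z - S s w) \<le> V (S t z - S t w)"
proof -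
  have "\<forall>t. \<exists>V'. ((\<lambda>t. V (S t z - S t w)) has_real_derivative V') (at t) \<and>
    a / 2 * V (S t z - S t w) + e * q (S t z - S t w) \<le> V'"
    using cone_deriv by blast
  from choice[OF this] obtain V' where V': "\<And>t. ((\<lambda>t. V (S t z - S t w)) has_real_derivative V' t) (at t)"
    "\<And>t. a / 2 * V (S t z - S t w) + e * q (S t z - S t w) \<le> V' t"
    by blast
  have "a / 2 * V (S t z - S t w) \<le> V' t" for t
  proof -
    have "e * q (S t z - S t w) \<ge> 0" using e_pos by simp
    then show ?thesis using V'(2)[of t] by linarith
  qed
  from exp_lower_bound_deriv[OF V'(1) this assms] show ?thesis .
qed

text \<open>If \<open>V\<close> vanishes along the whole orbit, so does its derivative, and the
  surplus e q in the cone inequality has to be zero.\<close>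

lemma eq_if_V_eq_0:
  assumes "\<And>t. V (S t z - S t w) = 0"
  shows "z = w"
proof -
  obtain V' where "((\<lambda>t. V (S t z - S t w)) has_real_derivative V') (at 0)"
    "a / 2 * V (S 0 z - S 0 w) + e * q (S 0 z - S 0 w) \<le> V'"
    using cone_deriv by blast
  moreover from this(1) have "V' = 0"
    unfolding assms by (rule DERIV_unique) (rule DERIV_const)
  ultimately have "e * q (z - w) \<le> 0"
    using assms[of 0] by simp
  then have "q (z - w) = 0"
    using e_pos q_nonneg(4)[of "z - w"] by (simp add: mult_le_0_iff)
  then show ?thesis using q_eq_0 by fastforce
qed

lemma V_nonpos_if_unstable_bounded:
  assumes "\<And>t. t \<ge> 0 \<Longrightarrow> qu (S t z - S t w) \<le> C"
  shows "V (z - w) \<le> 0"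
proof (rule exp_growth_unbounded[of "a / 2" _ C])
  fix t :: real assume t: "t \<ge> 0"
  show "exp (a / 2 * t) * V (z - w) \<le> C"
    using cone_growth[OF t, of z w] V_le[of "S t z - S t w"] assms[OF t] by simp
qed (use a_pos in simp)

text \<open>Two points are related when they lie on the same leaf of the unstable foliation.\<close>

definition rel :: "'x \<times> 'y \<Rightarrow> 'x \<times> 'y \<Rightarrow> bool" where
  "rel z w \<longleftrightarrow> (\<forall>t. V (S t z - S t w) \<ge> 0)"

lemma rel_sym: "rel z w \<Longrightarrow> rel w z"
  by (simp add: rel_def q_minus_commute)

lemma rel_shift: "rel z w \<Longrightarrow> rel (S t z) (S t w)"
  by (simp add: rel_def flip: fl.flow_add)

text \<open>On a leaf q \<le> 5 qu, so the perturbation costs \<open>qu\<close> at most 10 a/64 of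
  its rate 2a. The rate a survives, twice the rate in \<open>cone_growth\<close>.\<close>

lemma rel_decay:
  assumes "rel z w" and "t \<le> 0"
  shows "q (S t z - S t w) \<le> 5 * exp (a * t) * qu (z - w)"
proof -
  have "\<forall>t. \<exists>u'. ((\<lambda>t. qu (S t z - S t w)) has_real_derivative u') (at t) \<and>
    2 * a * qu (S t z - S t w) - 2 * e * q (S t z - S t w) \<le> u'"
    using qu_deriv by blast
  from choice[OF this] obtain u' where u': "\<And>t. ((\<lambda>t. qu (S t z - S t w)) has_real_derivative u' t) (at t)"
    "\<And>t. 2 * a * qu (S t z - S t w) - 2 * e * q (S t z - S t w) \<le> u' t"
    by blast
  have "a * qu (S t z - S t w) \<le> u' t" for t
  proof -
    have "2 * e * q (S t z - S t w) \<le> 2 * (a / 64) * (5 * qu (S t z - S t w))"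
      using e_le e_pos a_pos assms(1) by (intro mult_mono q_le_cone) (auto simp: rel_def)
    moreover have "a * qu (S t z - S t w) \<ge> 0" using a_pos by simp
    ultimately show ?thesis using u'(2)[of t] by simp
  qed
  from exp_lower_bound_deriv[OF u'(1) this assms(2)]
  have "exp (- a * t) * qu (S t z - S t w) \<le> qu (z - w)" by simp
  then have "exp (a * t) * (exp (- a * t) * qu (S t z - S t w)) \<le> exp (a * t) * qu (z - w)"
    by (intro mult_left_mono) auto
  then have "qu (S t z - S t w) \<le> exp (a * t) * qu (z - w)"
    by (simp add: mult.assoc[symmetric] exp_add[symmetric])
  moreover have "q (S t z - S t w) \<le> 5 * qu (S t z - S t w)"
    using assms(1) by (intro q_le_cone) (simp add: rel_def)
  ultimately show ?thesis by simp
qed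

text \<open>For s far in the past V is at least -C exp(a s), and cone growth up to time t multiplies
  this lower bound by exp(a (t - s)/2) only; the product tends to 0 as s tends to minus
  infinity.\<close>

lemma rel_if_decay:
  assumes "\<And>t. t \<le> 0 \<Longrightarrow> q (S t z - S t w) \<le> C * exp (a * t)"
  shows "rel z w"
  unfolding rel_def
proof
  fix t
  have "((\<lambda>s. - C * exp (a * t / 2) * exp (a / 2 * s)) \<longlongrightarrow> - C * exp (a * t / 2) * 0) at_bot"
    by (intro tendsto_intros filterlim_compose[OF exp_at_bot]
        filterlim_tendsto_pos_mult_at_bot[OF tendsto_const _ filterlim_ident]) (use a_pos in simp)
  moreover have "\<forall>\<^sub>F s in at_bot. - C * exp (a * t / 2) * exp (a / 2 * s) \<le> V (S t z - S t w)"
    using eventually_le_at_bot[of "min t 0"]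
  proof eventually_elim
    case (elim s)
    have eq: "exp (a / 2 * (t - s)) * exp (a * s) = exp (a * t / 2) * exp (a / 2 * s)"
      unfolding exp_add[symmetric] by (rule arg_cong[of _ _ exp]) (simp add: field_simps)
    have "- C * exp (a * t / 2) * exp (a / 2 * s) = exp (a / 2 * (t - s)) * (- C * exp (a * s))"
      using arg_cong[OF eq, of "\<lambda>x. - C * x"] by (simp only: mult_ac)
    also have "\<dots> \<le> exp (a / 2 * (t - s)) * V (S s z - S s w)"
      using V_ge[of "S s z - S s w"] assms[of s] elim by (intro mult_left_mono) auto
    also have "\<dots> \<le> V (S t z - S t w)"
      using elim by (intro cone_growth) simp
    finally show ?case .
  qed
  ultimately show "V (S t z - S t w) \<ge> 0"
    using tendsto_upperbound[of _ _ at_bot] by fastforce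
qed

lemma rel_trans:
  assumes "rel x y" "rel y z"
  shows "rel x z"
proof (rule rel_if_decay)
  fix t :: real assume t: "t \<le> 0"
  have "q (S t x - S t z) \<le> 2 * q (S t x - S t y) + 2 * q (S t y - S t z)"
    using q_add_le[of "S t x - S t y" "S t y - S t z"] by simp
  also have "\<dots> \<le> 2 * (5 * exp (a * t) * qu (x - y)) + 2 * (5 * exp (a * t) * qu (y - z))"
    using rel_decay[OF assms(1) t] rel_decay[OF assms(2) t] by simp
  finally show "q (S t x - S t z) \<le> (10 * qu (x - y) + 10 * qu (y - z)) * exp (a * t)"
    by (simp add: algebra_simps)
qed

text \<open>For fixed t the approximating pairs have to be in the cone only eventually, because
  points constructed at time -n are controlled only from then on.\<close>

lemma rel_limit:
  fixes p z :: "nat \<Rightarrow> 'x \<times> 'y"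
  assumes "p \<longlonglongrightarrow> p'" "z \<longlonglongrightarrow> z'"
    and "\<And>t. \<forall>\<^sub>F n in sequentially. V (S t (p n) - S t (z n)) \<ge> 0"
  shows "rel p' z'"
  unfolding rel_def
proof
  fix t
  have "(\<lambda>n. V (S t (p n) - S t (z n))) \<longlonglongrightarrow> V (S t p' - S t z')"
    by (intro tendsto_V tendsto_diff fl.tendsto_flow assms)
  then show "V (S t p' - S t z') \<ge> 0"
    using assms(3) by (rule tendsto_lowerbound) simp
qed

end

section \<open>The linearizing coordinate and existence of leaves\<close>

text \<open>A solution of f v = w is a fixed point of v - f v + w, which maps the ball of radius |w|
  + R into itself. Boundedness of f - id thus replaces a contraction estimate.\<close>

lemma bounded_perturbation_of_identity_surj:
  fixes f :: "'a::euclidean_space \<Rightarrow> 'a"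
  assumes "continuous_on UNIV f" and "\<And>v. norm (f v - v) \<le> R"
  shows "\<exists>v. f v = w"
proof -
  have R: "norm w + R \<ge> 0"
    using order_trans[OF norm_ge_zero assms(2)] by (intro add_nonneg_nonneg) auto
  have "\<exists>v\<in>cball 0 (norm w + R). w - (f v - v) = v"
  proof (rule brouwer[of _ "\<lambda>v. w - (f v - v)"])
    show "continuous_on (cball 0 (norm w + R)) (\<lambda>v. w - (f v - v))"
      by (intro continuous_intros continuous_on_subset[OF assms(1)]) auto
    show "(\<lambda>v. w - (f v - v)) \<in> cball 0 (norm w + R) \<rightarrow> cball 0 (norm w + R)"
    proof
      fix v
      have "norm (w - (f v - v)) \<le> norm w + norm (f v - v)" by (rule norm_triangle_ineq4)
      then show "w - (f v - v) \<in> cball 0 (norm w + R)" using assms(2)[of v] by simp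
    qed
  qed (use R in auto)
  then obtain v where "w - (f v - v) = v" by blast
  then have "f v = w" by (simp add: algebra_simps)
  then show ?thesis by blast
qed

text \<open>Turns uniqueness into convergence: a subsequence that stays away from x would have a
  further subsequence with another limit.\<close>

lemma tendsto_if_unique_subsequential_limit:
  fixes X :: "nat \<Rightarrow> 'a::heine_borel"
  assumes "bounded (range X)"
    and lim: "\<And>r l. strict_mono r \<Longrightarrow> (\<lambda>n. X (r n)) \<longlonglongrightarrow> l \<Longrightarrow> l = x"
  shows "X \<longlonglongrightarrow> x"
proof (rule tendstoI, rule ccontr)
  fix d :: real
  assume d: "d > 0" and "\<not> (\<forall>\<^sub>F n in sequentially. dist (X n) x < d)"
  then have "\<exists>\<^sub>F n in sequentially. \<not> dist (X n) x < d"
    by (simp add: not_eventually)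
  then have inf: "infinite {n. \<not> dist (X n) x < d}"
    by (simp add: frequently_cofinite flip: cofinite_eq_sequentially)
  define r where "r = enumerate {n. \<not> dist (X n) x < d}"
  have r: "strict_mono r" "\<not> dist (X (r n)) x < d" for n
    using strict_mono_enumerate[OF inf] enumerate_in_set[OF inf, of n] by (auto simp: r_def)
  have "bounded (range (\<lambda>n. X (r n)))"
    using assms(1) by (rule bounded_subset) auto
  then obtain l s where s: "strict_mono (s :: nat \<Rightarrow> nat)" "((\<lambda>n. X (r n)) \<circ> s) \<longlonglongrightarrow> l"
    using bounded_imp_convergent_subsequence by blast
  then have tends: "(\<lambda>n. X (r (s n))) \<longlonglongrightarrow> l" by (simp add: o_def)
  moreover from this have "l = x"
    using strict_mono_o[OF r(1) s(1)] lim[of "r \<circ> s" l] by (simp add: o_def)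
  ultimately have "\<forall>\<^sub>F n in sequentially. dist (X (r (s n))) x < d"
    using d by (auto dest: tendstoD)
  then show False using r(2) by simp
qed

lemma exp_neg_tendsto_0:
  fixes a c :: real
  assumes "a > 0"
  shows "((\<lambda>t. c * exp (- a * t)) \<longlongrightarrow> 0) at_top"
proof -
  have "((\<lambda>t. c * exp (- a * t)) \<longlongrightarrow> c * 0) at_top"
    by (intro tendsto_intros filterlim_compose[OF exp_at_bot]
        filterlim_tendsto_neg_mult_at_bot[OF tendsto_const _ filterlim_ident]) (use assms in simp)
  then show ?thesis by simp
qed

context palmer_system
begin

definition M :: real where "M = (SOME M. M > 0 \<and> (\<forall>z. norm (L (Pu (h z))) \<le> M))"

lemma M_pos: "M > 0" and M: "norm (L (Pu (h z))) \<le> M"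
proof -
  obtain C where C: "C > 0" "\<And>y. norm (L (Pu y)) \<le> C * norm y"
    using linear_norm_le[OF linear_compose[OF linear_Pu linear_L]] by (auto simp: o_def)
  obtain b where b: "b > 0" "\<And>z. norm (h z) \<le> b" using bounded_h unfolding bounded_pos by blast
  have "norm (L (Pu (h z))) \<le> C * b" for z
    using C(2)[of "h z"] mult_left_mono[OF b(2)[of z], of C] C(1) by linarith
  then have "\<exists>M>0. \<forall>z. norm (L (Pu (h z))) \<le> M"
    using C(1) b(1) by (intro exI[of _ "C * b"]) auto
  from someI_ex[OF this, folded M_def] show "M > 0" "norm (L (Pu (h z))) \<le> M" by blast+
qed

lemma unstable_flow_back_le:
  assumes "t \<ge> 0"
  shows "norm (L (Pu (flow A (- t) y))) \<le> exp (- a * t) * norm (L (Pu y))"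
proof -
  have "exp (a * t) * norm (L (Pu (flow A (- t) y))) \<le> norm (L (Pu y))"
    using unstable_flow_ge[OF assms, of "flow A (- t) y"] by simp
  then have "exp (- a * t) * (exp (a * t) * norm (L (Pu (flow A (- t) y)))) \<le> exp (- a * t) * norm (L (Pu y))"
    by (intro mult_left_mono) auto
  then show ?thesis by (simp add: mult.assoc[symmetric] exp_add[symmetric])
qed

text \<open>The vector \<open>flow A (- t) (y t)\<close> moves with velocity \<open>flow A (- t) (h t)\<close>, which decays exponentially in
  the unstable directions; so its unstable part converges uniformly as \<open>t\<close> tends to infinity, and
  the limit is a coordinate that evolves exactly linearly.\<close>

definition G :: "real \<Rightarrow> 'x \<times> 'y \<Rightarrow> 'y" where "G t z = Pu (flow A (- t) (snd (S t z)))"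

definition Hu :: "'x \<times> 'y \<Rightarrow> 'y" where "Hu z = lim (\<lambda>n. G (real n) z)"

lemma G_0 [simp]: "G 0 z = Pu (snd z)"
  by (simp add: G_def)

lemma G_deriv: "((\<lambda>t. L (G t z)) has_vector_derivative L (Pu (flow A (- t) (h (S t z))))) (at t)"
proof -
  have "bounded_linear (\<lambda>y. L (Pu y))"
    using linear_compose[OF linear_Pu linear_L] by (simp add: o_def linear_conv_bounded_linear)
  from bounded_linear.has_vector_derivative[OF this li.flow_back_deriv[OF snd_flow_deriv]]
  show ?thesis unfolding G_def .
qed

text \<open>The curve moves with speed at most M exp(-a x), whose integral from s onwards is M/a
  exp(-a s).\<close>

lemma G_dist:
  assumes "0 \<le> s" "s \<le> t"
  shows "norm (L (G t z) - L (G s z)) \<le> M / a * exp (- a * s)"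
proof (cases "s = t")
  case True
  then show ?thesis using M_pos a_pos by simp
next
  case False
  then have "s < t" using assms by simp
  have "norm (L (G t z) - L (G s z)) \<le> - M / a * exp (- a * t) - (- M / a * exp (- a * s))"
  proof (rule differentiable_bound_general[OF \<open>s < t\<close>])
    show "continuous_on {s..t} (\<lambda>t. L (G t z))"
      by (intro continuous_at_imp_continuous_on ballI has_vector_derivative_continuous[OF G_deriv])
    show "continuous_on {s..t} (\<lambda>x. - M / a * exp (- a * x))"
      by (intro continuous_intros)
    show "((\<lambda>t. L (G t z)) has_vector_derivative L (Pu (flow A (- x) (h (S x z))))) (at x)" for x
      by (rule G_deriv)
    show "((\<lambda>x. - M / a * exp (- a * x)) has_vector_derivative M * exp (- a * x)) (at x)" for x
      unfolding has_real_derivative_iff_has_vector_derivative[symmetric]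
      using a_pos by (auto intro!: derivative_eq_intros)
    show "norm (L (Pu (flow A (- x) (h (S x z))))) \<le> M * exp (- a * x)" if "s < x" for x
    proof -
      have "norm (L (Pu (flow A (- x) (h (S x z))))) \<le> exp (- a * x) * norm (L (Pu (h (S x z))))"
        using that assms by (intro unstable_flow_back_le) simp
      also have "\<dots> \<le> exp (- a * x) * M" by (intro mult_left_mono M) simp
      finally show ?thesis by (simp add: mult.commute)
    qed
  qed
  moreover have "M / a * exp (- a * t) \<ge> 0" using M_pos a_pos by simp
  ultimately show ?thesis by simp
qed

lemma norm_le_L:
  obtains c where "c > 0" "\<And>y. norm y \<le> c * norm (L y)"
  using linear_injective_norm_le[OF linear_L inj_L] by blast

lemma G_limit: "(\<lambda>n. G (real n) z) \<longlonglongrightarrow> Hu z"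
proof -
  obtain c where c: "c > 0" "\<And>y. norm y \<le> c * norm (L y)" by (rule norm_le_L) blast
  have *: "norm (G t z - G s z) \<le> c * (M / a) * exp (- a * s)" if "0 \<le> s" "s \<le> t" for s t
  proof -
    have "norm (G t z - G s z) \<le> c * norm (L (G t z) - L (G s z))"
      using c(2)[of "G t z - G s z"] by (simp add: linear_diff[OF linear_L])
    also have "\<dots> \<le> c * (M / a * exp (- a * s))"
      using c(1) by (intro mult_left_mono G_dist that) simp
    finally show ?thesis by (simp add: mult.assoc)
  qed
  have "Cauchy (\<lambda>n. G (real n) z)"
  proof (rule CauchyI')
    fix r :: real assume "r > 0"
    have "((\<lambda>n. c * (M / a) * exp (- a * real n)) \<longlonglongrightarrow> 0)"
      by (rule filterlim_compose[OF exp_neg_tendsto_0[OF a_pos] filterlim_real_sequentially])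
    then have "\<forall>\<^sub>F n in sequentially. c * (M / a) * exp (- a * real n) < r"
      using \<open>r > 0\<close> by (rule order_tendstoD)
    then obtain N where N: "\<And>n. n \<ge> N \<Longrightarrow> c * (M / a) * exp (- a * real n) < r"
      unfolding eventually_sequentially by blast
    have "dist (G (real m) z) (G (real n) z) < r" if "m \<ge> N" "n > m" for m n
      using *[of "real m" "real n"] N[of m] that by (simp add: dist_norm norm_minus_commute)
    then show "\<exists>N. \<forall>m\<ge>N. \<forall>n>m. dist (G (real m) z) (G (real n) z) < r" by blast
  qed
  then show ?thesis unfolding Hu_def
    using Cauchy_convergent convergent_LIMSEQ_iff by blast
qed

lemma tendsto_linears:
  assumes "(f \<longlongrightarrow> y) net"
  shows "((\<lambda>n. L (f n)) \<longlongrightarrow> L y) net" "((\<lambda>n. Pu (f n)) \<longlongrightarrow> Pu y) net"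
    "((\<lambda>n. Ps (f n)) \<longlongrightarrow> Ps y) net"
  using assms linear_L linear_Pu linear_Ps
  by (auto simp: linear_conv_bounded_linear intro: bounded_linear.tendsto)

lemma Hu_G_dist:
  assumes "s \<ge> 0"
  shows "norm (L (Hu z) - L (G s z)) \<le> M / a * exp (- a * s)"
proof (rule tendsto_upperbound)
  show "(\<lambda>n. norm (L (G (real n) z) - L (G s z))) \<longlonglongrightarrow> norm (L (Hu z) - L (G s z))"
    by (intro tendsto_intros tendsto_linears G_limit)
  show "\<forall>\<^sub>F n in sequentially. norm (L (G (real n) z) - L (G s z)) \<le> M / a * exp (- a * s)"
    using eventually_ge_at_top[of "nat \<lceil>s\<rceil>"]
    by eventually_elim (rule G_dist, use assms in \<open>auto simp: nat_le_iff ceiling_le_iff\<close>)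
qed simp

lemma Hu_near: "norm (L (Hu z) - L (Pu (snd z))) \<le> M / a"
  using Hu_G_dist[of 0 z] by simp

lemma Hu_G_bound:
  obtains C where "\<And>z t. t \<ge> 0 \<Longrightarrow> norm (G t z - Hu z) \<le> C * exp (- a * t)"
proof -
  obtain c where c: "c > 0" "\<And>y. norm y \<le> c * norm (L y)" by (rule norm_le_L) blast
  have "norm (G t z - Hu z) \<le> c * (M / a) * exp (- a * t)" if "t \<ge> 0" for z t
  proof -
    have "norm (G t z - Hu z) \<le> c * norm (L (Hu z) - L (G t z))"
      using c(2)[of "Hu z - G t z"] by (simp add: linear_diff[OF linear_L] norm_minus_commute)
    also have "\<dots> \<le> c * (M / a * exp (- a * t))"
      using c(1) by (intro mult_left_mono Hu_G_dist that) simp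
    finally show ?thesis by (simp add: mult.assoc)
  qed
  then show ?thesis by (rule that)
qed

text \<open>\<open>Hu\<close> is defined along integer times; the limit over real times permits the
  shift by an arbitrary s in \<open>Hu_flow\<close>.\<close>

lemma G_tendsto: "((\<lambda>t. G t z) \<longlongrightarrow> Hu z) at_top"
proof -
  obtain C where C: "\<And>z t. t \<ge> 0 \<Longrightarrow> norm (G t z - Hu z) \<le> C * exp (- a * t)"
    by (rule Hu_G_bound) blast
  have "((\<lambda>t. G t z - Hu z) \<longlongrightarrow> 0) at_top"
  proof (rule Lim_null_comparison)
    show "\<forall>\<^sub>F t in at_top. norm (G t z - Hu z) \<le> C * exp (- a * t)"
      using eventually_ge_at_top[of 0] by eventually_elim (rule C)
  qed (rule exp_neg_tendsto_0[OF a_pos])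
  then show ?thesis by (rule LIM_zero_cancel)
qed

lemma continuous_on_Hu: "continuous_on UNIV Hu"
proof (rule uniform_limit_theorem)
  show "uniform_limit UNIV (\<lambda>n. G (real n)) Hu sequentially"
  proof (rule uniform_limitI)
    fix r :: real assume "r > 0"
    obtain C where C: "\<And>z t. t \<ge> 0 \<Longrightarrow> norm (G t z - Hu z) \<le> C * exp (- a * t)"
      by (rule Hu_G_bound) blast
    have "((\<lambda>n. C * exp (- a * real n)) \<longlonglongrightarrow> 0)"
      by (rule filterlim_compose[OF exp_neg_tendsto_0[OF a_pos] filterlim_real_sequentially])
    then have "\<forall>\<^sub>F n in sequentially. C * exp (- a * real n) < r"
      using \<open>r > 0\<close> by (rule order_tendstoD)
    then show "\<forall>\<^sub>F n in sequentially. \<forall>z\<in>UNIV. dist (G (real n) z) (Hu z) < r"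
    proof eventually_elim
      case (elim n)
      then show ?case using C[of "real n"] by (auto simp: dist_norm intro: le_less_trans)
    qed
  qed
  show "\<forall>\<^sub>F n in sequentially. continuous_on UNIV (G (real n))"
    unfolding G_def
    by (intro always_eventually allI continuous_intros li.continuous_on_flow fl.continuous_on_flow)
qed simp

lemma tendsto_Hu: "(f \<longlongrightarrow> z) net \<Longrightarrow> ((\<lambda>n. Hu (f n)) \<longlongrightarrow> Hu z) net"
  by (rule continuous_on_tendsto_compose[OF continuous_on_Hu]) auto

text \<open>Starting from \<open>S s z\<close> only shifts time inside G and applies
  \<open>flow A s\<close> outside. As t tends to infinity the shift disappears, which leaves an
  exactly linear evolution.\<close>

lemma Hu_flow: "Hu (S s z) = flow A s (Hu z)"
proof (rule tendsto_unique)
  show "((\<lambda>t. G t (S s z)) \<longlongrightarrow> Hu (S s z)) at_top" by (rule G_tendsto)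
  have "G t (S s z) = flow A s (G (s + t) z)" for t
  proof -
    have "flow A (- t) y = flow A s (flow A (- (s + t)) y)" for y
      by (simp flip: li.flow_add)
    then show ?thesis
      by (simp add: G_def flow_Pu add.commute flip: fl.flow_add)
  qed
  moreover have "((\<lambda>t. flow A s (G (s + t) z)) \<longlongrightarrow> flow A s (Hu z)) at_top"
    by (intro li.tendsto_flow filterlim_compose[OF G_tendsto]
        filterlim_tendsto_add_at_top[OF tendsto_const filterlim_ident])
  ultimately show "((\<lambda>t. G t (S s z)) \<longlongrightarrow> flow A s (Hu z)) at_top" by simp
qed simp

lemma Pu_Hu [simp]: "Pu (Hu z) = Hu z"
proof (rule LIMSEQ_unique)
  show "(\<lambda>n. Pu (G (real n) z)) \<longlonglongrightarrow> Pu (Hu z)" by (intro tendsto_linears G_limit)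
  show "(\<lambda>n. Pu (G (real n) z)) \<longlonglongrightarrow> Hu z" using G_limit by (simp add: G_def)
qed

lemma Ps_Hu [simp]: "Ps (Hu z) = 0"
  using Ps_Pu[of "Hu z"] by simp

lemma L_eq_0: "norm (L y) \<le> 0 \<Longrightarrow> y = 0"
  using linear_injective_0[OF linear_L] inj_L by simp

lemma Hu_unstable_dist:
  "norm (L (Pu (snd (p - z)))) \<le> norm (L (Hu p - Hu z)) + 2 * (M / a)"
  "norm (L (Hu p - Hu z)) \<le> norm (L (Pu (snd (p - z)))) + 2 * (M / a)"
proof -
  let ?u = "L (Hu p) - L (Pu (snd p))" and ?v = "L (Hu z) - L (Pu (snd z))"
  have *: "L (Hu p - Hu z) = L (Pu (snd (p - z))) + (?u - ?v)"
    by (simp add: linear_simps)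
  have "norm (?u - ?v) \<le> 2 * (M / a)"
    using norm_triangle_ineq4[of ?u ?v] Hu_near[of p] Hu_near[of z] by linarith
  then show "norm (L (Pu (snd (p - z)))) \<le> norm (L (Hu p - Hu z)) + 2 * (M / a)"
    "norm (L (Hu p - Hu z)) \<le> norm (L (Pu (snd (p - z)))) + 2 * (M / a)"
    unfolding * using norm_triangle_ineq[of "L (Pu (snd (p - z)))" "?u - ?v"]
      norm_diff_ineq[of "L (Pu (snd (p - z)))" "?u - ?v"] by linarith+
qed

text \<open>The difference of the two coordinates grows at least like exp(a t), yet exceeds the
  unstable difference of the orbits by at most 2 M/a; boundedness leaves only 0.\<close>

lemma Hu_eq_if_bounded:
  assumes "\<And>t. t \<ge> 0 \<Longrightarrow> qu (S t p - S t z) \<le> C"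
  shows "Hu p = Hu z"
proof -
  have "norm (L (Hu p - Hu z)) \<le> 0"
  proof (rule exp_growth_unbounded[OF a_pos])
    fix t :: real assume t: "t \<ge> 0"
    have "norm (L (Pu (snd (S t p - S t z)))) \<le> sqrt C"
      using assms[OF t] by (intro real_le_rsqrt) (simp add: qu_def)
    moreover have "exp (a * t) * norm (L (Pu (Hu p - Hu z))) \<le> norm (L (Pu (flow A t (Hu p - Hu z))))"
      by (rule unstable_flow_ge[OF t])
    ultimately show "exp (a * t) * norm (L (Hu p - Hu z)) \<le> sqrt C + 2 * (M / a)"
      using Hu_unstable_dist(2)[of "S t p" "S t z"]
      by (simp add: Hu_flow linear_diff[OF linear_Pu] linear_diff[OF li.linear_flow] flow_Pu[symmetric])
  qed
  then show ?thesis using L_eq_0 by fastforce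
qed

text \<open>Equality of \<open>Hu\<close> persists along the flow, so the unstable components of the
  orbits stay within 2 M/a of each other; with V positive they would separate exponentially.\<close>

lemma V_nonpos_if_Hu_eq:
  assumes "Hu p = Hu z"
  shows "V (p - z) \<le> 0"
proof (rule V_nonpos_if_unstable_bounded)
  fix t
  have "norm (L (Pu (snd (S t p - S t z)))) \<le> 2 * (M / a)"
    using Hu_unstable_dist(1)[of "S t p" "S t z"] assms
    by (simp add: Hu_flow linear_0[OF linear_L])
  then show "qu (S t p - S t z) \<le> (2 * (M / a))\<^sup>2"
    unfolding qu_def by (rule power_mono) simp
qed

text \<open>Sharing a leaf gives V \<ge> 0 and equal \<open>Hu\<close> gives V \<le> 0 at all times,
  so V vanishes along the orbit.\<close>

lemma rel_unique:
  assumes "rel p z" "rel p' z" "Hu p = Hu p'"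
  shows "p = p'"
proof (rule eq_if_V_eq_0)
  fix t
  have "rel p p'" using assms rel_sym rel_trans by blast
  then have "V (S t p - S t p') \<ge> 0" by (simp add: rel_def)
  moreover have "V (S t p - S t p') \<le> 0"
    using assms(3) by (intro V_nonpos_if_Hu_eq) (simp add: Hu_flow)
  ultimately show "V (S t p - S t p') = 0" by simp
qed

lemma Hu_solve:
  assumes "Pu w = w"
  shows "\<exists>v. Hu (x, Pu v + Ps y) = w"
proof -
  obtain c where c: "c > 0" "\<And>y. norm y \<le> c * norm (L y)" by (rule norm_le_L) blast
  \<comment> \<open>The summand \<open>Ps v\<close> extends the map from the unstable subspace to
    the whole space, where it is a bounded perturbation of the identity; applying \<open>Pu\<close>
    removes it again.\<close>
  have "\<exists>v. Hu (x, Pu v + Ps y) + Ps v = w"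
  proof (rule bounded_perturbation_of_identity_surj)
    show "continuous_on UNIV (\<lambda>v. Hu (x, Pu v + Ps y) + Ps v)"
      by (intro continuous_on_add continuous_on_compose2[OF continuous_on_Hu, of _ "\<lambda>v. (x, Pu v + Ps y)"]
          continuous_intros) auto
    fix v
    let ?d = "Hu (x, Pu v + Ps y) - Pu (snd (x, Pu v + Ps y))"
    have "norm ?d \<le> c * norm (L ?d)" by (rule c(2))
    also have "\<dots> \<le> c * (M / a)"
      using Hu_near[of "(x, Pu v + Ps y)"] c(1)
      by (intro mult_left_mono) (simp_all add: linear_diff[OF linear_L])
    also have "?d = Hu (x, Pu v + Ps y) + Ps v - v"
      using Pu_plus_Ps[of v] by (simp add: linear_add[OF linear_Pu] algebra_simps)
    finally show "norm (Hu (x, Pu v + Ps y) + Ps v - v) \<le> c * (M / a)" .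
  qed
  then obtain v where v: "Hu (x, Pu v + Ps y) + Ps v = w" by blast
  then have "Pu (Hu (x, Pu v + Ps y) + Ps v) = w" using assms by simp
  then have "Hu (x, Pu v + Ps y) = w" by (simp add: linear_add[OF linear_Pu])
  then show ?thesis by (rule exI)
qed

lemma bounded_if_q_bounded:
  assumes "\<And>n. q (f n) \<le> C"
  shows "\<exists>R. \<forall>n. norm (f n) \<le> R"
proof -
  obtain c where c: "c > 0" "\<And>z. (norm z)\<^sup>2 \<le> c * q z" by (rule norm_le_q) blast
  have "norm (f n) \<le> sqrt (c * C)" for n
    using c(2)[of "f n"] mult_left_mono[OF assms[of n], of c] c(1) by (intro real_le_rsqrt) linarith
  then show ?thesis by blast
qed

text \<open>In the cone the unstable difference controls everything, and \<open>Hu\<close>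
  determines it up to 2 M/a. This is the source of compactness below.\<close>

lemma rel_near:
  assumes "V (p - z) \<ge> 0"
  shows "q (p - z) \<le> 5 * (norm (L (Hu p - Hu z)) + 2 * (M / a))\<^sup>2"
proof -
  have "qu (p - z) \<le> (norm (L (Hu p - Hu z)) + 2 * (M / a))\<^sup>2"
    unfolding qu_def by (rule power_mono[OF Hu_unstable_dist(1)]) simp
  then show ?thesis using q_le_cone[OF assms] by linarith
qed

text \<open>The point is found as a limit of points which at time \<open>- n\<close> differ from \<open>z\<close> in the unstable
  direction only; these differences stay in the cone from then on.\<close>

lemma rel_exists:
  assumes "Pu w = w"
  shows "\<exists>p. rel p z \<and> Hu p = w"
proof -
  \<comment> \<open>The prescribed value is the one that flowing forward for time n turns into
    w.\<close>
  have "\<exists>\<zeta>. Hu \<zeta> = flow A (- real n) w \<and> V (\<zeta> - S (- real n) z) \<ge> 0" for n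
  proof -
    obtain v where v: "Hu (fst (S (- real n) z), Pu v + Ps (snd (S (- real n) z))) = flow A (- real n) w"
      using Hu_solve[of "flow A (- real n) w" "fst (S (- real n) z)" "snd (S (- real n) z)"]
        flow_Pu[of "- real n" w] assms by auto
    \<comment> \<open>Equal centre and stable components leave V = qu.\<close>
    have "V ((fst (S (- real n) z), Pu v + Ps (snd (S (- real n) z))) - S (- real n) z) \<ge> 0"
      by (simp add: V_def qc_def qs_def linear_simps q_nonneg)
    then show ?thesis using v by blast
  qed
  then have "\<exists>\<zeta>. \<forall>n. Hu (\<zeta> n) = flow A (- real n) w \<and> V (\<zeta> n - S (- real n) z) \<ge> 0"
    by (intro choice allI)
  then obtain \<zeta> where \<zeta>: "\<And>n. Hu (\<zeta> n) = flow A (- real n) w" "\<And>n. V (\<zeta> n - S (- real n) z) \<ge> 0"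
    by blast
  define p where "p n = S (real n) (\<zeta> n)" for n
  have Hp: "Hu (p n) = w" for n by (simp add: p_def Hu_flow \<zeta>)
  have Vp: "V (S t (p n) - S t z) \<ge> 0" if "t \<ge> - real n" for n t
  proof -
    have "exp (a / 2 * (t + real n - 0)) * V (S 0 (\<zeta> n) - S 0 (S (- real n) z))
        \<le> V (S (t + real n) (\<zeta> n) - S (t + real n) (S (- real n) z))"
      using that by (intro cone_growth) simp
    moreover have "exp (a / 2 * (t + real n - 0)) * V (S 0 (\<zeta> n) - S 0 (S (- real n) z)) \<ge> 0"
      using \<zeta>(2)[of n] by simp
    moreover have "S (t + real n) (\<zeta> n) = S t (p n)" "S (t + real n) (S (- real n) z) = S t z"
      unfolding p_def by (simp_all flip: fl.flow_add)
    ultimately show ?thesis by simp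
  qed
  \<comment> \<open>The bound is independent of n, since \<open>Hu\<close> takes the value w at
    every \<open>p n\<close>.\<close>
  have "q (p n - z) \<le> 5 * (norm (L (w - Hu z)) + 2 * (M / a))\<^sup>2" for n
    using rel_near[of "p n" z] Vp[of n 0] by (simp add: Hp)
  from bounded_if_q_bounded[of "\<lambda>n. p n - z", OF this] obtain R where R: "\<And>n. norm (p n - z) \<le> R" by blast
  have "bounded (range p)"
    unfolding bounded_def by (intro exI[of _ z] exI[of _ R]) (auto simp: dist_norm norm_minus_commute[of z] R)
  then obtain l r where lr: "strict_mono (r :: nat \<Rightarrow> nat)" "(p \<circ> r) \<longlonglongrightarrow> l"
    using bounded_imp_convergent_subsequence by blast
  have "rel l z"
  proof (rule rel_limit[OF lr(2) tendsto_const])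
    fix t
    show "\<forall>\<^sub>F n in sequentially. 0 \<le> V (S t ((p \<circ> r) n) - S t z)"
      using eventually_ge_at_top[of "nat \<lceil>- t\<rceil>"]
    proof eventually_elim
      case (elim n)
      have "real n \<ge> - t" using elim by (simp add: nat_le_iff ceiling_le_iff)
      then have "t \<ge> - real (r n)"
        using seq_suble[OF lr(1), of n] by (simp add: of_nat_le_iff[symmetric, where 'a = real] del: of_nat_le_iff)
      then show ?case using Vp[where n = "r n" and t = t] by simp
    qed
  qed
  moreover have "Hu l = w"
    using tendsto_Hu[OF lr(2)] by (simp add: Hp LIMSEQ_const_iff)
  ultimately show ?thesis by blast
qed

lemma rel_ex1: "Pu w = w \<Longrightarrow> \<exists>!p. rel p z \<and> Hu p = w"
  using rel_exists rel_unique by blast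

text \<open>Holonomy along unstable leaves onto the set Hu = 0, which will be the centre-stable
  manifold.\<close>

definition Tu :: "'x \<times> 'y \<Rightarrow> 'x \<times> 'y" where "Tu z = (THE p. rel p z \<and> Hu p = 0)"

lemma rel_Tu: "rel (Tu z) z" and Hu_Tu: "Hu (Tu z) = 0"
  using theI'[OF rel_ex1[of 0 z]] by (simp_all add: Tu_def linear_simps)

lemma Tu_eqI: "rel p z \<Longrightarrow> Hu p = 0 \<Longrightarrow> p = Tu z"
  using rel_unique[of p z "Tu z"] rel_Tu Hu_Tu by simp

lemma Tu_flow: "Tu (S t z) = S t (Tu z)"
  by (rule Tu_eqI[symmetric]) (simp_all add: rel_shift rel_Tu Hu_flow Hu_Tu linear_0[OF li.linear_flow])

text \<open>No modulus of continuity is estimated. Along a convergent sequence the images stay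
  bounded by \<open>rel_near\<close>; every subsequential limit shares a leaf with the limit point
  and has Hu = 0, so uniqueness identifies it.\<close>

lemma continuous_on_Tu: "continuous_on UNIV Tu"
proof -
  have "isCont Tu z" for z
    unfolding continuous_at_sequentially
  proof (intro allI impI)
    fix f :: "nat \<Rightarrow> 'x \<times> 'y" assume f: "f \<longlonglongrightarrow> z"
    have "Bseq (\<lambda>n. L (Hu (f n)))"
      by (rule convergent_imp_Bseq[OF convergentI[OF tendsto_linears(1)[OF tendsto_Hu[OF f]]]])
    then obtain K where K: "\<And>n. norm (L (Hu (f n))) \<le> K" by (auto simp: Bseq_def)
    have "q (Tu (f n) - f n) \<le> 5 * (K + 2 * (M / a))\<^sup>2" for n
    proof -
      have "V (Tu (f n) - f n) \<ge> 0"
        using spec[OF rel_Tu[of "f n", unfolded rel_def], of 0] by simp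
      from rel_near[OF this] have "q (Tu (f n) - f n) \<le> 5 * (norm (L (Hu (f n))) + 2 * (M / a))\<^sup>2"
        by (simp add: Hu_Tu linear_simps)
      also have "\<dots> \<le> 5 * (K + 2 * (M / a))\<^sup>2"
        using K[of n] M_pos a_pos by (intro mult_left_mono power_mono add_mono) auto
      finally show ?thesis .
    qed
    from bounded_if_q_bounded[of "\<lambda>n. Tu (f n) - f n", OF this] obtain R where R: "\<And>n. norm (Tu (f n) - f n) \<le> R" by blast
    obtain R' where R': "\<And>n. norm (f n) \<le> R'"
      using convergent_imp_Bseq[OF convergentI[OF f]] by (auto simp: Bseq_def)
    have "norm (Tu (f n)) \<le> R + R'" for n
      using norm_triangle_sub[of "Tu (f n)" "f n"] R[of n] R'[of n] by linarith
    then have bdd: "bounded (range (\<lambda>n. Tu (f n)))" unfolding bounded_iff by auto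
    show "(Tu \<circ> f) \<longlonglongrightarrow> Tu z"
      unfolding o_def
    proof (rule tendsto_if_unique_subsequential_limit[OF bdd])
      fix r :: "nat \<Rightarrow> nat" and l
      assume r: "strict_mono r" and l: "(\<lambda>n. Tu (f (r n))) \<longlonglongrightarrow> l"
      have fr: "(\<lambda>n. f (r n)) \<longlonglongrightarrow> z"
        using LIMSEQ_subseq_LIMSEQ[OF f r] by (simp add: o_def)
      have "rel l z"
        by (rule rel_limit[OF l fr]) (use rel_Tu in \<open>auto simp: rel_def\<close>)
      moreover have "Hu l = 0"
        using tendsto_Hu[OF l] by (simp add: Hu_Tu LIMSEQ_const_iff)
      ultimately show "l = Tu z" by (rule Tu_eqI)
    qed
  qed
  then show ?thesis by (simp add: continuous_on_eq_continuous_at)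
qed

end

section \<open>The conjugacy\<close>

context palmer_system
begin

section \<open>Time reversal and the full hyperbolic coordinate\<close>

lemma reverse_splitting: "splitting (\<lambda>y. - A y) (\<lambda>x. - B x) Ps Pu Lc L a"
proof (rule splitting.intro)
  show "Ps y + Pu y = y" for y using Pu_plus_Ps[of y] by (simp add: add.commute)
  show "a * (norm (L (Ps y)))\<^sup>2 \<le> inner (L (- A (Ps y))) (L (Ps y))" for y
    using contracting[of y] by (simp add: linear_neg[OF linear_L])
  show "inner (L (- A (Pu y))) (L (Pu y)) \<le> - a * (norm (L (Pu y)))\<^sup>2" for y
    using expanding[of y] by (simp add: linear_neg[OF linear_L])
  show "\<bar>inner (Lc (- B x)) (Lc x)\<bar> \<le> a / 8 * (norm (Lc x))\<^sup>2" for x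
    using center[of x] by (simp add: linear_neg[OF linear_Lc])
qed (simp_all add: linears linear_compose_neg linear_neg[OF linear_Pu] linear_neg[OF linear_Ps]
    Pu_A Ps_A inj_Lc inj_L a_pos)

lemma reverse: "palmer_system (\<lambda>y. - A y) (\<lambda>x. - B x) Ps Pu Lc L a (\<lambda>z. - g z) (\<lambda>z. - h z) e"
proof -
  interpret rev: splitting "\<lambda>y. - A y" "\<lambda>x. - B x" Ps Pu Lc L a
    by (rule reverse_splitting)
  have q: "rev.q z = q z" for z
    by (simp add: rev.q_def rev.qc_def rev.qu_def rev.qs_def q_def qc_def qu_def qs_def)
  have neg: "K-lipschitz_on UNIV f \<Longrightarrow> K-lipschitz_on UNIV (\<lambda>z. - f z)"
    for K and f :: "'x \<times> 'y \<Rightarrow> 'c::real_normed_vector"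
    by (auto simp: lipschitz_on_def dist_norm norm_minus_commute)
  have bdd: "bounded (range f) \<Longrightarrow> bounded (range (\<lambda>z. - f z))"
    for f :: "'x \<times> 'y \<Rightarrow> 'c::real_normed_vector"
    by (auto simp: bounded_iff)
  show ?thesis
  proof
    show "\<exists>K. K-lipschitz_on UNIV (\<lambda>z. - g z)" "\<exists>K. K-lipschitz_on UNIV (\<lambda>z. - h z)"
      using lipschitz_g lipschitz_h neg by blast+
    show "bounded (range (\<lambda>z. - g z))" "bounded (range (\<lambda>z. - h z))"
      using bounded_g bounded_h bdd by blast+
    show "norm (Lc (- g z - - g w)) \<le> e * sqrt (rev.q (z - w))"
      "norm (L (Ps (- h z - - h w))) \<le> e * sqrt (rev.q (z - w))"
      "norm (L (Pu (- h z - - h w))) \<le> e * sqrt (rev.q (z - w))" for z w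
      using g_small[of z w] hs_small[of z w] hu_small[of z w]
      by (simp_all add: q linear_simps norm_minus_commute)
  qed (use e_pos e_le in auto)
qed

text \<open>Facts prefixed with \<open>rev\<close> are the stable counterparts:
  \<open>rev.Hu\<close> is the stable coordinate, \<open>rev.rel\<close> means lying on one stable
  leaf, and \<open>rev.Tu\<close> slides along stable leaves to where \<open>rev.Hu\<close>
  vanishes.\<close>

interpretation rev: palmer_system "\<lambda>y. - A y" "\<lambda>x. - B x" Ps Pu Lc L a "\<lambda>z. - g z" "\<lambda>z. - h z" e
  by (rule reverse)

lemma rev_q: "rev.qu z = qs z" "rev.qs z = qu z" "rev.q z = q z"
  by (simp_all add: rev.q_def rev.qc_def rev.qu_def rev.qs_def q_def qc_def qu_def qs_def)

lemma rev_S: "rev.S t z = S (- t) z"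
proof -
  have "rev.F = (\<lambda>z. - F z)" by (rule ext) (simp add: rev.F_def F_def)
  then show ?thesis by (simp add: fl.flow_reverse)
qed

lemma Hs_flow: "rev.Hu (S t z) = flow A t (rev.Hu z)"
  using rev.Hu_flow[of "- t" z] by (simp add: rev_S li.flow_reverse)

text \<open>Backward in time, points of one unstable leaf approach each other, so their stable
  difference is bounded and the stable coordinates agree. Sliding along unstable leaves therefore
  does not disturb the stable coordinate.\<close>

lemma rel_Hs:
  assumes "rel p z"
  shows "rev.Hu p = rev.Hu z"
proof (rule rev.Hu_eq_if_bounded)
  fix t :: real assume t: "t \<ge> 0"
  have "qs (S (- t) p - S (- t) z) \<le> q (S (- t) p - S (- t) z)"
    by (simp add: q_def)
  also have "\<dots> \<le> 5 * exp (a * (- t)) * qu (p - z)"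
    using t by (intro rel_decay assms) simp
  also have "\<dots> \<le> 5 * 1 * qu (p - z)"
    using t a_pos by (intro mult_right_mono mult_left_mono) auto
  finally show "rev.qu (rev.S t p - rev.S t z) \<le> 5 * 1 * qu (p - z)"
    by (simp only: rev_q rev_S)
qed

lemma rev_rel_Hu:
  assumes "rev.rel p z"
  shows "Hu p = Hu z"
proof (rule Hu_eq_if_bounded)
  fix t :: real assume t: "t \<ge> 0"
  have "qu (S t p - S t z) \<le> q (S t p - S t z)"
    by (simp add: q_def)
  also have "\<dots> \<le> 5 * exp (a * (- t)) * qs (p - z)"
    using rev.rel_decay[OF assms, of "- t"] t by (simp add: rev_q rev_S)
  also have "\<dots> \<le> 5 * 1 * qs (p - z)"
    using t a_pos by (intro mult_right_mono mult_left_mono) auto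
  finally show "qu (S t p - S t z) \<le> 5 * 1 * qs (p - z)" .
qed

text \<open>\<open>Y z\<close> is the initial value of the only solution of the linear equation that stays at bounded
  distance from the second component of the orbit of \<open>z\<close> for all times.\<close>

definition Y :: "'x \<times> 'y \<Rightarrow> 'y" where "Y z = Hu z + rev.Hu z"

lemma Pu_Y: "Pu (Y z) = Hu z" and Ps_Y: "Ps (Y z) = rev.Hu z"
proof -
  show "Pu (Y z) = Hu z"
    unfolding Y_def linear_add[OF linear_Pu] rev.Ps_Hu by simp
  show "Ps (Y z) = rev.Hu z"
    unfolding Y_def linear_add[OF linear_Ps] rev.Pu_Hu by simp
qed

lemma Y_eq_iff: "Y z = Y w \<longleftrightarrow> Hu z = Hu w \<and> rev.Hu z = rev.Hu w"
  by (metis Y_def Pu_Y Ps_Y)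

lemma Y_eq_0_iff: "Y z = 0 \<longleftrightarrow> Hu z = 0 \<and> rev.Hu z = 0"
  by (metis Y_def Pu_Y Ps_Y add_0 linear_0[OF linear_Pu] linear_0[OF linear_Ps])

lemma Y_flow: "Y (S t z) = flow A t (Y z)"
  by (simp add: Y_def Hu_flow Hs_flow linear_add[OF li.linear_flow])

lemma continuous_on_Y: "continuous_on UNIV Y"
  unfolding Y_def by (intro continuous_on_add continuous_on_Hu rev.continuous_on_Hu)

lemma Y_near:
  obtains R where "\<And>z. norm (Y z - snd z) \<le> R"
proof -
  obtain c where c: "c > 0" "\<And>y. norm y \<le> c * norm (L y)" by (rule norm_le_L) blast
  have "norm (Y z - snd z) \<le> c * (M / a + rev.M / a)" for z
  proof -
    have "L (Y z - snd z) = (L (Hu z) - L (Pu (snd z))) + (L (rev.Hu z) - L (Ps (snd z)))"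
    proof -
      have "L (snd z) = L (Pu (snd z)) + L (Ps (snd z))"
        by (simp add: Pu_plus_Ps flip: linear_add[OF linear_L])
      then show ?thesis by (simp add: Y_def linear_add[OF linear_L] linear_diff[OF linear_L])
    qed
    then have "norm (L (Y z - snd z)) \<le> M / a + rev.M / a"
      using norm_triangle_ineq[of "L (Hu z) - L (Pu (snd z))" "L (rev.Hu z) - L (Ps (snd z))"]
        Hu_near[of z] rev.Hu_near[of z] by simp
    then show ?thesis
      using order_trans[OF c(2)[of "Y z - snd z"] mult_left_mono[of _ _ c]] c(1) by simp
  qed
  then show ?thesis by (rule that)
qed

section \<open>The centre manifold as a Lipschitz graph\<close>

lemma center_lipschitz:
  obtains K where "K \<ge> 0" "\<And>z w. Y z = 0 \<Longrightarrow> Y w = 0 \<Longrightarrow> norm (z - w) \<le> K * norm (fst z - fst w)"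
proof -
  obtain C where C: "C > 0" "\<And>z. (norm z)\<^sup>2 \<le> C * q z" by (rule norm_le_q) blast
  obtain D where D: "D > 0" "\<And>x. norm (Lc x) \<le> D * norm x" using linear_norm_le[OF linear_Lc] by blast
  have "norm (z - w) \<le> sqrt (C * 2) * D * norm (fst z - fst w)" if "Y z = 0" "Y w = 0" for z w
  proof -
    have "Hu z = Hu w" "rev.Hu z = rev.Hu w"
      using that by (simp_all add: Y_eq_0_iff)
    then have "V (z - w) \<le> 0" "rev.V (z - w) \<le> 0"
      by (simp_all only: V_nonpos_if_Hu_eq rev.V_nonpos_if_Hu_eq)
    \<comment> \<open>Adding qu \<le> (qc + qs)/4 and qs \<le> (qc + qu)/4 gives qu + qs \<le> 2
      qc/3. Cones of aperture 1 would give nothing here.\<close>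
    then have "q (z - w) \<le> 2 * qc (z - w)"
      unfolding V_def rev.V_def rev_q q_def add_divide_distrib
      using q_nonneg(1-3)[of "z - w"] by linarith
    then have "(norm (z - w))\<^sup>2 \<le> C * (2 * qc (z - w))"
      using C(2)[of "z - w"] mult_left_mono[of "q (z - w)" "2 * qc (z - w)" C] C(1) by linarith
    also have "\<dots> = C * 2 * (norm (Lc (fst z - fst w)))\<^sup>2" by (simp add: qc_def)
    also have "\<dots> \<le> C * 2 * (D * norm (fst z - fst w))\<^sup>2"
      using C(1) D(2) by (intro mult_left_mono power_mono) auto
    also have "\<dots> = (sqrt (C * 2) * D * norm (fst z - fst w))\<^sup>2"
      using C(1) by (simp add: power_mult_distrib)
    finally show ?thesis
      by (rule power2_le_imp_le) (use C(1) D(1) in simp)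
  qed
  then show ?thesis using C(1) D(1) by (intro that[of "sqrt (C * 2) * D"]) auto
qed

lemma center_eq: "Y z = 0 \<Longrightarrow> Y w = 0 \<Longrightarrow> fst z = fst w \<Longrightarrow> z = w"
proof -
  assume *: "Y z = 0" "Y w = 0" "fst z = fst w"
  obtain K where "\<And>z w. Y z = 0 \<Longrightarrow> Y w = 0 \<Longrightarrow> norm (z - w) \<le> K * norm (fst z - fst w)"
    by (rule center_lipschitz) blast
  from this[OF *(1,2)] *(3) show "z = w" by simp
qed

lemma center_exists: "\<exists>y. Y (x, y) = 0"
proof -
  obtain R where R: "\<And>z. norm (Y z - snd z) \<le> R" by (rule Y_near) blast
  show ?thesis
  proof (rule bounded_perturbation_of_identity_surj)
    show "continuous_on UNIV (\<lambda>y. Y (x, y))"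
      by (rule continuous_on_compose2[OF continuous_on_Y]) (auto intro!: continuous_intros)
    show "norm (Y (x, y) - y) \<le> R" for y using R[of "(x, y)"] by simp
  qed
qed

definition v :: "'x \<Rightarrow> 'y" where "v x = (SOME y. Y (x, y) = 0)"

lemma Y_v [simp]: "Y (x, v x) = 0"
  unfolding v_def by (rule someI_ex) (rule center_exists)

lemma Y_eq_0_iff_v: "Y z = 0 \<longleftrightarrow> z = (fst z, v (fst z))"
  using center_eq[of z "(fst z, v (fst z))"] by (metis Y_v fst_conv)

lemma v_lipschitz: "\<exists>K. K-lipschitz_on UNIV (\<lambda>x. (x, v x))"
proof -
  obtain K where "K \<ge> 0" "\<And>z w. Y z = 0 \<Longrightarrow> Y w = 0 \<Longrightarrow> norm (z - w) \<le> K * norm (fst z - fst w)"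
    by (rule center_lipschitz) blast
  from this(2)[OF Y_v Y_v] this(1) have "K-lipschitz_on UNIV (\<lambda>x. (x, v x))"
    by (intro lipschitz_onI) (simp_all add: dist_norm)
  then show ?thesis by blast
qed

lemma continuous_on_v: "continuous_on UNIV v"
proof -
  have "continuous_on UNIV (\<lambda>x. (x, v x))"
    using v_lipschitz lipschitz_on_continuous_on by blast
  then have "continuous_on UNIV (\<lambda>x. snd (x, v x))" by (rule continuous_on_snd)
  then show ?thesis by simp
qed

lemma bounded_v: "bounded (range v)"
proof -
  obtain R where R: "\<And>z. norm (Y z - snd z) \<le> R" by (rule Y_near) blast
  have "norm (v x) \<le> R" for x using R[of "(x, v x)"] by simp
  then show ?thesis unfolding bounded_iff by blast
qed

text \<open>The composite of the two foliation projections sends a point to the centre manifold.\<close>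

definition Z :: "'x \<times> 'y \<Rightarrow> 'x \<times> 'y" where "Z z = rev.Tu (Tu z)"

text \<open>\<open>Tu\<close> makes the unstable coordinate zero; the subsequent slide along a
  stable leaf preserves this and kills the stable coordinate.\<close>

lemma Y_Z: "Y (Z z) = 0"
  using rev_rel_Hu[OF rev.rel_Tu[of "Tu z"]] by (simp add: Y_eq_0_iff Z_def rev.Hu_Tu Hu_Tu)

lemma Z_flow: "Z (S t z) = S t (Z z)"
proof -
  have "rev.Tu (S t w) = S t (rev.Tu w)" for w
    using rev.Tu_flow[of "- t" w] by (simp add: rev_S)
  then show ?thesis by (simp add: Z_def Tu_flow)
qed

section \<open>The conjugating homeomorphism\<close>

definition H :: "'x \<times> 'y \<Rightarrow> 'x \<times> 'y" where "H z = (fst (Z z), Y z)"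

lemma continuous_on_H: "continuous_on UNIV H"
  unfolding H_def Z_def
  by (intro continuous_on_Pair continuous_on_fst continuous_on_Y
      continuous_on_compose2[OF rev.continuous_on_Tu continuous_on_Tu]) simp

text \<open>The slides are undone in reverse order: \<open>Z z\<close> and the stable coordinate
  determine \<open>Tu z\<close> on its stable leaf, then the unstable coordinate determines z on its
  unstable leaf.\<close>

lemma inj_H: "inj H"
proof (rule injI)
  fix z w assume "H z = H w"
  then have eq: "fst (Z z) = fst (Z w)" "Hu z = Hu w" "rev.Hu z = rev.Hu w"
    by (auto simp: H_def Y_eq_iff)
  have "Z z = Z w" by (rule center_eq[OF Y_Z Y_Z eq(1)])
  then have "rev.rel (Tu z) (Z z)" "rev.rel (Tu w) (Z z)"
    by (auto simp: Z_def rev.rel_Tu intro: rev.rel_sym) (metis rev.rel_Tu rev.rel_sym)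
  moreover have "rev.Hu (Tu z) = rev.Hu (Tu w)"
    using rel_Hs[OF rel_Tu[of z]] rel_Hs[OF rel_Tu[of w]] eq(3) by simp
  ultimately have "Tu z = Tu w" by (rule rev.rel_unique)
  then show "z = w"
    using rel_unique[of z "Tu z" w] rel_sym[OF rel_Tu] eq(2) by metis
qed

lemma surj_H: "surj H"
  unfolding surj_def
proof
  fix zeta :: "'x \<times> 'y"
  define c where "c = (fst zeta, v (fst zeta))"
  have "Y c = 0" by (simp add: c_def)
  then have c: "Hu c = 0" "rev.Hu c = 0" by (simp_all only: Y_eq_0_iff)
  \<comment> \<open>From the centre manifold a stable leaf leads to the wanted stable coordinate;
    the unstable leaf taken next preserves it.\<close>
  obtain p where p: "rev.rel p c" "rev.Hu p = Ps (snd zeta)"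
    using rev.rel_exists[of "Ps (snd zeta)" c] by auto
  obtain z where z: "rel z p" "Hu z = Pu (snd zeta)"
    using rel_exists[of "Pu (snd zeta)" p] by auto
  have "p = Tu z"
    using rel_sym[OF z(1)] rev_rel_Hu[OF p(1)] c(1) by (intro Tu_eqI) auto
  moreover have "c = rev.Tu p"
    by (rule rev.Tu_eqI[OF rev.rel_sym[OF p(1)] c(2)])
  ultimately have "Z z = c" by (simp add: Z_def)
  moreover have "Y z = snd zeta"
    using rel_Hs[OF z(1)] z(2) p(2) Pu_plus_Ps[of "snd zeta"] by (simp add: Y_def)
  ultimately have "zeta = H z" by (simp add: H_def c_def)
  then show "\<exists>z. zeta = H z" ..
qed

lemma homeomorphism_H: "\<exists>H'. homeomorphism UNIV UNIV H H'"
  using invariance_of_domain_homeomorphism[OF open_UNIV continuous_on_H order_refl] inj_H surj_H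
  by metis

definition gc :: "'x \<Rightarrow> 'x" where "gc x = g (x, v x)"

lemma bounded_gc: "bounded (range gc)"
  using bounded_g by (rule bounded_subset) (auto simp: gc_def)

lemma lipschitz_gc: "\<exists>K. K-lipschitz_on UNIV gc"
proof -
  obtain K where K: "K-lipschitz_on UNIV (\<lambda>x. (x, v x))" using v_lipschitz by blast
  obtain K' where K': "K'-lipschitz_on UNIV g" using lipschitz_g by blast
  have "(K' * K)-lipschitz_on UNIV (\<lambda>x. g (x, v x))"
    by (rule lipschitz_on_compose2[OF K]) (rule lipschitz_on_subset[OF K'], simp)
  then show ?thesis by (auto simp: gc_def[abs_def])
qed

lemma H_flow: "H (S t z) = flow (\<lambda>z. (B (fst z) + gc (fst z), A (snd z))) t (H z)"
proof -
  let ?T = "\<lambda>z. (B (fst z) + gc (fst z), A (snd z))"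
  obtain K where K: "K-lipschitz_on UNIV gc" using lipschitz_gc by blast
  have "1-lipschitz_on UNIV (fst :: 'x \<times> 'y \<Rightarrow> 'x)"
    by (rule lipschitz_onI) (auto simp: dist_fst_le)
  then have "(K * 1)-lipschitz_on UNIV (\<lambda>z :: 'x \<times> 'y. gc (fst z))"
    by (rule lipschitz_on_compose2) (rule lipschitz_on_subset[OF K], simp)
  moreover have "0-lipschitz_on UNIV (\<lambda>z :: 'x \<times> 'y. 0 :: 'y)"
    by (rule lipschitz_onI) auto
  ultimately obtain KT where KT: "KT-lipschitz_on UNIV ?T"
    using lipschitz_coupled_field[OF linear_A linear_B, of "\<lambda>z. gc (fst z)" "\<lambda>z. 0"] by auto
  interpret target: lipschitz_field ?T KT
    by unfold_locales (rule KT)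
  have "((\<lambda>t. H (S t z)) has_vector_derivative ?T (H (S t z))) (at t)" for t
  proof -
    \<comment> \<open>The orbit of \<open>Z z\<close> remains in the graph of \<open>v\<close>,
      where the perturbation depends on the centre variable only; this is the origin of the reduced
      nonlinearity \<open>gc\<close>.\<close>
    have "g (S t (Z z)) = gc (fst (S t (Z z)))"
      using Y_Z[of z] Y_flow[of t "Z z"] Y_eq_0_iff_v[of "S t (Z z)"]
      by (simp add: gc_def linear_0[OF li.linear_flow])
    then have "((\<lambda>t. (fst (S t (Z z)), flow A t (Y z))) has_vector_derivative
        ?T (fst (S t (Z z)), flow A t (Y z))) (at t)"
      using has_vector_derivative_Pair[OF fst_flow_deriv[of "Z z" t] li.flow_deriv[of "Y z" t]] by simp
    then show ?thesis by (simp add: H_def Z_flow Y_flow)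
  qed
  from target.flow_eqI[OF this, of t] show ?thesis by simp
qed

lemma center_manifold_graph: "{z. Y z = 0} = range (\<lambda>x. (x, v x))"
  using Y_eq_0_iff_v by (auto simp: image_iff)

text \<open>Over the same x, the orbits of (x, w x) and (x, v x) keep bounded hyperbolic distance in
  both directions of time, because both graphs are invariant and bounded. Hence both hyperbolic
  coordinates agree and vanish on the competing graph.\<close>

lemma center_manifold_unique:
  assumes bdd: "bounded (range w)" and inv: "\<And>t. S t ` range (\<lambda>x. (x, w x)) \<subseteq> range (\<lambda>x. (x, w x))"
  shows "range (\<lambda>x. (x, w x)) = {z. Y z = 0}"
proof -
  obtain R where R: "\<And>x. norm (w x) \<le> R" using bdd unfolding bounded_iff by auto
  obtain R' where R': "\<And>x. norm (v x) \<le> R'" using bounded_v unfolding bounded_iff by auto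
  obtain C where C: "C > 0" "\<And>y. norm (L (Pu y)) \<le> C * norm y"
    using linear_norm_le[OF linear_compose[OF linear_Pu linear_L]] by (auto simp: o_def)
  obtain C' where C': "C' > 0" "\<And>y. norm (L (Ps y)) \<le> C' * norm y"
    using linear_norm_le[OF linear_compose[OF linear_Ps linear_L]] by (auto simp: o_def)
  have dist: "norm (snd (S t (x, w x) - S t (x, v x))) \<le> R + R'" for t x
  proof -
    have "S t (x, w x) \<in> range (\<lambda>x. (x, w x))" using inv[of t] by blast
    then have "norm (snd (S t (x, w x))) \<le> R" using R by auto
    moreover have "Y (S t (x, v x)) = 0"
      by (simp add: Y_flow linear_0[OF li.linear_flow])
    then have "S t (x, v x) = (fst (S t (x, v x)), v (fst (S t (x, v x))))"
      by (simp only: Y_eq_0_iff_v[symmetric])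
    then have "norm (snd (S t (x, v x))) \<le> R'" using R' by (metis snd_conv)
    ultimately show ?thesis
      using norm_triangle_ineq4[of "snd (S t (x, w x))" "snd (S t (x, v x))"] by simp
  qed
  have "Y (x, w x) = 0" for x
  proof -
    have "Hu (x, w x) = Hu (x, v x)"
    proof (rule Hu_eq_if_bounded)
      fix t
      have "norm (L (Pu (snd (S t (x, w x) - S t (x, v x))))) \<le> C * (R + R')"
        using order_trans[OF C(2) mult_left_mono[OF dist]] C(1) by simp
      then show "qu (S t (x, w x) - S t (x, v x)) \<le> (C * (R + R'))\<^sup>2"
        unfolding qu_def by (rule power_mono) simp
    qed
    moreover have "rev.Hu (x, w x) = rev.Hu (x, v x)"
    proof (rule rev.Hu_eq_if_bounded)
      fix t
      have "norm (L (Ps (snd (S (- t) (x, w x) - S (- t) (x, v x))))) \<le> C' * (R + R')"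
        using order_trans[OF C'(2) mult_left_mono[OF dist]] C'(1) by simp
      then show "rev.qu (rev.S t (x, w x) - rev.S t (x, v x)) \<le> (C' * (R + R'))\<^sup>2"
        unfolding rev_q rev_S qs_def by (rule power_mono) simp
    qed
    ultimately have "Y (x, w x) = Y (x, v x)" by (simp only: Y_eq_iff)
    then show ?thesis by simp
  qed
  then have "w x = v x" for x using Y_eq_0_iff_v[of "(x, w x)"] by simp
  then show ?thesis by (simp add: center_manifold_graph)
qed

end

section \<open>Jordan coordinates of a real matrix\<close>

lemma idx_enum_bij: "bij_betw (idx_enum :: nat \<Rightarrow> 'n::finite) {..<CARD('n)} UNIV"
proof -
  have "\<exists>e. bij_betw e {..<CARD('n)} (UNIV :: 'n set)"
    by (rule finite_same_card_bij) auto
  then show ?thesis unfolding idx_enum_def by (rule someI_ex)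
qed

definition idx_of :: "'n::finite \<Rightarrow> nat" where
  "idx_of = the_inv_into {..<CARD('n)} idx_enum"

lemma idx_of_less [simp]: "idx_of (r :: 'n::finite) < CARD('n)"
  using the_inv_into_into[of idx_enum "{..<CARD('n)}" r "{..<CARD('n)}"] idx_enum_bij[where 'n = 'n]
  by (auto simp: idx_of_def bij_betw_def)

lemma idx_enum_idx_of [simp]: "idx_enum (idx_of (r :: 'n::finite)) = r"
  using f_the_inv_into_f_bij_betw[OF idx_enum_bij[where 'n = 'n], of r] by (simp add: idx_of_def)

lemma idx_of_idx_enum [simp]: "i < CARD('n) \<Longrightarrow> idx_of (idx_enum i :: 'n::finite) = i"
  using the_inv_into_f_f[of idx_enum "{..<CARD('n)}" i] idx_enum_bij[where 'n = 'n]
  by (auto simp: idx_of_def bij_betw_def)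

lemma sum_UNIV_idx: "(\<Sum>r\<in>UNIV. f (r :: 'n::finite)) = (\<Sum>i<CARD('n). f (idx_enum i))"
  using sum.reindex_bij_betw[OF idx_enum_bij[where 'n = 'n], of f] by simp

lemma index_mult_mat_sum:
  assumes "X \<in> carrier_mat n m" "Y \<in> carrier_mat m k" "i < n" "j < k"
  shows "(X * Y) $$ (i, j) = (\<Sum>l<m. X $$ (i, l) * Y $$ (l, j))"
  using assms by (simp add: scalar_prod_def lessThan_atLeast0)

definition cvec :: "real^'n \<Rightarrow> complex^'n" where "cvec y = (\<chi> i. complex_of_real (y $ i))"

lemma cvec_nth [simp]: "cvec y $ i = complex_of_real (y $ i)"
  by (simp add: cvec_def)

lemma cvec_simps: "cvec (x + y) = cvec x + cvec y" "cvec (c *\<^sub>R y) = complex_of_real c *s cvec y"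
    "cvec (x - y) = cvec x - cvec y" "cvec 0 = 0"
  by (simp_all add: Finite_Cartesian_Product.vec_eq_iff)

lemma cvec_eq_0 [simp]: "cvec y = 0 \<longleftrightarrow> y = 0"
  by (simp add: Finite_Cartesian_Product.vec_eq_iff)

lemma cvec_matrix: "map_matrix complex_of_real A *v cvec y = cvec (A *v y)"
  by (simp add: Finite_Cartesian_Product.vec_eq_iff matrix_vector_mult_def)

locale jordan_coordinates =
  fixes M :: "real^'n^'n" and n :: nat and n_as :: "(nat \<times> complex) list" and P Q :: "complex mat"
  assumes n: "n = CARD('n)"
    and wit: "similar_mat_wit (cmat M) (jordan_matrix n_as) P Q"
begin

abbreviation J where "J \<equiv> jordan_matrix n_as"
abbreviation cM where "cM \<equiv> map_matrix complex_of_real M"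

lemma cmat_carrier: "cmat M \<in> carrier_mat n n"
  by (simp add: cmat_def n)

lemma carriers: "P \<in> carrier_mat n n" "Q \<in> carrier_mat n n" "J \<in> carrier_mat n n"
  and PQ: "P * Q = 1\<^sub>m n" and QP: "Q * P = 1\<^sub>m n" and PJQ: "cmat M = P * J * Q"
  using similar_mat_witD2[OF cmat_carrier wit] by blast+

lemma n_sum: "n = sum_list (map fst n_as)"
  using carrier_matD(1)[OF carriers(3)] by (simp only: jordan_matrix_dim)

lemma Q_cmat: "Q * cmat M = J * Q"
proof -
  have JQ: "J * Q \<in> carrier_mat n n" by (rule mult_carrier_mat[OF carriers(3,2)])
  have "Q * cmat M = Q * (P * (J * Q))"
    unfolding PJQ by (rule arg_cong[of _ _ "\<lambda>X. Q * X"]) (rule assoc_mult_mat[OF carriers(1,3,2)])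
  also have "\<dots> = (Q * P) * (J * Q)"
    by (rule assoc_mult_mat[OF carriers(2,1) JQ, symmetric])
  also have "\<dots> = J * Q" unfolding QP by (rule left_mult_one_mat[OF JQ])
  finally show ?thesis .
qed

text \<open>Rows of \<open>Q\<close> as coordinate functionals, dual to the columns
  \<open>p j\<close> of \<open>P\<close>, which are the generalized eigenvectors.\<close>

definition l :: "nat \<Rightarrow> complex^'n \<Rightarrow> complex" where
  "l i w = (\<Sum>k<n. Q $$ (i, k) * w $ idx_enum k)"

definition p :: "nat \<Rightarrow> complex^'n" where
  "p j = (\<chi> r. P $$ (idx_of r, j))"

lemma idx [simp]: "idx_of (r :: 'n) < n" "i < n \<Longrightarrow> idx_of (idx_enum i :: 'n) = i"
  by (simp_all add: n)

lemma l_add: "l i (v + w) = l i v + l i w"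
  and l_diff: "l i (v - w) = l i v - l i w"
  and l_smult: "l i (c *s w) = c * l i w"
  and l_0 [simp]: "l i 0 = 0"
  by (simp_all add: l_def algebra_simps sum.distrib sum_subtractf sum_distrib_left)

lemma l_sum: "l i (\<Sum>j\<in>I. f j) = (\<Sum>j\<in>I. l i (f j))"
  by (induction I rule: infinite_finite_induct) (auto simp: l_add)

lemma l_p: "i < n \<Longrightarrow> j < n \<Longrightarrow> l i (p j) = (if i = j then 1 else 0)"
  using index_mult_mat_sum[OF carriers(2,1), of i j] by (simp add: QP l_def p_def)

lemma expansion: "(\<Sum>j<n. l j w *s p j) = w"
proof -
  have "(\<Sum>j<n. l j w *s p j) $ r = w $ r" for r
  proof -
    have "(\<Sum>j<n. l j w *s p j) $ r = (\<Sum>j<n. \<Sum>k<n. P $$ (idx_of r, j) * Q $$ (j, k) * w $ idx_enum k)"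
      by (simp add: l_def p_def sum_distrib_left sum_distrib_right mult_ac)
    also have "\<dots> = (\<Sum>k<n. (\<Sum>j<n. P $$ (idx_of r, j) * Q $$ (j, k)) * w $ idx_enum k)"
      by (subst sum.swap) (simp add: sum_distrib_right)
    also have "\<dots> = (\<Sum>k<n. (P * Q) $$ (idx_of r, k) * w $ idx_enum k)"
      by (intro sum.cong refl) (simp add: index_mult_mat_sum[OF carriers(1,2)])
    also have "\<dots> = (\<Sum>k<n. if idx_of r = k then w $ idx_enum k else 0)"
      unfolding PQ by (intro sum.cong refl) simp
    also have "\<dots> = w $ r" by simp
    finally show ?thesis .
  qed
  then show ?thesis by (simp add: Finite_Cartesian_Product.vec_eq_iff)
qed

lemma eq_if_l_eq:
  assumes "\<And>i. i < n \<Longrightarrow> l i v = l i w"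
  shows "v = w"
proof -
  have "v = (\<Sum>j<n. l j v *s p j)" by (rule expansion[symmetric])
  also have "\<dots> = (\<Sum>j<n. l j w *s p j)" by (intro sum.cong refl) (simp add: assms)
  also have "\<dots> = w" by (rule expansion)
  finally show ?thesis .
qed

lemma l_cM:
  assumes "i < n"
  shows "l i (cM *v w) = (\<Sum>j<n. J $$ (i, j) * l j w)"
proof -
  have "l i (cM *v w) = (\<Sum>k<n. \<Sum>m<n. Q $$ (i, k) * cmat M $$ (k, m) * w $ idx_enum m)"
    unfolding l_def matrix_vector_mult_def map_matrix_def
    by (simp add: sum_UNIV_idx cmat_def n sum_distrib_left mult.assoc)
  also have "\<dots> = (\<Sum>m<n. (\<Sum>k<n. Q $$ (i, k) * cmat M $$ (k, m)) * w $ idx_enum m)"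
    by (subst sum.swap) (simp add: sum_distrib_right)
  also have "\<dots> = (\<Sum>m<n. (Q * cmat M) $$ (i, m) * w $ idx_enum m)"
    using assms by (intro sum.cong refl) (simp add: index_mult_mat_sum[OF carriers(2) cmat_carrier])
  also have "\<dots> = (\<Sum>m<n. (\<Sum>j<n. J $$ (i, j) * Q $$ (j, m)) * w $ idx_enum m)"
    unfolding Q_cmat using assms
    by (intro sum.cong refl) (simp add: index_mult_mat_sum[OF carriers(3,2)] del: index_mult_mat)
  also have "\<dots> = (\<Sum>j<n. \<Sum>m<n. J $$ (i, j) * Q $$ (j, m) * w $ idx_enum m)"
    by (subst sum.swap) (simp add: sum_distrib_right)
  also have "\<dots> = (\<Sum>j<n. J $$ (i, j) * l j w)"
    by (simp add: l_def sum_distrib_left mult.assoc)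
  finally show ?thesis .
qed

end

fun jordan_diag :: "(nat \<times> 'a) list \<Rightarrow> 'a list" where
  "jordan_diag [] = []"
| "jordan_diag ((k, \<mu>) # n_as) = replicate k \<mu> @ jordan_diag n_as"

lemma length_jordan_diag [simp]: "length (jordan_diag n_as) = sum_list (map fst n_as)"
  by (induction n_as rule: jordan_diag.induct) auto

lemma set_jordan_diag: "set (jordan_diag n_as) \<subseteq> snd ` set n_as"
  by (induction n_as rule: jordan_diag.induct) auto

lemma jordan_diag_append: "jordan_diag (xs @ ys) = jordan_diag xs @ jordan_diag ys"
  by (induction xs rule: jordan_diag.induct) auto

text \<open>The last clause is the essential one: a superdiagonal 1 never crosses the border between
  two blocks, so the neighbouring diagonal entries coincide.\<close>

lemma jordan_matrix_index:
  assumes "i < sum_list (map fst n_as)" "j < sum_list (map fst n_as)"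
  shows "(i = j \<longrightarrow> jordan_matrix n_as $$ (i, j) = jordan_diag n_as ! i)
    \<and> (i \<noteq> j \<longrightarrow> j \<noteq> Suc i \<longrightarrow> jordan_matrix n_as $$ (i, j) = 0)
    \<and> (j = Suc i \<longrightarrow> jordan_matrix n_as $$ (i, j) = 0 \<or>
          jordan_matrix n_as $$ (i, j) = 1 \<and> jordan_diag n_as ! i = jordan_diag n_as ! j)"
  using assms
proof (induction n_as arbitrary: i j rule: jordan_diag.induct)
  case (2 k \<mu> n_as)
  let ?N = "sum_list (map fst n_as)"
  have idx: "jordan_matrix ((k, \<mu>) # n_as) $$ (i, j) =
      (if i < k then if j < k then jordan_block k \<mu> $$ (i, j) else 0
       else if j < k then 0 else jordan_matrix n_as $$ (i - k, j - k))"
    if "i < k + ?N" "j < k + ?N" for i j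
    unfolding jordan_matrix_Cons using that by (subst index_mat_four_block) auto
  have ij: "i < k + ?N" "j < k + ?N" using "2.prems" by auto
  note E = idx[OF ij]
  have nth: "jordan_diag ((k, \<mu>) # n_as) ! i = (if i < k then \<mu> else jordan_diag n_as ! (i - k))" for i
    by (simp add: nth_append)
  consider "i < k" "j < k" | "i < k" "\<not> j < k" | "\<not> i < k" "j < k" | "\<not> i < k" "\<not> j < k" by blast
  then show ?case
  proof cases
    case 1
    then show ?thesis unfolding E nth by simp
  next
    case 2
    then show ?thesis unfolding E nth by simp
  next
    case 3
    then show ?thesis unfolding E nth by simp
  next
    case 4
    then have "i - k < ?N" "j - k < ?N" "i - k = j - k \<longleftrightarrow> i = j" "j - k = Suc (i - k) \<longleftrightarrow> j = Suc i"
      using ij by auto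
    then show ?thesis
      using "2.IH"[of "i - k" "j - k"] 4 unfolding E nth by (simp only: if_False simp_thms True_implies_equals)
  qed
qed simp

definition cnjv :: "complex^'n \<Rightarrow> complex^'n" where "cnjv w = (\<chi> i. cnj (w $ i))"

lemma cnjv_simps: "cnjv (v + w) = cnjv v + cnjv w" "cnjv (v - w) = cnjv v - cnjv w"
    "cnjv (c *s w) = cnj c *s cnjv w" "cnjv 0 = 0" "cnjv (cvec y) = cvec y"
  by (simp_all add: cnjv_def Finite_Cartesian_Product.vec_eq_iff)

lemma cnjv_matrix: "cnjv (map_matrix complex_of_real M *v w) = map_matrix complex_of_real M *v cnjv w"
  by (simp add: cnjv_def Finite_Cartesian_Product.vec_eq_iff matrix_vector_mult_def)

lemma sum_shift_le:
  fixes f :: "nat \<Rightarrow> real"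
  assumes "\<And>i. f i \<ge> 0"
  shows "(\<Sum>i<n. if Suc i < n then f (Suc i) else 0) \<le> (\<Sum>i<n. f i)"
proof (cases n)
  case (Suc m)
  have "(\<Sum>i<Suc m. if Suc i < Suc m then f (Suc i) else 0) = (\<Sum>i<m. f (Suc i))"
    by simp
  also have "\<dots> \<le> (\<Sum>i<Suc m. f i)"
    using assms[of 0] unfolding sum.lessThan_Suc_shift by simp
  finally show ?thesis unfolding Suc .
qed simp

context jordan_coordinates
begin

definition mu :: "nat \<Rightarrow> complex" where "mu i = jordan_diag n_as ! i"

text \<open>The superdiagonal entry; its default 0 at the last index cancels
  \<open>l (Suc i)\<close>, whose row lies outside \<open>Q\<close>.\<close>

definition ka :: "nat \<Rightarrow> complex" where "ka i = (if Suc i < n then J $$ (i, Suc i) else 0)"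

lemma mu_in: "i < n \<Longrightarrow> mu i \<in> snd ` set n_as"
  using set_jordan_diag[of n_as] nth_mem[of i "jordan_diag n_as", unfolded length_jordan_diag, folded n_sum]
  by (auto simp: mu_def)

lemma ka_cases: "i < n \<Longrightarrow> ka i = 0 \<or> ka i = 1 \<and> Suc i < n \<and> mu (Suc i) = mu i"
  using jordan_matrix_index[of i n_as "Suc i", folded n_sum] by (auto simp: ka_def mu_def)

lemma l_matrix:
  assumes i: "i < n"
  shows "l i (cM *v w) = mu i * l i w + ka i * l (Suc i) w"
proof -
  have J: "J $$ (i, j) = (if j = i then mu i else if j = Suc i then ka i else 0)" if "j < n" for j
    using jordan_matrix_index[of i n_as j, folded n_sum] i that by (auto simp: ka_def mu_def)
  have "l i (cM *v w) = (\<Sum>j<n. (if j = i then mu i * l i w else 0) + (if j = Suc i then ka i * l (Suc i) w else 0))"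
    unfolding l_cM[OF i] by (intro sum.cong refl) (simp add: J)
  also have "\<dots> = mu i * l i w + (if Suc i < n then ka i * l (Suc i) w else 0)"
    unfolding sum.distrib using i by simp
  finally show ?thesis by (simp add: ka_def)
qed

section \<open>Spectral subspaces in Jordan coordinates\<close>

definition N :: "complex \<Rightarrow> complex^'n \<Rightarrow> complex^'n" where "N \<mu> v = cM *v v - \<mu> *s v"

lemma N_0 [simp]: "N \<mu> 0 = 0"
  by (simp add: N_def)

lemma N_pow_0 [simp]: "(N \<mu> ^^ k) 0 = 0"
  by (induction k) auto

lemma l_N: "i < n \<Longrightarrow> l i (N \<mu> w) = (mu i - \<mu>) * l i w + ka i * l (Suc i) w"
  by (simp add: N_def l_diff l_smult l_matrix algebra_simps)

lemma N_p:
  assumes "j < n"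
  shows "N (mu j) (p j) = (if j = 0 then 0 else ka (j - 1) *s p (j - 1))"
proof (rule eq_if_l_eq)
  fix i assume i: "i < n"
  have "ka i * l (Suc i) (p j) = (if Suc i = j then ka i else 0)"
    using assms by (cases "Suc i < n") (auto simp: l_p ka_def)
  then show "l i (N (mu j) (p j)) = l i (if j = 0 then 0 else ka (j - 1) *s p (j - 1))"
    using i assms by (auto simp: l_N l_p l_smult)
qed

text \<open>Each application moves one step down the chain, or gives zero at the start of a block.
  The exponent counts from the start of the whole basis, which is generous but uniform.\<close>

lemma N_pow_p: "j < n \<Longrightarrow> (N (mu j) ^^ Suc j) (p j) = 0"
proof (induction j)
  case 0
  then show ?case using N_p[of 0] by simp
next
  case (Suc j)
  have "(N (mu (Suc j)) ^^ Suc (Suc j)) (p (Suc j)) = (N (mu (Suc j)) ^^ Suc j) (N (mu (Suc j)) (p (Suc j)))"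
    by (simp only: funpow_Suc_right o_apply)
  also have "\<dots> = (N (mu (Suc j)) ^^ Suc j) (ka j *s p j)"
    using N_p[OF Suc.prems] by simp
  also have "\<dots> = 0"
  proof -
    have j: "j < n" using Suc.prems by simp
    from ka_cases[OF j] show ?thesis
    proof
      assume "ka j = 1 \<and> Suc j < n \<and> mu (Suc j) = mu j"
      then show ?thesis using Suc.IH[OF j] by (simp only: vec.scale_one)
    qed (simp del: funpow.simps)
  qed
  finally show ?case .
qed

definition generators :: "(complex \<Rightarrow> bool) \<Rightarrow> (complex^'n) set" where
  "generators R = {w. \<exists>\<mu> k. R \<mu> \<and> (N \<mu> ^^ k) w = 0}"

definition annihilated :: "(complex \<Rightarrow> bool) \<Rightarrow> (complex^'n) set" where
  "annihilated R = {w. \<forall>i<n. \<not> R (mu i) \<longrightarrow> l i w = 0}"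

lemma subspace_annihilated: "vec.subspace (annihilated R)"
  by (auto simp: vec.subspace_def annihilated_def l_add l_smult)

lemma generators_subset: "generators R \<subseteq> annihilated R"
proof
  fix w assume "w \<in> generators R"
  then obtain \<mu> k where \<mu>: "R \<mu>" "(N \<mu> ^^ k) w = 0" by (auto simp: generators_def)
  have step: "v \<in> annihilated R" if v: "N \<mu> v \<in> annihilated R" for v
  proof -
    \<comment> \<open>Downward induction, since \<open>l_N\<close> is upper triangular: coordinate i
      + 1 is either decoupled or belongs to the same eigenvalue and vanishes already. Then mu i
      differs from \<mu>, as only \<mu> satisfies R.\<close>
    have "\<not> R (mu i) \<longrightarrow> l i v = 0" if "i < n" for i
      using that
    proof (induction "n - i" arbitrary: i rule: less_induct)
      case less
      show ?case
      proof
        assume R: "\<not> R (mu i)"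
        have "n - Suc i < n - i" using less.prems by (rule diff_less_mono2[OF lessI])
        then have k0: "ka i * l (Suc i) v = 0"
          using ka_cases[OF less.prems] less.hyps[of "Suc i"] R by auto
        have N0: "l i (N \<mu> v) = 0" using v R less.prems by (simp add: annihilated_def)
        have "(mu i - \<mu>) * l i v = 0"
          using l_N[OF less.prems, of \<mu> v] unfolding k0 N0 by simp
        then show "l i v = 0" using R \<mu>(1) by auto
      qed
    qed
    then show ?thesis by (simp add: annihilated_def)
  qed
  show "w \<in> annihilated R"
    using \<mu>(2)
  proof (induction k arbitrary: w)
    case 0
    then show ?case by (simp add: annihilated_def)
  next
    case (Suc k)
    have "(N \<mu> ^^ k) (N \<mu> w) = 0"
      using Suc.prems by (simp only: funpow_Suc_right o_apply)
    then show ?case by (rule step[OF Suc.IH])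
  qed
qed

text \<open>Turns the span in the definition of a spectral subspace into the vanishing of the other
  Jordan coordinates, which zero level sets of eigenfunctions can express.\<close>

lemma span_generators: "vec.span (generators R) = annihilated R"
proof
  show "vec.span (generators R) \<subseteq> annihilated R"
    by (rule vec.span_minimal[OF generators_subset subspace_annihilated])
  show "annihilated R \<subseteq> vec.span (generators R)"
  proof
    fix w assume w: "w \<in> annihilated R"
    have "l j w *s p j \<in> vec.span (generators R)" if "j < n" for j
    proof (cases "R (mu j)")
      case True
      then have "p j \<in> generators R"
        using N_pow_p[OF that] unfolding generators_def by blast
      then show ?thesis by (intro vec.span_scale vec.span_base)
    next
      case False
      then show ?thesis using w that by (simp add: annihilated_def vec.span_zero)
    qed
    then have "(\<Sum>j<n. l j w *s p j) \<in> vec.span (generators R)"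
      by (intro vec.span_sum) simp
    then show "w \<in> vec.span (generators R)" by (simp add: expansion)
  qed
qed

lemma spectral_subspace_eq:
  "spectral_subspace M R = {y. \<forall>i<n. \<not> R (mu i) \<longrightarrow> l i (cvec y) = 0}"
  using span_generators[of R]
  by (auto simp: spectral_subspace_def generators_def annihilated_def N_def[abs_def] cvec_def)

text \<open>Since \<open>M\<close> is real, conjugation permutes the generalized eigenspaces; hence the spectral
  projection of a real vector is real.\<close>

lemma cnjv_annihilated:
  assumes R: "\<And>\<mu>. R (cnj \<mu>) = R \<mu>" and w: "w \<in> annihilated R"
  shows "cnjv w \<in> annihilated R"
proof -
  have "vec.subspace {w. cnjv w \<in> annihilated R}"
    using subspace_annihilated[of R] by (simp add: vec.subspace_def cnjv_simps)
  moreover have "generators R \<subseteq> {w. cnjv w \<in> annihilated R}"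
  proof
    fix w assume "w \<in> generators R"
    then obtain \<mu> k where \<mu>: "R \<mu>" "(N \<mu> ^^ k) w = 0" by (auto simp: generators_def)
    have "(N (cnj \<mu>) ^^ k) (cnjv w) = cnjv ((N \<mu> ^^ k) w)"
      by (induction k) (simp_all add: N_def cnjv_simps cnjv_matrix)
    then have "(N (cnj \<mu>) ^^ k) (cnjv w) = 0" by (simp add: \<mu>(2) cnjv_simps)
    then have "cnjv w \<in> generators R" using \<mu>(1) R by (auto simp: generators_def)
    then show "w \<in> {w. cnjv w \<in> annihilated R}" using generators_subset by auto
  qed
  ultimately have "vec.span (generators R) \<subseteq> {w. cnjv w \<in> annihilated R}"
    by (intro vec.span_minimal)
  then show ?thesis using w by (auto simp: span_generators)
qed

text \<open>For a conjugation-invariant R the real part loses nothing: the complex projection of a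
  real vector is then real, as \<open>l_proj\<close> shows.\<close>

definition proj :: "(complex \<Rightarrow> bool) \<Rightarrow> real^'n \<Rightarrow> real^'n" where
  "proj R y = (\<chi> r. Re ((\<Sum>j\<in>{j. j < n \<and> R (mu j)}. l j (cvec y) *s p j) $ r))"

lemma l_proj:
  assumes R: "\<And>\<mu>. R (cnj \<mu>) = R \<mu>" and i: "i < n"
  shows "l i (cvec (proj R y)) = (if R (mu i) then l i (cvec y) else 0)"
proof -
  define w where "w = (\<Sum>j\<in>{j. j < n \<and> R (mu j)}. l j (cvec y) *s p j)"
  have lw: "l i w = (if R (mu i) then l i (cvec y) else 0)" if "i < n" for i
  proof -
    have "l i w = (\<Sum>j\<in>{j. j < n \<and> R (mu j)}. if j = i then l i (cvec y) else 0)"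
      unfolding w_def l_sum using that by (intro sum.cong) (auto simp: l_smult l_p)
    also have "\<dots> = (if R (mu i) then l i (cvec y) else 0)"
      using that by (subst sum.delta) auto
    finally show ?thesis .
  qed
  have w: "w \<in> annihilated R" "cvec y - w \<in> annihilated (\<lambda>\<mu>. \<not> R \<mu>)"
    by (simp_all add: annihilated_def lw l_diff)
  have 1: "cnjv w - w \<in> annihilated R"
    by (intro vec.subspace_diff subspace_annihilated cnjv_annihilated R w)
  have "(cvec y - w) - cnjv (cvec y - w) \<in> annihilated (\<lambda>\<mu>. \<not> R \<mu>)"
    by (intro vec.subspace_diff subspace_annihilated cnjv_annihilated w) (simp add: R)
  then have 2: "cnjv w - w \<in> annihilated (\<lambda>\<mu>. \<not> R \<mu>)" by (simp add: cnjv_simps)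
  \<comment> \<open>The difference lies in two complementary spectral subspaces, so all of its
    coordinates vanish.\<close>
  have "cnjv w - w = 0"
    by (rule eq_if_l_eq) (use 1 2 in \<open>auto simp: annihilated_def\<close>)
  then have "cnj (w $ r) = w $ r" for r
    by (simp add: cnjv_def Finite_Cartesian_Product.vec_eq_iff)
  then have "complex_of_real (Re (w $ r)) = w $ r" for r
    by (metis Reals_cnj_iff of_real_Re)
  then have "cvec (proj R y) = w"
    by (simp add: proj_def Finite_Cartesian_Product.vec_eq_iff w_def)
  then show ?thesis using lw[OF i] by simp
qed

lemma eq_if_l_cvec_eq: "(\<And>i. i < n \<Longrightarrow> l i (cvec x) = l i (cvec y)) \<Longrightarrow> x = y"
proof -
  assume "\<And>i. i < n \<Longrightarrow> l i (cvec x) = l i (cvec y)"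
  then have "cvec x = cvec y" by (rule eq_if_l_eq)
  then have "cvec (x - y) = 0" by (simp add: cvec_simps)
  then show "x = y" by simp
qed

lemma l_cvec_matrix: "i < n \<Longrightarrow> l i (cvec (M *v y)) = mu i * l i (cvec y) + ka i * l (Suc i) (cvec y)"
  using l_matrix[of i "cvec y"] by (simp add: cvec_matrix)

context
  fixes R :: "complex \<Rightarrow> bool"
  assumes R: "\<And>\<mu>. R (cnj \<mu>) = R \<mu>"
begin

lemma l_proj_compl:
  "i < n \<Longrightarrow> l i (cvec (proj R y)) = (if R (mu i) then l i (cvec y) else 0)"
  "i < n \<Longrightarrow> l i (cvec (proj (\<lambda>\<mu>. \<not> R \<mu>) y)) = (if R (mu i) then 0 else l i (cvec y))"
  using l_proj[of R i y] l_proj[of "\<lambda>\<mu>. \<not> R \<mu>" i y] by (auto simp: R)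

lemma linear_proj: "linear (proj R)"
proof
  show "proj R (x + y) = proj R x + proj R y" for x y
    by (rule eq_if_l_cvec_eq) (simp add: l_proj_compl cvec_simps l_add)
  show "proj R (c *\<^sub>R y) = c *\<^sub>R proj R y" for c y
    by (rule eq_if_l_cvec_eq) (simp add: l_proj_compl cvec_simps l_smult)
qed

lemma proj_matrix: "proj R (M *v y) = M *v proj R y"
proof (rule eq_if_l_cvec_eq)
  fix i assume i: "i < n"
  then show "l i (cvec (proj R (M *v y))) = l i (cvec (M *v proj R y))"
    using ka_cases[OF i] by (auto simp: l_cvec_matrix l_proj_compl)
qed

lemma proj_compl: "proj R y + proj (\<lambda>\<mu>. \<not> R \<mu>) y = y"
  by (rule eq_if_l_cvec_eq) (simp add: l_proj_compl cvec_simps l_add)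

lemma proj_proj_compl: "proj R (proj (\<lambda>\<mu>. \<not> R \<mu>) y) = 0" "proj (\<lambda>\<mu>. \<not> R \<mu>) (proj R y) = 0"
  by (rule eq_if_l_cvec_eq, simp add: l_proj_compl cvec_simps)+

end

section \<open>Adapted norms by rescaling\<close>

definition chi :: "real \<Rightarrow> nat \<Rightarrow> real^'n \<Rightarrow> complex" where
  "chi d i y = complex_of_real (1 / d ^ i) * l i (cvec y)"

text \<open>Rescaling the Jordan coordinates shrinks the off-diagonal entries from \<open>1\<close> to \<open>d\<close>.\<close>

definition Lr :: "real \<Rightarrow> real^'n \<Rightarrow> complex^'n" where
  "Lr d y = (\<chi> r. chi d (idx_of r) y)"

lemma linear_Lr: "linear (Lr d)"
  by unfold_locales
    (simp_all add: Lr_def chi_def Finite_Cartesian_Product.vec_eq_iff cvec_simps l_add l_smult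
      distrib_left scaleR_conv_of_real[where 'a = complex] mult_ac)

lemma inner_Lr: "inner (Lr d x) (Lr d y) = (\<Sum>i<n. inner (chi d i x) (chi d i y))"
  unfolding inner_vec_def sum_UNIV_idx n[symmetric] by (simp add: Lr_def)

lemma norm_Lr: "(norm (Lr d y))\<^sup>2 = (\<Sum>i<n. (norm (chi d i y))\<^sup>2)"
  by (simp add: power2_norm_eq_inner inner_Lr)

context
  fixes d :: real
  assumes d: "d > 0"
begin

lemma inj_Lr: "inj (Lr d)"
proof (rule injI)
  fix x y assume "Lr d x = Lr d y"
  then have eq: "Lr d x $ idx_enum i = Lr d y $ idx_enum i" for i by simp
  show "x = y"
  proof (rule eq_if_l_cvec_eq)
    fix i assume "i < n"
    then show "l i (cvec x) = l i (cvec y)"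
      using eq[of i] d by (simp add: Lr_def chi_def)
  qed
qed

lemma chi_matrix:
  assumes "i < n"
  shows "chi d i (M *v y) = mu i * chi d i y + d *\<^sub>R (ka i * chi d (Suc i) y)"
  using d by (simp add: chi_def l_cvec_matrix[OF assms] scaleR_conv_of_real field_simps)

text \<open>The diagonal part gives the sum exactly. Each off-diagonal product is at most d/2 times
  a sum of two squares, and every coordinate occurs in at most two of them, which adds up to d times
  the squared norm.\<close>

lemma inner_Lr_matrix:
  "\<bar>inner (Lr d (M *v y)) (Lr d y) - (\<Sum>i<n. Re (mu i) * (norm (chi d i y))\<^sup>2)\<bar> \<le> d * (norm (Lr d y))\<^sup>2"
proof -
  let ?f = "\<lambda>i. (norm (chi d i y))\<^sup>2"
  let ?e = "\<lambda>i. inner (d *\<^sub>R (ka i * chi d (Suc i) y)) (chi d i y)"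
  have Re_inner: "inner (m * c) c = Re m * (norm c)\<^sup>2" for m c :: complex
    unfolding cmod_power2 inner_complex_def by (simp add: algebra_simps power2_eq_square)
  have "inner (Lr d (M *v y)) (Lr d y) = (\<Sum>i<n. Re (mu i) * ?f i + ?e i)"
    unfolding inner_Lr
    by (intro sum.cong refl) (simp add: chi_matrix inner_add_left Re_inner del: inner_scaleR_left)
  then have "inner (Lr d (M *v y)) (Lr d y) - (\<Sum>i<n. Re (mu i) * ?f i) = (\<Sum>i<n. ?e i)"
    by (simp add: sum.distrib)
  also have "\<bar>\<dots>\<bar> \<le> (\<Sum>i<n. d / 2 * ((if Suc i < n then ?f (Suc i) else 0) + ?f i))"
  proof (rule order_trans[OF sum_abs sum_mono])
    fix i assume "i \<in> {..<n}"
    then have i: "i < n" by simp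
    have 2: "2 * (norm (chi d (Suc i) y) * norm (chi d i y)) \<le> ?f (Suc i) + ?f i"
      using sum_squares_bound[of "norm (chi d (Suc i) y)" "norm (chi d i y)"] by simp
    have "\<bar>inner (chi d (Suc i) y) (chi d i y)\<bar> \<le> (?f (Suc i) + ?f i) / 2"
      using Cauchy_Schwarz_ineq2[of "chi d (Suc i) y" "chi d i y"] 2
      unfolding add_divide_distrib by linarith
    then have "d * \<bar>inner (chi d (Suc i) y) (chi d i y)\<bar> \<le> d * ((?f (Suc i) + ?f i) / 2)"
      using d by (intro mult_left_mono) auto
    then show "\<bar>?e i\<bar> \<le> d / 2 * ((if Suc i < n then ?f (Suc i) else 0) + ?f i)"
      using ka_cases[OF i] d by (auto simp: abs_mult)
  qed
  also have "\<dots> = d / 2 * ((\<Sum>i<n. if Suc i < n then ?f (Suc i) else 0) + (\<Sum>i<n. ?f i))"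
    by (simp only: sum_distrib_left[symmetric] sum.distrib)
  also have "\<dots> \<le> d / 2 * ((\<Sum>i<n. ?f i) + (\<Sum>i<n. ?f i))"
    using d by (intro mult_left_mono add_right_mono sum_shift_le) auto
  also have "\<dots> = d * (norm (Lr d y))\<^sup>2" by (simp add: norm_Lr)
  finally show ?thesis .
qed

lemma inner_Lr_ge:
  assumes "\<And>i. i < n \<Longrightarrow> Re (mu i) \<ge> \<alpha> \<or> l i (cvec y) = 0"
  shows "(\<alpha> - d) * (norm (Lr d y))\<^sup>2 \<le> inner (Lr d (M *v y)) (Lr d y)"
proof -
  have "\<alpha> * (norm (Lr d y))\<^sup>2 \<le> (\<Sum>i<n. Re (mu i) * (norm (chi d i y))\<^sup>2)"
    unfolding norm_Lr sum_distrib_left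
  proof (rule sum_mono)
    fix i assume "i \<in> {..<n}"
    then show "\<alpha> * (norm (chi d i y))\<^sup>2 \<le> Re (mu i) * (norm (chi d i y))\<^sup>2"
      using assms[of i] mult_right_mono[OF _ zero_le_power2[of "norm (chi d i y)"]] by (auto simp: chi_def)
  qed
  then show ?thesis
    unfolding left_diff_distrib using abs_le_D2[OF inner_Lr_matrix[of y]] by linarith
qed

lemma inner_Lr_le:
  assumes "\<And>i. i < n \<Longrightarrow> Re (mu i) \<le> \<alpha> \<or> l i (cvec y) = 0"
  shows "inner (Lr d (M *v y)) (Lr d y) \<le> (\<alpha> + d) * (norm (Lr d y))\<^sup>2"
proof -
  have "(\<Sum>i<n. Re (mu i) * (norm (chi d i y))\<^sup>2) \<le> \<alpha> * (norm (Lr d y))\<^sup>2"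
    unfolding norm_Lr sum_distrib_left
  proof (rule sum_mono)
    fix i assume "i \<in> {..<n}"
    then show "Re (mu i) * (norm (chi d i y))\<^sup>2 \<le> \<alpha> * (norm (chi d i y))\<^sup>2"
      using assms[of i] mult_right_mono[OF _ zero_le_power2[of "norm (chi d i y)"]] by (auto simp: chi_def)
  qed
  then have "d * (norm (Lr d y))\<^sup>2 + (\<Sum>i<n. Re (mu i) * (norm (chi d i y))\<^sup>2)
      \<le> d * (norm (Lr d y))\<^sup>2 + \<alpha> * (norm (Lr d y))\<^sup>2"
    by (rule add_left_mono)
  with abs_le_D1[OF inner_Lr_matrix[of y]] show ?thesis
    unfolding diff_le_eq distrib_right add.commute[of "\<alpha> * _"] by (rule order_trans)
qed

end

end

section \<open>Ordering the Jordan blocks\<close>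

lemma jordan_matrix_append:
  "jordan_matrix (xs @ ys) = four_block_mat (jordan_matrix xs)
     (0\<^sub>m (sum_list (map fst xs)) (sum_list (map fst ys)))
     (0\<^sub>m (sum_list (map fst ys)) (sum_list (map fst xs))) (jordan_matrix ys)"
  using jordan_matrix_dim[of xs] jordan_matrix_dim[of ys]
  unfolding jordan_matrix_def map_append diag_block_mat_append by (simp add: Let_def)

lemma similar_mat_block_swap:
  fixes X Y :: "'a::comm_ring_1 mat"
  assumes X: "X \<in> carrier_mat n n" and Y: "Y \<in> carrier_mat m m"
  shows "similar_mat (four_block_mat X (0\<^sub>m n m) (0\<^sub>m m n) Y) (four_block_mat Y (0\<^sub>m m n) (0\<^sub>m n m) X)"
proof -
  let ?P = "four_block_mat (0\<^sub>m n m) (1\<^sub>m n) (1\<^sub>m m) (0\<^sub>m m n) :: 'a mat"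
  let ?Q = "four_block_mat (0\<^sub>m m n) (1\<^sub>m m) (1\<^sub>m n) (0\<^sub>m n m) :: 'a mat"
  let ?D = "four_block_mat X (0\<^sub>m n m) (0\<^sub>m m n) Y"
  let ?E = "four_block_mat Y (0\<^sub>m m n) (0\<^sub>m n m) X"
  note z = zero_carrier_mat and o = one_carrier_mat
  have PQ: "?P * ?Q = 1\<^sub>m (n + m)"
    by (subst mult_four_block_mat[OF z o o z z o o z]) (simp add: four_block_one_mat)
  have QP: "?Q * ?P = 1\<^sub>m (n + m)"
    by (subst mult_four_block_mat[OF z o o z z o o z]) (simp add: four_block_one_mat add.commute)
  have "?P * ?E = four_block_mat (0\<^sub>m n m) X Y (0\<^sub>m m n)"
    using X Y by (subst mult_four_block_mat[OF z o o z Y z z X]) simp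
  moreover have "four_block_mat (0\<^sub>m n m) X Y (0\<^sub>m m n) * ?Q = ?D"
    using X Y by (subst mult_four_block_mat[OF z X Y z z o o z]) simp
  ultimately have D: "?D = ?P * ?E * ?Q" by simp
  have "similar_mat_wit ?D ?E ?P ?Q"
    using four_block_carrier_mat[OF X Y] four_block_carrier_mat[OF Y X]
      four_block_carrier_mat[OF z[of n m] z[of m n]] four_block_carrier_mat[OF z[of m n] z[of n m]]
    by (intro similar_mat_witI[OF PQ QP D]) (simp_all only: add.commute[of m n])
  then show ?thesis unfolding similar_mat_def by blast
qed

lemma similar_mat_dim: "similar_mat X Y \<Longrightarrow> dim_row X = dim_row Y"
proof -
  assume "similar_mat X Y"
  from similar_matD[OF this] obtain n where "X \<in> carrier_mat n n" "Y \<in> carrier_mat n n" by blast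
  then show ?thesis by simp
qed

lemma similar_jordan_matrix_append:
  fixes xs ys :: "(nat \<times> 'a::comm_ring_1) list"
  assumes "similar_mat (jordan_matrix xs) (jordan_matrix xs')"
    and "similar_mat (jordan_matrix ys) (jordan_matrix ys')"
  shows "similar_mat (jordan_matrix (xs @ ys)) (jordan_matrix (xs' @ ys'))"
proof -
  have "sum_list (map fst xs) = sum_list (map fst xs')" "sum_list (map fst ys) = sum_list (map fst ys')"
    using similar_mat_dim[OF assms(1)] similar_mat_dim[OF assms(2)] by (simp_all only: jordan_matrix_dim)
  then show ?thesis
    using similar_mat_four_block_0_0[OF assms jordan_matrix_carrier jordan_matrix_carrier]
    by (simp only: jordan_matrix_append)
qed

lemma similar_jordan_matrix_refl: "similar_mat (jordan_matrix xs) (jordan_matrix (xs :: (nat \<times> 'a::comm_ring_1) list))"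
  by (rule similar_mat_refl[OF jordan_matrix_carrier])

lemma similar_jordan_matrix_swap:
  "similar_mat (jordan_matrix (xs @ ys)) (jordan_matrix (ys @ (xs :: (nat \<times> 'a::comm_ring_1) list)))"
  unfolding jordan_matrix_append
  by (rule similar_mat_block_swap[OF jordan_matrix_carrier jordan_matrix_carrier])

text \<open>Insertion sort: a head block that violates R is moved past the blocks satisfying R, and
  such a move is a similarity.\<close>

lemma similar_jordan_matrix_partition:
  "similar_mat (jordan_matrix n_as)
     (jordan_matrix (filter R n_as @ filter (\<lambda>x. \<not> R x) (n_as :: (nat \<times> 'a::comm_ring_1) list)))"
proof (induction n_as)
  case Nil
  show ?case by (simp add: similar_jordan_matrix_refl)
next
  case (Cons x xs)
  let ?f = "filter R xs" and ?g = "filter (\<lambda>x. \<not> R x) xs"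
  have 1: "similar_mat (jordan_matrix ([x] @ xs)) (jordan_matrix ([x] @ (?f @ ?g)))"
    by (intro similar_jordan_matrix_append similar_jordan_matrix_refl Cons.IH)
  show ?case
  proof (cases "R x")
    case True
    then show ?thesis using 1 by simp
  next
    case False
    have 2: "similar_mat (jordan_matrix (([x] @ ?f) @ ?g)) (jordan_matrix ((?f @ [x]) @ ?g))"
      by (intro similar_jordan_matrix_append similar_jordan_matrix_refl similar_jordan_matrix_swap)
    from similar_mat_trans[OF 1 2[unfolded append.assoc]] show ?thesis using False by simp
  qed
qed

lemma jordan_nf_partition:
  fixes n_as :: "(nat \<times> 'a::comm_ring_1) list"
  assumes "jordan_nf X n_as"
  shows "jordan_nf X (filter R n_as @ filter (\<lambda>x. \<not> R x) n_as)"
  using assms similar_mat_trans[OF _ similar_jordan_matrix_partition[of n_as R]]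
  unfolding jordan_nf_def by auto

lemma cmat_carrier: "cmat (M :: real^'n^'n) \<in> carrier_mat CARD('n) CARD('n)"
  by (simp add: cmat_def)

lemma jordan_nf_cmat_exists: "\<exists>n_as. jordan_nf (cmat (M :: real^'n^'n)) n_as"
  using char_poly_factorized[OF cmat_carrier] jordan_nf_exists[OF cmat_carrier] by metis

lemma jordan_nf_eigenvalue:
  fixes X :: "complex mat"
  assumes "jordan_nf X n_as" "X \<in> carrier_mat n n" "\<mu> \<in> snd ` set n_as"
  shows "eigenvalue X \<mu>"
proof -
  obtain k where k: "(k, \<mu>) \<in> set n_as" using assms(3) by auto
  then have "k \<noteq> 0" using assms(1) by (force simp: jordan_nf_def)
  then have "order \<mu> (char_poly X) \<noteq> 0"
    using jordan_nf_block_size_order_bound[OF assms(1) k] by simp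
  then have "poly (char_poly X) \<mu> = 0" by (simp add: order_root)
  then show ?thesis using eigenvalue_root_char_poly[OF assms(2)] by simp
qed

lemma sum_sum_list_filter:
  assumes "finite S"
  shows "(\<Sum>\<mu>\<in>S. sum_list (map fst (filter (\<lambda>x. snd x = \<mu>) xs)))
    = sum_list (map fst (filter (\<lambda>x. snd x \<in> S) (xs :: (nat \<times> 'a) list)))"
proof (induction xs)
  case (Cons x xs)
  have "(\<Sum>\<mu>\<in>S. sum_list (map fst (filter (\<lambda>x. snd x = \<mu>) (x # xs))))
    = (\<Sum>\<mu>\<in>S. (if snd x = \<mu> then fst x else 0) + sum_list (map fst (filter (\<lambda>x. snd x = \<mu>) xs)))"
    by (intro sum.cong) auto
  then show ?case using assms Cons.IH by (simp add: sum.distrib sum.delta')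
qed simp

text \<open>The algebraic multiplicity of an eigenvalue is the total size of its blocks, so counting
  becomes a sum over a filtered block list; blocks are nonempty, hence each of them belongs to an
  actual eigenvalue.\<close>

lemma num_eigenvalues_eq:
  fixes M :: "real^'n^'n"
  assumes "jordan_nf (cmat M) n_as"
  shows "num_eigenvalues M R = sum_list (map fst (filter (\<lambda>x. R (snd x)) n_as))"
proof -
  let ?S = "{\<mu>. eigenvalue (cmat M) \<mu> \<and> R \<mu>}"
  have "coeff (char_poly (cmat M)) CARD('n) = 1"
    using degree_monic_char_poly[OF cmat_carrier[of M]] by (rule conjunct2)
  then have "char_poly (cmat M) \<noteq> 0" by (metis coeff_0 zero_neq_one)
  then have "finite {\<mu>. poly (char_poly (cmat M)) \<mu> = 0}" by (rule poly_roots_finite)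
  then have fin: "finite ?S"
    by (rule rev_finite_subset) (auto simp: eigenvalue_root_char_poly[OF cmat_carrier[of M]])
  have "num_eigenvalues M R = sum_list (map fst (filter (\<lambda>x. snd x \<in> ?S) n_as))"
    unfolding num_eigenvalues_def jordan_nf_order[OF assms] by (rule sum_sum_list_filter[OF fin])
  also have "filter (\<lambda>x. snd x \<in> ?S) n_as = filter (\<lambda>x. R (snd x)) n_as"
    using jordan_nf_eigenvalue[OF assms cmat_carrier] by (intro filter_cong) auto
  finally show ?thesis .
qed

lemma jordan_coordinates_exist:
  assumes "jordan_nf (cmat (M :: real^'n^'n)) n_as"
  obtains P Q where "jordan_coordinates M CARD('n) n_as P Q"
  using assms unfolding jordan_nf_def similar_mat_def jordan_coordinates_def by blast

lemma unstable_first_jordan_form: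
  fixes M :: "real^'n^'n"
  assumes "CARD('n) = u + s"
    and "num_eigenvalues M (\<lambda>\<mu>. Re \<mu> > 0) = u" and "num_eigenvalues M (\<lambda>\<mu>. Re \<mu> < 0) = s"
  obtains Ju Js where "jordan_nf (cmat M) (Ju @ Js)"
    "sum_list (map fst Ju) = u" "\<And>\<mu>. \<mu> \<in> snd ` set Ju \<Longrightarrow> Re \<mu> > 0"
    "sum_list (map fst Js) = s" "\<And>\<mu>. \<mu> \<in> snd ` set Js \<Longrightarrow> Re \<mu> < 0"
proof -
  obtain n_as where jnf: "jordan_nf (cmat M) n_as" using jordan_nf_cmat_exists by blast
  let ?Ju = "filter (\<lambda>x. Re (snd x) > 0) n_as"
  let ?Js = "filter (\<lambda>x. \<not> Re (snd x) > 0) n_as"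
  let ?J0 = "filter (\<lambda>x. Re (snd x) < 0) n_as"
  have Ju: "sum_list (map fst ?Ju) = u" and J0: "sum_list (map fst ?J0) = s"
    using num_eigenvalues_eq[OF jnf] assms(2,3) by auto
  have nf: "jordan_nf (cmat M) (?Ju @ ?Js)" by (rule jordan_nf_partition[OF jnf])
  obtain P Q where "jordan_coordinates M CARD('n) (?Ju @ ?Js) P Q"
    using jordan_coordinates_exist[OF nf] by blast
  then interpret jordan_coordinates M "CARD('n)" "?Ju @ ?Js" P Q .
  have Js: "sum_list (map fst ?Js) = s"
    using n_sum assms(1) Ju by simp
  have le: "sum_list (map fst (filter (\<lambda>x. Re (snd x) < 0) xs)) + sum_list (map fst (filter (\<lambda>x. Re (snd x) = 0) xs))
      = sum_list (map fst (filter (\<lambda>x. \<not> Re (snd x) > 0) xs))" for xs :: "(nat \<times> complex) list"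
    by (induction xs) auto
  \<comment> \<open>The two counts exhaust the dimension, so blocks with eigenvalue on the imaginary
    axis have total size 0; a normal form contains no empty block, hence there are none.\<close>
  have "sum_list (map fst (filter (\<lambda>x. Re (snd x) = 0) n_as)) = 0"
    using le[of n_as] Js J0 by simp
  then have "\<forall>k\<in>set (map fst (filter (\<lambda>x. Re (snd x) = 0) n_as)). k = 0"
    by (simp only: sum_list_eq_0_iff)
  then have "\<forall>x\<in>set n_as. Re (snd x) = 0 \<longrightarrow> fst x = 0" by fastforce
  then have "\<forall>x\<in>set n_as. Re (snd x) \<noteq> 0"
    using jnf by (force simp: jordan_nf_def)
  then have neg: "Re \<mu> < 0" if "\<mu> \<in> snd ` set ?Js" for \<mu>
    using that by fastforce
  have pos: "Re \<mu> > 0" if "\<mu> \<in> snd ` set ?Ju" for \<mu>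
    using that by auto
  show ?thesis by (rule that[OF nf Ju pos Js neg])
qed

section \<open>Eigenfunctions and invariant manifolds\<close>

locale center_hyperbolic =
  J: jordan_coordinates A nA n_as P Q + K: jordan_coordinates B nB m_as P' Q'
  for A :: "real^'m^'m" and B :: "real^'c^'c" and nA nB n_as m_as P Q P' Q' +
  fixes \<alpha> :: real
  assumes \<alpha>_pos: "\<alpha> > 0" and hyperbolic: "\<And>i. i < nA \<Longrightarrow> \<bar>Re (J.mu i)\<bar> \<ge> \<alpha>"
    and central: "\<And>i. i < nB \<Longrightarrow> Re (K.mu i) = 0"
begin

abbreviation Pu where "Pu \<equiv> J.proj (\<lambda>\<mu>. Re \<mu> > 0)"
abbreviation Ps where "Ps \<equiv> J.proj (\<lambda>\<mu>. \<not> Re \<mu> > 0)"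
abbreviation L where "L \<equiv> J.Lr (\<alpha> / 2)"
abbreviation Lc where "Lc \<equiv> K.Lr (\<alpha> / 16)"

text \<open>Rescaling by \<alpha>/2 costs half of the spectral gap and leaves the rate a =
  \<alpha>/2. In the centre the diagonal part vanishes, and \<alpha>/16 = a/8 is the bound that the
  splitting demands.\<close>

sublocale splitting "(*v) A" "(*v) B" Pu Ps Lc L "\<alpha> / 2"
proof (rule splitting.intro)
  show "linear ((*v) A)" "linear ((*v) B)" by (rule matrix_vector_mul_linear)+
  show "linear Pu" "linear Ps" by (rule J.linear_proj; simp)+
  show "linear Lc" "linear L" by (rule K.linear_Lr J.linear_Lr)+
  show "inj Lc" "inj L" using \<alpha>_pos by (auto intro!: K.inj_Lr J.inj_Lr)
  show "Pu y + Ps y = y" for y by (rule J.proj_compl) simp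
  show "Pu (Ps y) = 0" "Ps (Pu y) = 0" for y by (rule J.proj_proj_compl; simp)+
  show "Pu (A *v y) = A *v Pu y" "Ps (A *v y) = A *v Ps y" for y
    by (rule J.proj_matrix; simp)+
  show "\<alpha> / 2 > 0" using \<alpha>_pos by simp
  show "\<alpha> / 2 * (norm (L (Pu y)))\<^sup>2 \<le> inner (L (A *v Pu y)) (L (Pu y))" for y
  proof -
    have "Re (J.mu i) \<ge> \<alpha> \<or> J.l i (cvec (Pu y)) = 0" if "i < nA" for i
      using hyperbolic[OF that] J.l_proj[of "\<lambda>\<mu>. Re \<mu> > 0" i y] that by auto
    from J.inner_Lr_ge[of "\<alpha> / 2", OF _ this] show ?thesis using \<alpha>_pos by simp
  qed
  show "inner (L (A *v Ps y)) (L (Ps y)) \<le> - (\<alpha> / 2) * (norm (L (Ps y)))\<^sup>2" for y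
  proof -
    have "Re (J.mu i) \<le> - \<alpha> \<or> J.l i (cvec (Ps y)) = 0" if "i < nA" for i
      using hyperbolic[OF that] J.l_proj[of "\<lambda>\<mu>. \<not> Re \<mu> > 0" i y] that by auto
    from J.inner_Lr_le[of "\<alpha> / 2", OF _ this] show ?thesis using \<alpha>_pos by simp
  qed
  show "\<bar>inner (Lc (B *v x)) (Lc x)\<bar> \<le> \<alpha> / 2 / 8 * (norm (Lc x))\<^sup>2" for x
    using K.inner_Lr_matrix[of "\<alpha> / 16" x] \<alpha>_pos by (simp add: central)
qed

lemma palmer_system_if_small:
  "\<exists>\<epsilon>>0. \<forall>(g :: (real^'c) \<times> (real^'m) \<Rightarrow> real^'c) (h :: (real^'c) \<times> (real^'m) \<Rightarrow> real^'m) c1 c2 d1 d2.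
    bounded (range g) \<longrightarrow> bounded (range h) \<longrightarrow>
    (\<forall>x1 y1 x2 y2. norm (g (x1, y1) - g (x2, y2)) \<le> c1 * norm (x1 - x2) + c2 * norm (y1 - y2)) \<longrightarrow>
    (\<forall>x1 y1 x2 y2. norm (h (x1, y1) - h (x2, y2)) \<le> d1 * norm (x1 - x2) + d2 * norm (y1 - y2)) \<longrightarrow>
    c1 < \<epsilon> \<longrightarrow> c2 < \<epsilon> \<longrightarrow> d1 < \<epsilon> \<longrightarrow> d2 < \<epsilon> \<longrightarrow>
    palmer_system ((*v) A) ((*v) B) Pu Ps Lc L (\<alpha> / 2) g h (\<alpha> / 128)"
proof -
  obtain C where C: "C > 0" "\<And>z. (norm z)\<^sup>2 \<le> C * q z" by (rule norm_le_q) blast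
  obtain K1 where K1: "K1 > 0" "\<And>x. norm (Lc x) \<le> K1 * norm x"
    using linear_norm_le[OF linear_Lc] by blast
  obtain K2 where K2: "K2 > 0" "\<And>y. norm (L (Pu y)) \<le> K2 * norm y"
    using linear_norm_le[OF linear_compose[OF linear_Pu linear_L]] by (auto simp: o_def)
  obtain K3 where K3: "K3 > 0" "\<And>y. norm (L (Ps y)) \<le> K3 * norm y"
    using linear_norm_le[OF linear_compose[OF linear_Ps linear_L]] by (auto simp: o_def)
  define k where "k = K1 + K2 + K3"
  have k: "k > 0" "K1 \<le> k" "K2 \<le> k" "K3 \<le> k" using K1(1) K2(1) K3(1) by (auto simp: k_def)
  \<comment> \<open>Chosen so that 2 \<epsilon> sqrt C k = \<alpha>/128, which is a/64. Two
    constants below \<epsilon> give the Lipschitz constant 2 \<epsilon>, sqrt C passes from the norm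
    to sqrt q, and k bounds the coordinate maps.\<close>
  define \<epsilon> where "\<epsilon> = \<alpha> / 128 / (2 * sqrt C * k)"
  have \<epsilon>: "\<epsilon> > 0" using C(1) k(1) \<alpha>_pos by (simp add: \<epsilon>_def)
  have lip: "norm (f z - f w) \<le> 2 * \<epsilon> * norm (z - w)"
    if f: "\<And>x1 y1 x2 y2. norm (f (x1, y1) - f (x2, y2)) \<le> b1 * norm (x1 - x2) + b2 * norm (y1 - y2)"
      and b: "b1 < \<epsilon>" "b2 < \<epsilon>"
    for f :: "(real^'c) \<times> (real^'m) \<Rightarrow> 'r::real_normed_vector" and b1 b2 z w
  proof -
    have "norm (f z - f w) \<le> b1 * norm (fst z - fst w) + b2 * norm (snd z - snd w)"
      using f[of "fst z" "snd z" "fst w" "snd w"] by simp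
    also have "\<dots> \<le> \<epsilon> * norm (z - w) + \<epsilon> * norm (z - w)"
    proof (intro add_mono)
      show "b1 * norm (fst z - fst w) \<le> \<epsilon> * norm (z - w)"
        using b(1) \<epsilon> norm_fst_le[of "fst z - fst w" "snd z - snd w"]
        by (intro order_trans[OF mult_right_mono mult_left_mono]) (auto simp: minus_prod_def)
      show "b2 * norm (snd z - snd w) \<le> \<epsilon> * norm (z - w)"
        using b(2) \<epsilon> norm_snd_le[of "snd z - snd w" "fst z - fst w"]
        by (intro order_trans[OF mult_right_mono mult_left_mono]) (auto simp: minus_prod_def)
    qed
    finally show ?thesis by simp
  qed
  have small: "norm (T v) \<le> \<alpha> / 128 * sqrt (q (z - w))"
    if T: "norm (T v) \<le> K * norm v" "K \<le> k" and v: "norm v \<le> 2 * \<epsilon> * norm (z - w)"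
    for T :: "'r::real_normed_vector \<Rightarrow> 't::real_normed_vector" and v K z w
  proof -
    have "norm (z - w) \<le> sqrt (C * q (z - w))" by (rule real_le_rsqrt[OF C(2)])
    then have le: "norm (z - w) \<le> sqrt C * sqrt (q (z - w))" by (simp add: real_sqrt_mult)
    have "norm (T v) \<le> k * norm v"
      using T by (meson mult_right_mono norm_ge_zero order_trans)
    also have "\<dots> \<le> k * (2 * \<epsilon> * (sqrt C * sqrt (q (z - w))))"
      using k(1) \<epsilon> order_trans[OF v mult_left_mono[OF le]] by (intro mult_left_mono) auto
    also have "\<dots> = (\<epsilon> * (2 * sqrt C * k)) * sqrt (q (z - w))" by (simp only: mult_ac)
    also have "\<epsilon> * (2 * sqrt C * k) = \<alpha> / 128"
      unfolding \<epsilon>_def using C(1) k(1) by simp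
    finally show ?thesis .
  qed
  show ?thesis
  proof (intro exI[of _ \<epsilon>] conjI allI impI \<epsilon>)
    fix g :: "(real^'c) \<times> (real^'m) \<Rightarrow> real^'c" and h :: "(real^'c) \<times> (real^'m) \<Rightarrow> real^'m"
      and c1 c2 d1 d2
    assume bdd: "bounded (range g)" "bounded (range h)"
      and g: "\<forall>x1 y1 x2 y2. norm (g (x1, y1) - g (x2, y2)) \<le> c1 * norm (x1 - x2) + c2 * norm (y1 - y2)"
      and h: "\<forall>x1 y1 x2 y2. norm (h (x1, y1) - h (x2, y2)) \<le> d1 * norm (x1 - x2) + d2 * norm (y1 - y2)"
      and b: "c1 < \<epsilon>" "c2 < \<epsilon>" "d1 < \<epsilon>" "d2 < \<epsilon>"
    have gl: "norm (g z - g w) \<le> 2 * \<epsilon> * norm (z - w)" for z w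
      by (rule lip[OF g[rule_format] b(1,2)])
    have hl: "norm (h z - h w) \<le> 2 * \<epsilon> * norm (z - w)" for z w
      by (rule lip[OF h[rule_format] b(3,4)])
    have "(2 * \<epsilon>)-lipschitz_on UNIV g" "(2 * \<epsilon>)-lipschitz_on UNIV h"
      using gl hl \<epsilon> by (auto intro!: lipschitz_onI simp: dist_norm)
    moreover have "norm (Lc (g z - g w)) \<le> \<alpha> / 128 * sqrt (q (z - w))" for z w
      by (rule small[of Lc, OF K1(2) k(2) gl])
    moreover have "norm (L (Pu (h z - h w))) \<le> \<alpha> / 128 * sqrt (q (z - w))" for z w
      by (rule small[of "\<lambda>y. L (Pu y)", OF K2(2) k(3) hl])
    moreover have "norm (L (Ps (h z - h w))) \<le> \<alpha> / 128 * sqrt (q (z - w))" for z w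
      by (rule small[of "\<lambda>y. L (Ps y)", OF K3(2) k(4) hl])
    ultimately have "palmer_system_axioms Pu Ps Lc L (\<alpha> / 2) g h (\<alpha> / 128)"
      using \<alpha>_pos bdd by (intro palmer_system_axioms.intro) auto
    then show "palmer_system ((*v) A) ((*v) B) Pu Ps Lc L (\<alpha> / 2) g h (\<alpha> / 128)"
      by (intro palmer_system.intro splitting_axioms)
  qed
qed

end

section \<open>Splitting the linear system into its two blocks\<close>

lemma sum_lessThan_add:
  fixes f :: "nat \<Rightarrow> 'a::comm_monoid_add"
  shows "(\<Sum>i<u + s. f i) = (\<Sum>i<u. f i) + (\<Sum>i<s. f (u + i))"
  by (induction s) (simp_all add: add.assoc)

lemma jordan_matrix_append_index:
  fixes xs ys :: "(nat \<times> 'a::zero_neq_one) list"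
  defines "u \<equiv> sum_list (map fst xs)" and "s \<equiv> sum_list (map fst ys)"
  shows "i < u \<Longrightarrow> j < u \<Longrightarrow> jordan_matrix (xs @ ys) $$ (i, j) = jordan_matrix xs $$ (i, j)"
    and "i < u \<Longrightarrow> j < s \<Longrightarrow> jordan_matrix (xs @ ys) $$ (i, u + j) = 0"
    and "i < s \<Longrightarrow> j < u \<Longrightarrow> jordan_matrix (xs @ ys) $$ (u + i, j) = 0"
    and "i < s \<Longrightarrow> j < s \<Longrightarrow> jordan_matrix (xs @ ys) $$ (u + i, u + j) = jordan_matrix ys $$ (i, j)"
  unfolding jordan_matrix_append u_def s_def by (subst index_mat_four_block; simp)+

context jordan_coordinates
begin

lemma bounded_linear_l_cvec: "bounded_linear (\<lambda>y. l i (cvec y))"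
proof -
  have "linear (\<lambda>y. l i (cvec y))"
    by (rule linearI) (simp_all only: cvec_simps l_add l_smult scaleR_conv_of_real[where 'a = complex])
  then show ?thesis by (simp only: linear_conv_bounded_linear)
qed

lemma l_cvec_deriv:
  assumes "(y has_vector_derivative M *v y t) (at t)" "i < n"
  shows "((\<lambda>t. l i (cvec (y t))) has_vector_derivative (\<Sum>j<n. J $$ (i, j) * l j (cvec (y t)))) (at t)"
  using bounded_linear.has_vector_derivative[OF bounded_linear_l_cvec assms(1), of i] l_cM[OF assms(2), of "cvec (y t)"]
  by (simp only: cvec_matrix)

text \<open>The relation is known on real vectors only; it extends to the complex basis vector
  \<open>p j\<close> through real and imaginary parts, where it isolates the coefficient c
  j.\<close>

lemma l_cvec_independent:
  assumes "\<And>y. (\<Sum>i<n. c i * l i (cvec y)) = 0" and "j < n"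
  shows "c j = 0"
proof -
  define x y where "x = (\<chi> r. Re (p j $ r))" and "y = (\<chi> r. Im (p j $ r))"
  have "p j = cvec x + \<i> *s cvec y"
    by (simp add: x_def y_def Finite_Cartesian_Product.vec_eq_iff complex_eq_iff)
  then have "(\<Sum>i<n. c i * l i (p j)) = (\<Sum>i<n. c i * l i (cvec x)) + \<i> * (\<Sum>i<n. c i * l i (cvec y))"
    by (simp add: l_add l_smult sum.distrib sum_distrib_left distrib_left mult.left_commute)
  also have "\<dots> = 0" by (simp add: assms(1))
  also have "(\<Sum>i<n. c i * l i (p j)) = (\<Sum>i<n. if i = j then c j else 0)"
    using assms(2) by (intro sum.cong) (auto simp: l_p)
  finally show ?thesis using assms(2) by simp
qed

end

theorem proposition5p1:
  fixes B :: "real^'c^'c" and A :: "real^'m^'m" and u s :: nat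
  assumes "\<forall>\<mu>. eigenvalue (cmat B) \<mu> \<longrightarrow> Re \<mu> = 0"
    and "CARD('m) = u + s"
    and "num_eigenvalues A (\<lambda>\<mu>. Re \<mu> > 0) = u"
    and "num_eigenvalues A (\<lambda>\<mu>. Re \<mu> < 0) = s"
  shows "\<exists>\<epsilon>>0. \<forall>(g :: (real^'c) \<times> (real^'m) \<Rightarrow> real^'c) (h :: (real^'c) \<times> (real^'m) \<Rightarrow> real^'m) c1 c2 d1 d2.
    let F = coupled_field B A g h in
      F 0 = 0 \<and>
      (F has_derivative (\<lambda>(x, y). (B *v x, A *v y))) (at 0) \<and>
      bounded (range g) \<and> bounded (range h) \<and>
      (\<forall>x1 y1 x2 y2. norm (g (x1, y1) - g (x2, y2)) \<le> c1 * norm (x1 - x2) + c2 * norm (y1 - y2)) \<and>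
      (\<forall>x1 y1 x2 y2. norm (h (x1, y1) - h (x2, y2)) \<le> d1 * norm (x1 - x2) + d2 * norm (y1 - y2)) \<and>
      c1 < \<epsilon> \<and> c2 < \<epsilon> \<and> d1 < \<epsilon> \<and> d2 < \<epsilon>
      \<longrightarrow>
      (\<exists>gt H \<phi> J\<^sub>u J\<^sub>s.
        palmer_conjugacy B A F gt H \<and>
        jordan_nf (cmat A) (J\<^sub>u @ J\<^sub>s) \<and>
        sum_list (map fst J\<^sub>u) = u \<and> (\<forall>(k, \<mu>)\<in>set J\<^sub>u. Re \<mu> > 0) \<and>
        sum_list (map fst J\<^sub>s) = s \<and> (\<forall>(k, \<mu>)\<in>set J\<^sub>s. Re \<mu> < 0) \<and>
        gen_koopman_eigenfunctions F J\<^sub>u \<phi> \<and>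
        gen_koopman_eigenfunctions F J\<^sub>s (\<lambda>i. \<phi> (u + i)) \<and>
        (\<forall>a. (\<forall>z. (\<Sum>i<u + s. a i * \<phi> i z) = 0) \<longrightarrow> (\<forall>i<u + s. a i = 0)) \<and>
        {z. \<forall>i<u. \<phi> i z = 0} = center_stable_manifold A H \<and>
        {z. \<forall>i<u + s. \<phi> i z = 0} = center_manifold H \<and>
        unique_global_center_manifold F (center_manifold H) \<and>
        {z. \<forall>i\<in>{u..<u + s}. \<phi> i z = 0} = center_unstable_manifold A H)"
proof -
  obtain Ju Js where nf: "jordan_nf (cmat A) (Ju @ Js)"
    and Ju: "sum_list (map fst Ju) = u" "\<And>\<mu>. \<mu> \<in> snd ` set Ju \<Longrightarrow> Re \<mu> > 0"
    and Js: "sum_list (map fst Js) = s" "\<And>\<mu>. \<mu> \<in> snd ` set Js \<Longrightarrow> Re \<mu> < 0"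
    by (rule unstable_first_jordan_form[OF assms(2,3,4)]) blast
  obtain P Q where J: "jordan_coordinates A CARD('m) (Ju @ Js) P Q"
    by (rule jordan_coordinates_exist[OF nf])
  obtain m_as where nfB: "jordan_nf (cmat B) m_as" using jordan_nf_cmat_exists by blast
  obtain P' Q' where K: "jordan_coordinates B CARD('c) m_as P' Q'"
    by (rule jordan_coordinates_exist[OF nfB])
  interpret J: jordan_coordinates A "CARD('m)" "Ju @ Js" P Q by (rule J)
  interpret K: jordan_coordinates B "CARD('c)" m_as P' Q' by (rule K)
  have mu_u: "Re (J.mu i) > 0" if "i < u" for i
  proof -
    have "J.mu i = jordan_diag Ju ! i"
      using that Ju(1) by (simp add: J.mu_def jordan_diag_append nth_append)
    then have "J.mu i \<in> snd ` set Ju"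
      using that Ju(1) set_jordan_diag[of Ju] nth_mem[of i "jordan_diag Ju"] by auto
    then show ?thesis by (rule Ju(2))
  qed
  have mu_s: "Re (J.mu i) < 0" if "\<not> i < u" "i < u + s" for i
  proof -
    have "J.mu i = jordan_diag Js ! (i - u)"
      using that Ju(1) by (simp add: J.mu_def jordan_diag_append nth_append)
    then have "J.mu i \<in> snd ` set Js"
      using that Js(1) set_jordan_diag[of Js] nth_mem[of "i - u" "jordan_diag Js"] by auto
    then show ?thesis by (rule Js(2))
  qed
  \<comment> \<open>The spectral gap of \<open>A\<close>, capped at 1; the inserted 1 makes the set
    visibly nonempty for \<open>Min\<close>.\<close>
  define \<alpha> where "\<alpha> = Min (insert 1 ((\<lambda>i. \<bar>Re (J.mu i)\<bar>) ` {..<CARD('m)}))"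
  have "\<bar>Re (J.mu i)\<bar> > 0" if "i < CARD('m)" for i
    using mu_u[of i] mu_s[of i] that assms(2) by (cases "i < u") auto
  then have \<alpha>: "\<alpha> > 0" "\<And>i. i < CARD('m) \<Longrightarrow> \<alpha> \<le> \<bar>Re (J.mu i)\<bar>"
    unfolding \<alpha>_def by (subst Min_gr_iff) (auto intro!: Min_le)
  interpret center_hyperbolic A B "CARD('m)" "CARD('c)" "Ju @ Js" m_as P Q P' Q' \<alpha>
  proof (intro center_hyperbolic.intro center_hyperbolic_axioms.intro J K \<alpha>)
    fix i assume "i < CARD('c)"
    from jordan_nf_eigenvalue[OF nfB cmat_carrier K.mu_in[OF this]]
    show "Re (K.mu i) = 0" using assms(1) by blast
  qed
  obtain \<epsilon> where \<epsilon>: "\<epsilon> > 0" "\<And>g h c1 c2 d1 d2. bounded (range g) \<Longrightarrow> bounded (range h) \<Longrightarrow>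
    (\<forall>x1 y1 x2 y2. norm (g (x1, y1) - g (x2, y2)) \<le> c1 * norm (x1 - x2) + c2 * norm (y1 - y2)) \<Longrightarrow>
    (\<forall>x1 y1 x2 y2. norm (h (x1, y1) - h (x2, y2)) \<le> d1 * norm (x1 - x2) + d2 * norm (y1 - y2)) \<Longrightarrow>
    c1 < \<epsilon> \<Longrightarrow> c2 < \<epsilon> \<Longrightarrow> d1 < \<epsilon> \<Longrightarrow> d2 < \<epsilon> \<Longrightarrow>
    palmer_system ((*v) A) ((*v) B) Pu Ps Lc L (\<alpha> / 2) g h (\<alpha> / 128)"
    using palmer_system_if_small by blast
  show ?thesis
    unfolding Let_def
  proof (intro exI[of _ \<epsilon>] conjI[OF \<epsilon>(1)] allI impI, elim conjE)
    fix g :: "(real^'c) \<times> (real^'m) \<Rightarrow> real^'c" and h :: "(real^'c) \<times> (real^'m) \<Rightarrow> real^'m"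
      and c1 c2 d1 d2 :: real
    assume "bounded (range g)" "bounded (range h)"
      "\<forall>x1 y1 x2 y2. norm (g (x1, y1) - g (x2, y2)) \<le> c1 * norm (x1 - x2) + c2 * norm (y1 - y2)"
      "\<forall>x1 y1 x2 y2. norm (h (x1, y1) - h (x2, y2)) \<le> d1 * norm (x1 - x2) + d2 * norm (y1 - y2)"
      "c1 < \<epsilon>" "c2 < \<epsilon>" "d1 < \<epsilon>" "d2 < \<epsilon>"
    then interpret ps: palmer_system "(*v) A" "(*v) B" Pu Ps Lc L "\<alpha> / 2" g h "\<alpha> / 128"
      by (rule \<epsilon>(2))
    have F: "coupled_field B A g h = ps.F"
      by (rule ext) (simp add: coupled_field_def ps.F_def split_beta)
    define \<phi> where "\<phi> i z = J.l i (cvec (ps.Y z))" for i z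
    have sndH: "snd (ps.H z) = ps.Y z" for z by (simp add: ps.H_def)
    have \<phi>_cont: "continuous_on UNIV (\<phi> i)" for i
      unfolding \<phi>_def
      by (rule bounded_linear.continuous_on[OF J.bounded_linear_l_cvec ps.continuous_on_Y])
    have \<phi>_deriv: "((\<lambda>\<tau>. \<phi> i (ps.S \<tau> z)) has_vector_derivative
        (\<Sum>j<u + s. jordan_matrix (Ju @ Js) $$ (i, j) * \<phi> j (ps.S t z))) (at t)"
      if "i < u + s" for i z t
    proof -
      have i: "i < CARD('m)" using that assms(2) by simp
      show ?thesis
        unfolding \<phi>_def ps.Y_flow assms(2)[symmetric] by (rule J.l_cvec_deriv[OF li.flow_deriv i])
    qed
    have conj: "palmer_conjugacy B A ps.F ps.gc ps.H"
      unfolding palmer_conjugacy_def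
    proof (intro conjI allI)
      have "coupled_field B A (\<lambda>(x, y). ps.gc x) (\<lambda>_. 0) = (\<lambda>z. (B *v fst z + ps.gc (fst z), A *v snd z))"
        by (rule ext) (simp add: coupled_field_def split_beta)
      then show "ps.H (ps.S t z) = flow (coupled_field B A (\<lambda>(x, y). ps.gc x) (\<lambda>_. 0)) t (ps.H z)" for t z
        by (simp only: ps.H_flow)
    qed (rule ps.homeomorphism_H ps.bounded_gc ps.lipschitz_gc)+
    have koopman_u: "gen_koopman_eigenfunctions ps.F Ju \<phi>"
      unfolding gen_koopman_eigenfunctions_def Let_def koopman_def o_apply jordan_matrix_dim Ju(1)
    proof (intro allI impI conjI \<phi>_cont)
      fix i z t assume i: "i < u"
      \<comment> \<open>The Jordan matrix is block diagonal, so the unstable functions form a closed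
        linear system of their own.\<close>
      have "(\<Sum>j<u + s. jordan_matrix (Ju @ Js) $$ (i, j) * \<phi> j (ps.S t z))
          = (\<Sum>j<u. jordan_matrix Ju $$ (i, j) * \<phi> j (ps.S t z))"
        unfolding sum_lessThan_add
        using jordan_matrix_append_index(1,2)[of i Ju _ Js, unfolded Ju(1) Js(1)] i by simp
      then show "((\<lambda>\<tau>. \<phi> i (ps.S \<tau> z)) has_vector_derivative
          (\<Sum>j<u. jordan_matrix Ju $$ (i, j) * \<phi> j (ps.S t z))) (at t)"
        using \<phi>_deriv[of i z t] i by simp
    qed
    have koopman_s: "gen_koopman_eigenfunctions ps.F Js (\<lambda>i. \<phi> (u + i))"
      unfolding gen_koopman_eigenfunctions_def Let_def koopman_def o_apply jordan_matrix_dim Js(1)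
    proof (intro allI impI conjI \<phi>_cont)
      fix i z t assume i: "i < s"
      have "(\<Sum>j<u + s. jordan_matrix (Ju @ Js) $$ (u + i, j) * \<phi> j (ps.S t z))
          = (\<Sum>j<s. jordan_matrix Js $$ (i, j) * \<phi> (u + j) (ps.S t z))"
        unfolding sum_lessThan_add
        using jordan_matrix_append_index(3,4)[of i Js _ Ju, unfolded Ju(1) Js(1)] i by simp
      then show "((\<lambda>\<tau>. \<phi> (u + i) (ps.S \<tau> z)) has_vector_derivative
          (\<Sum>j<s. jordan_matrix Js $$ (i, j) * \<phi> (u + j) (ps.S t z))) (at t)"
        using \<phi>_deriv[of "u + i" z t] i by simp
    qed
    have independent: "\<forall>c. (\<forall>z. (\<Sum>i<u + s. c i * \<phi> i z) = 0) \<longrightarrow> (\<forall>i<u + s. c i = 0)"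
    proof (intro allI impI)
      fix c i assume c: "\<forall>z. (\<Sum>i<u + s. c i * \<phi> i z) = 0" and i: "i < u + s"
      have "(\<Sum>i<CARD('m). c i * J.l i (cvec y)) = 0" for y
      proof -
        \<comment> \<open>Surjectivity of the conjugacy makes every real y a value of
          \<open>Y\<close>, so a relation between eigenfunctions is one between coordinate
          functionals.\<close>
        obtain z where "(0, y) = ps.H z" using ps.surj_H unfolding surj_def by blast
        then have "y = ps.Y z" using sndH[of z] by (metis snd_conv)
        then show ?thesis using c unfolding \<phi>_def assms(2) by blast
      qed
      then show "c i = 0" using i assms(2) by (intro J.l_cvec_independent[of c i]) simp_all
    qed
    have cs: "{z. \<forall>i<u. \<phi> i z = 0} = center_stable_manifold A ps.H"
    proof -
      have "(\<forall>i<u. \<phi> i z = 0) \<longleftrightarrow> (\<forall>i<CARD('m). \<not> Re (J.mu i) < 0 \<longrightarrow> \<phi> i z = 0)" for z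
        unfolding assms(2) using mu_u mu_s by (meson less_asym trans_less_add1)
      then show ?thesis
        unfolding center_stable_manifold_def stable_subspace_def J.spectral_subspace_eq sndH \<phi>_def by simp
    qed
    have cu: "{z. \<forall>i\<in>{u..<u + s}. \<phi> i z = 0} = center_unstable_manifold A ps.H"
    proof -
      have "(\<forall>i\<in>{u..<u + s}. \<phi> i z = 0) \<longleftrightarrow> (\<forall>i<CARD('m). \<not> Re (J.mu i) > 0 \<longrightarrow> \<phi> i z = 0)" for z
        unfolding assms(2) using mu_u mu_s by (meson atLeastLessThan_iff less_asym not_less)
      then show ?thesis
        unfolding center_unstable_manifold_def unstable_subspace_def J.spectral_subspace_eq sndH \<phi>_def by simp
    qed
    have ce: "{z. \<forall>i<u + s. \<phi> i z = 0} = center_manifold ps.H"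
    proof -
      have "(\<forall>i<u + s. \<phi> i z = 0) \<longleftrightarrow> ps.Y z = 0" for z
      proof
        assume "\<forall>i<u + s. \<phi> i z = 0"
        then show "ps.Y z = 0"
          unfolding \<phi>_def
          by (intro J.eq_if_l_cvec_eq) (simp only: assms(2)[symmetric] cvec_simps J.l_0)
      next
        assume "ps.Y z = 0"
        then show "\<forall>i<u + s. \<phi> i z = 0" by (simp only: \<phi>_def cvec_simps J.l_0 simp_thms)
      qed
      then show ?thesis unfolding center_manifold_def sndH by simp
    qed
    have W: "center_manifold ps.H = {z. ps.Y z = 0}" by (simp only: center_manifold_def sndH)
    have "unique_global_center_manifold ps.F (center_manifold ps.H)"
      unfolding unique_global_center_manifold_def
    proof (intro conjI allI impI)
      have "ps.S t z \<in> {z. ps.Y z = 0}" if "z \<in> {z. ps.Y z = 0}" for t z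
        using that by (simp add: ps.Y_flow linear_0[OF li.linear_flow])
      then show "global_center_graph ps.F (center_manifold ps.H)"
        unfolding global_center_graph_def W
        using ps.continuous_on_v ps.bounded_v ps.center_manifold_graph by blast
      fix W' assume "global_center_graph ps.F W'"
      then obtain w where w: "bounded (range w)" "W' = range (\<lambda>x. (x, w x))"
        and inv: "\<And>t. ps.S t ` W' \<subseteq> W'"
        unfolding global_center_graph_def by blast
      from ps.center_manifold_unique[OF w(1) inv[unfolded w(2)]]
      show "W' = center_manifold ps.H" unfolding w(2) W .
    qed
    moreover have "\<forall>(k, \<mu>)\<in>set Ju. Re \<mu> > 0" "\<forall>(k, \<mu>)\<in>set Js. Re \<mu> < 0"
      using Ju(2) Js(2) by force+
    ultimately show "\<exists>gt H \<phi> J\<^sub>u J\<^sub>s.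
        palmer_conjugacy B A (coupled_field B A g h) gt H \<and>
        jordan_nf (cmat A) (J\<^sub>u @ J\<^sub>s) \<and>
        sum_list (map fst J\<^sub>u) = u \<and> (\<forall>(k, \<mu>)\<in>set J\<^sub>u. Re \<mu> > 0) \<and>
        sum_list (map fst J\<^sub>s) = s \<and> (\<forall>(k, \<mu>)\<in>set J\<^sub>s. Re \<mu> < 0) \<and>
        gen_koopman_eigenfunctions (coupled_field B A g h) J\<^sub>u \<phi> \<and>
        gen_koopman_eigenfunctions (coupled_field B A g h) J\<^sub>s (\<lambda>i. \<phi> (u + i)) \<and>
        (\<forall>a. (\<forall>z. (\<Sum>i<u + s. a i * \<phi> i z) = 0) \<longrightarrow> (\<forall>i<u + s. a i = 0)) \<and>
        {z. \<forall>i<u. \<phi> i z = 0} = center_stable_manifold A H \<and>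
        {z. \<forall>i<u + s. \<phi> i z = 0} = center_manifold H \<and>
        unique_global_center_manifold (coupled_field B A g h) (center_manifold H) \<and>
        {z. \<forall>i\<in>{u..<u + s}. \<phi> i z = 0} = center_unstable_manifold A H"
      unfolding F
      by (intro exI[of _ ps.gc] exI[of _ ps.H] exI[of _ \<phi>] exI[of _ Ju] exI[of _ Js] conjI
          conj nf Ju(1) Js(1) koopman_u koopman_s independent cs ce cu)
  qed
qed

end
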